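(* Let $\mathbb G$ be a homogeneous Carnot group, $p>1$, and assume $\Gamma_p$ is $L_p$-harmonic on $\mathbb G\setminus\{0\}$. Let $R>0$ and $\Omega=\{\xi\in\mathbb G:N_2(\xi)<R\}$. Then for every $u\in D^{1,p}_L(\Omega)$, $$\Big(\frac{p-1}{p}\Big)^p\int_\Omega\frac{|u|^p}{(R-N_2)^p}|\nabla_LN_2|^pd\xi\le\int_\Omega|\nabla_Lu|^pd\xi,$$ and the constant $((p-1)/p)^p$ is optimal. Moreover, for every $u\in D^{1,p}_L(\Omega)$, $$c^p\int_\Omega\frac{|u|^p}{\delta^p}|\nabla_LN_2|^pd\xi\le\int_\Omega|\nabla_Lu|^pd\xi,$$ where either (a) $\delta(\xi)=d_{CC}(\xi,\partial\Omega)$ and $c=\frac{p-1}{p}\frac1{C_2}$ with $C_2=\|\nabla_LN_2\|_{L^\infty}$, or (b) $\delta(\xi)=\inf_{\eta\in\partial\Omega}N_2(\xi^{-1}\eta)$ and $c=\frac{p-1}{p}$, provided $(\xi,\eta)\mapsto N_2(\xi^{-1}\eta)$ is a distance.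
   Context: A homogeneous Carnot group $\mathbb G=(\mathbb R^N,\circ,\delta_\lambda)$: $\mathbb R^N=\mathbb R^{n_1}\times\dots\times\mathbb R^{n_r}$, $\xi=(\xi^{(1)},\dots,\xi^{(r)})$, $\circ$ is a Lie group law on $\mathbb R^N$ for which the dilations $\delta_\lambda(\xi)=(\lambda\xi^{(1)},\lambda^2\xi^{(2)},\dots,\lambda^r\xi^{(r)})$ ($\lambda>0$) are group automorphisms; for $i=1,\dots,l:=n_1$, $X_i$ is the left-invariant vector field agreeing with $\partial/\partial\xi^{(1)}_i$ at the origin, and $X_1,\dots,X_l$ generate the whole Lie algebra of left-invariant vector fields. $\nabla_L=(X_1,\dots,X_l)^T$, $L_pu=\sum_{i=1}^lX_i(|\nabla_Lu|^{p-2}X_iu)$, and $Q=\sum_{i=1}^r i\,n_i$. $N_2$ is the homogeneous norm, smooth on $\mathbb G\setminus\{0\}$, such that $N_2^{2-Q}$ is a fundamental solution of $-L_2$ at $0$. For $p>1$ and $\xi\ne0$, $\Gamma_p(\xi)=N_2(\xi)^{(p-Q)/(p-1)}$ if $p\ne Q$ and $\Gamma_p(\xi)=-\ln N_2(\xi)$ if $p=Q$. $D^{1,p}_L(\Omega)$ is the closure of $C^\infty_0(\Omega)$ in the norm $(\int_\Omega|\nabla_Lu|^p)^{1/p}$. $d_{CC}$ is the Carnot–Carathéodory distance: $d_{CC}(\xi,\eta)$ is the infimum of $\int_a^b|\dot\gamma|$ over piecewise smooth curves $\gamma:[a,b]\to\mathbb R^N$ from $\xi$ to $\eta$ whose velocity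 lies (where defined) in the span of $X_1,\dots,X_l$; $d_{CC}(\xi,\partial\Omega)=\inf_{\eta\in\partial\Omega}d_{CC}(\xi,\eta)$. *)

theory Defs
  imports "HOL-Analysis.Analysis" "HOL-Probability.Essential_Supremum"
begin

definition pd :: "'a::euclidean_space \<Rightarrow> ('a \<Rightarrow> real) \<Rightarrow> 'a \<Rightarrow> real" where
  "pd b f x = deriv (\<lambda>t. f (x + t *\<^sub>R b)) 0"

fun iter_pd :: "'a::euclidean_space list \<Rightarrow> ('a \<Rightarrow> real) \<Rightarrow> 'a \<Rightarrow> real" where
  "iter_pd [] f = f"
| "iter_pd (b # bs) f = pd b (iter_pd bs f)"

definition smooth_on :: "'a::euclidean_space set \<Rightarrow> ('a \<Rightarrow> real) \<Rightarrow> bool" where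
  "smooth_on S f \<longleftrightarrow> (\<forall>bs. set bs \<subseteq> Basis \<longrightarrow>
      continuous_on S (iter_pd bs f) \<and>
      (\<forall>b\<in>Basis. \<forall>x\<in>S. (\<lambda>t. iter_pd bs f (x + t *\<^sub>R b)) differentiable (at 0)))"

definition smooth_map_on :: "'a::euclidean_space set \<Rightarrow> ('a \<Rightarrow> real^'n) \<Rightarrow> bool" where
  "smooth_map_on S F \<longleftrightarrow> (\<forall>j. smooth_on S (\<lambda>x. F x $ j))"

definition test_fun :: "'a::euclidean_space set \<Rightarrow> ('a \<Rightarrow> real) \<Rightarrow> bool" where
  "test_fun \<Omega> \<phi> \<longleftrightarrow> smooth_on UNIV \<phi> \<and>
     (\<exists>K. compact K \<and> K \<subseteq> \<Omega> \<and> (\<forall>x. x \<notin> K \<longrightarrow> \<phi> x = 0))"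

text \<open>The coordinates of R^N are indexed by the finite type 'n; deg i is the layer
  (degree of homogeneity) of coordinate i, so n_k = card {i. deg i = k}.\<close>

definition dil :: "('n::finite \<Rightarrow> nat) \<Rightarrow> real \<Rightarrow> real^'n \<Rightarrow> real^'n" where
  "dil deg s \<xi> = (\<chi> i. s ^ deg i * \<xi> $ i)"

definition horiz :: "('n::finite \<Rightarrow> nat) \<Rightarrow> 'n set" where
  "horiz deg = {i. deg i = 1}"

definition hom_dim :: "('n::finite \<Rightarrow> nat) \<Rightarrow> real" where
  "hom_dim deg = (\<Sum>i\<in>UNIV. real (deg i))"

text \<open>Left-invariant vector field X_i (agreeing with d/dx_i at the origin), acting on functions.\<close>
definition Xf :: "(real^'n \<Rightarrow> real^'n \<Rightarrow> real^'n) \<Rightarrow> 'n::finite \<Rightarrow> (real^'n \<Rightarrow> real) \<Rightarrow> real^'n \<Rightarrow> real" where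
  "Xf gmul i f \<xi> = deriv (\<lambda>t. f (gmul \<xi> (t *\<^sub>R axis i 1))) 0"

definition Vf :: "(real^'n \<Rightarrow> real^'n \<Rightarrow> real^'n) \<Rightarrow> 'n::finite \<Rightarrow> real^'n \<Rightarrow> real^'n" where
  "Vf gmul i \<xi> = vector_derivative (\<lambda>t. gmul \<xi> (t *\<^sub>R axis i 1)) (at 0)"

definition lie_bracket :: "(real^'n \<Rightarrow> real^'n) \<Rightarrow> (real^'n \<Rightarrow> real^'n) \<Rightarrow> real^'n \<Rightarrow> real^'n::finite" where
  "lie_bracket F G x = vector_derivative (\<lambda>t. G (x + t *\<^sub>R F x)) (at 0)
                      - vector_derivative (\<lambda>t. F (x + t *\<^sub>R G x)) (at 0)"

inductive_set iter_brackets :: "(real^'n \<Rightarrow> real^'n) set \<Rightarrow> (real^'n \<Rightarrow> real^'n::finite) set"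
  for A where
  gen: "F \<in> A \<Longrightarrow> F \<in> iter_brackets A"
| br: "F \<in> A \<Longrightarrow> G \<in> iter_brackets A \<Longrightarrow> lie_bracket F G \<in> iter_brackets A"

text \<open>Homogeneous Carnot group: a Lie group law on R^N (identity 0, necessarily, since it
  is fixed by all dilations), dilations are automorphisms, and X_1..X_l generate the Lie
  algebra of left-invariant vector fields (equivalently, since left-invariant fields are
  determined by their value at 0, iterated brackets span R^N at the origin).\<close>
definition carnot_group ::
  "(real^'n \<Rightarrow> real^'n \<Rightarrow> real^'n) \<Rightarrow> (real^'n \<Rightarrow> real^'n) \<Rightarrow> ('n::finite \<Rightarrow> nat) \<Rightarrow> bool" where
  "carnot_group gmul ginv deg \<longleftrightarrow>
     (\<forall>i. deg i \<ge> 1) \<and>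
     (\<forall>x y z. gmul (gmul x y) z = gmul x (gmul y z)) \<and>
     (\<forall>x. gmul 0 x = x \<and> gmul x 0 = x) \<and>
     (\<forall>x. gmul (ginv x) x = 0 \<and> gmul x (ginv x) = 0) \<and>
     smooth_map_on UNIV (\<lambda>z::(real^'n) \<times> (real^'n). gmul (fst z) (snd z)) \<and>
     smooth_map_on UNIV ginv \<and>
     (\<forall>s>0. \<forall>x y. dil deg s (gmul x y) = gmul (dil deg s x) (dil deg s y)) \<and>
     span ((\<lambda>F. F 0) ` iter_brackets (Vf gmul ` horiz deg)) = UNIV"

definition hgrad :: "(real^'n \<Rightarrow> real^'n \<Rightarrow> real^'n) \<Rightarrow> ('n::finite \<Rightarrow> nat) \<Rightarrow> (real^'n \<Rightarrow> real) \<Rightarrow> real^'n \<Rightarrow> real^'n" where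
  "hgrad gmul deg f \<xi> = (\<chi> i. if i \<in> horiz deg then Xf gmul i f \<xi> else 0)"

definition sublap :: "(real^'n \<Rightarrow> real^'n \<Rightarrow> real^'n) \<Rightarrow> ('n::finite \<Rightarrow> nat) \<Rightarrow> (real^'n \<Rightarrow> real) \<Rightarrow> real^'n \<Rightarrow> real" where
  "sublap gmul deg f \<xi> = (\<Sum>i\<in>horiz deg. Xf gmul i (Xf gmul i f) \<xi>)"

text \<open>N is a homogeneous norm, smooth off 0, with N^(2-Q) a fundamental solution of -L_2
  at 0 (distributional sense: L_2 (N^(2-Q)) = - Dirac_0).\<close>
definition fund_norm :: "(real^'n \<Rightarrow> real^'n \<Rightarrow> real^'n) \<Rightarrow> ('n::finite \<Rightarrow> nat) \<Rightarrow> (real^'n \<Rightarrow> real) \<Rightarrow> bool" where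
  "fund_norm gmul deg N \<longleftrightarrow>
     continuous_on UNIV N \<and> smooth_on (UNIV - {0}) N \<and>
     N 0 = 0 \<and> (\<forall>\<xi>. \<xi> \<noteq> 0 \<longrightarrow> N \<xi> > 0) \<and>
     (\<forall>s>0. \<forall>\<xi>. N (dil deg s \<xi>) = s * N \<xi>) \<and>
     (\<forall>\<phi>. test_fun UNIV \<phi> \<longrightarrow>
        integrable lebesgue (\<lambda>\<xi>. N \<xi> powr (2 - hom_dim deg) * sublap gmul deg \<phi> \<xi>) \<and>
        (\<integral>\<xi>. N \<xi> powr (2 - hom_dim deg) * (- sublap gmul deg \<phi> \<xi>) \<partial>lebesgue) = \<phi> 0)"

definition Gamma_p :: "('n::finite \<Rightarrow> nat) \<Rightarrow> (real^'n \<Rightarrow> real) \<Rightarrow> real \<Rightarrow> real^'n \<Rightarrow> real" where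
  "Gamma_p deg N p \<xi> = (if p \<noteq> hom_dim deg then N \<xi> powr ((p - hom_dim deg) / (p - 1))
                         else - ln (N \<xi>))"

definition Lp_harmonic :: "(real^'n \<Rightarrow> real^'n \<Rightarrow> real^'n) \<Rightarrow> ('n::finite \<Rightarrow> nat) \<Rightarrow> real \<Rightarrow> (real^'n) set \<Rightarrow> (real^'n \<Rightarrow> real) \<Rightarrow> bool" where
  "Lp_harmonic gmul deg p S f \<longleftrightarrow>
     (\<forall>\<phi>. test_fun S \<phi> \<longrightarrow>
        (\<integral>\<xi>. norm (hgrad gmul deg f \<xi>) powr (p - 2) * (hgrad gmul deg f \<xi> \<bullet> hgrad gmul deg \<phi> \<xi>) \<partial>lebesgue) = 0)"

text \<open>Elements of D^{1,p}_L(Omega) (closure of C_0^infinity(Omega) in the norm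
  (int |grad_L u|^p)^(1/p)), represented by the pair (u, grad_L u = g): there is a sequence
  of test functions whose horizontal gradients converge to g in L^p(Omega) and which
  converge to u in L^1_loc(Omega).\<close>
definition D1p :: "(real^'n \<Rightarrow> real^'n \<Rightarrow> real^'n) \<Rightarrow> ('n::finite \<Rightarrow> nat) \<Rightarrow> real \<Rightarrow> (real^'n) set
     \<Rightarrow> (real^'n \<Rightarrow> real) \<Rightarrow> (real^'n \<Rightarrow> real^'n) \<Rightarrow> bool" where
  "D1p gmul deg p \<Omega> u g \<longleftrightarrow>
     u \<in> borel_measurable lebesgue \<and> g \<in> borel_measurable lebesgue \<and>
     (\<exists>\<phi>::nat \<Rightarrow> real^'n \<Rightarrow> real. (\<forall>k. test_fun \<Omega> (\<phi> k)) \<and>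
        ((\<lambda>k. \<integral>\<^sup>+\<xi>\<in>\<Omega>. ennreal (norm (hgrad gmul deg (\<phi> k) \<xi> - g \<xi>) powr p) \<partial>lebesgue) \<longlonglongrightarrow> 0) \<and>
        (\<forall>K. compact K \<and> K \<subseteq> \<Omega> \<longrightarrow>
           ((\<lambda>k. \<integral>\<^sup>+\<xi>\<in>K. ennreal \<bar>\<phi> k \<xi> - u \<xi>\<bar> \<partial>lebesgue) \<longlonglongrightarrow> 0)))"

definition cc_lengths :: "(real^'n \<Rightarrow> real^'n \<Rightarrow> real^'n) \<Rightarrow> ('n::finite \<Rightarrow> nat) \<Rightarrow> real^'n \<Rightarrow> real^'n \<Rightarrow> real set" where
  "cc_lengths gmul deg \<xi> \<eta> = {L. \<exists>a b (\<gamma>::real \<Rightarrow> real^'n) (h::real \<Rightarrow> 'n \<Rightarrow> real) S.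
      a \<le> b \<and> \<gamma> a = \<xi> \<and> \<gamma> b = \<eta> \<and> \<gamma> piecewise_C1_differentiable_on {a..b} \<and> finite S \<and>
      (\<forall>t\<in>{a..b} - S. (\<gamma> has_vector_derivative (\<Sum>i\<in>horiz deg. h t i *\<^sub>R Vf gmul i (\<gamma> t))) (at t)) \<and>
      (\<lambda>t. sqrt (\<Sum>i\<in>horiz deg. (h t i)\<^sup>2)) integrable_on {a..b} \<and>
      L = integral {a..b} (\<lambda>t. sqrt (\<Sum>i\<in>horiz deg. (h t i)\<^sup>2))}"

definition d_CC :: "(real^'n \<Rightarrow> real^'n \<Rightarrow> real^'n) \<Rightarrow> ('n::finite \<Rightarrow> nat) \<Rightarrow> real^'n \<Rightarrow> real^'n \<Rightarrow> real" where
  "d_CC gmul deg \<xi> \<eta> = Inf (cc_lengths gmul deg \<xi> \<eta>)"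

definition is_distance :: "('a \<Rightarrow> 'a \<Rightarrow> real) \<Rightarrow> bool" where
  "is_distance d \<longleftrightarrow> (\<forall>x y. d x y = 0 \<longleftrightarrow> x = y) \<and> (\<forall>x y. d x y = d y x) \<and>
     (\<forall>x y z. d x z \<le> d x y + d y z)"

end

(*
  Since Gamma_p is a function of N with L_p Gamma_p = 0 off the origin, the horizontal vector field
  N^(1-Q) |grad N|^(p-2) grad N is divergence free there.  Testing it against f(N) |u|^p with
  f(r) = r^(Q-1) (R - r)^(1-p), whose derivative is at least (p-1) r^(Q-1) (R - r)^(-p), and applying
  Young's inequality pointwise gives the Hardy inequality with weight |grad N|^p / (R - N)^p.  It is
  sharp because |grad N| is homogeneous of degree 0: functions of N reduce to a one-dimensional
  quotient, and cutting off the formal extremal (R - r)^((p-1)/p) in the variable - ln (R - r) makes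
  the error as small as desired.

  For the other two weights it suffices that R - N is at most delta, respectively C_2 delta.  For the
  quasi-norm distance this is the triangle inequality.  For the Carnot-Caratheodory distance N grows
  at most at rate C_2 along horizontal curves, and every two points are joined by one (Chow).  The
  latter holds because horizontal integral curves are computed layer by layer, the tangent vectors of
  curves x c(t) x^(-1) with x reachable and c horizontal span the whole space by the bracket
  condition, and hence, by an open mapping theorem for maps differentiable at a point, the reachable
  subgroup contains a neighbourhood of 0, which the dilations expand to everything.
*)
theory Submission
  imports Defs "HOL-Real_Asymp.Real_Asymp"
begin

section \<open>Smooth functions\<close>

text \<open>Three irregularities shape the analytic half. \<open>N\<close> need not be smooth at the
  origin, and harmonicity is tested only off it; \<open>\<bar>u\<bar> powr p\<close> need not be
  smooth where \<open>u\<close> vanishes; a member of \<open>D1p\<close> is known only as a local L1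
  limit of test functions. Each is removed by its own limit: Fatou for the inner cutoff, a parameter
  \<open>\<eta>\<close> tending to 0 for the power, and Fatou along an a.e. convergent subsequence
  on compact sets for \<open>D1p\<close>. The constant comes from Young's inequality with a free
  scale. The divergence term supplies the coefficient p - 1; spending (p-1)^2/p of it on the mixed
  term leaves (p-1)/p, while the gradient carries (p/(p-1))^(p-1). The quotient is ((p-1)/p)^p.
  Chow's theorem serves twice: it makes \<open>d_CC\<close> an infimum of a nonempty set, and it
  yields \<open>C2 > 0\<close>, by joining a point to its dilate. The bracket condition speaks about
  the origin only, reachability about curves; a right-invariant frame links them, because bracketing
  with a left-invariant field merely differentiates coefficients in such a frame.\<close>

abbreviation has_pd :: "('a::euclidean_space \<Rightarrow> real) \<Rightarrow> 'a \<Rightarrow> real \<Rightarrow> 'a \<Rightarrow> bool" where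
  "has_pd f b D x \<equiv> ((\<lambda>t. f (x + t *\<^sub>R b)) has_real_derivative D) (at 0)"

lemma iter_pd_append: "iter_pd (bs @ [b]) f = iter_pd bs (pd b f)"
  by (induction bs) auto

lemma smooth_on_continuous: "smooth_on S f \<Longrightarrow> continuous_on S f"
  unfolding smooth_on_def by (metis empty_subsetI iter_pd.simps(1) list.set(1))

lemma smooth_on_pd: "smooth_on S f \<Longrightarrow> b \<in> Basis \<Longrightarrow> smooth_on S (pd b f)"
  unfolding smooth_on_def iter_pd_append[symmetric]
  by (metis Un_subset_iff empty_subsetI insert_subset list.set(1,2) set_append)

lemma smooth_on_has_pd:
  assumes "smooth_on S f" "b \<in> Basis" "x \<in> S"
  shows "has_pd f b (pd b f x) x"
proof -
  have "(\<lambda>t. iter_pd [] f (x + t *\<^sub>R b)) differentiable (at 0)"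
    using assms unfolding smooth_on_def by (metis empty_subsetI list.set(1))
  then show ?thesis
    unfolding pd_def by (simp add: DERIV_deriv_iff_real_differentiable)
qed

lemma smooth_on_ex_pd:
  "smooth_on S f \<Longrightarrow> b \<in> Basis \<Longrightarrow> \<exists>g. smooth_on S g \<and> (\<forall>x\<in>S. has_pd f b (g x) x)"
  by (intro exI[of _ "pd b f"]) (simp add: smooth_on_pd smooth_on_has_pd)

lemma smooth_on_subset: "smooth_on S f \<Longrightarrow> T \<subseteq> S \<Longrightarrow> smooth_on T f"
  unfolding smooth_on_def by (meson continuous_on_subset subsetD)

lemma smooth_on_Un: "smooth_on S f \<Longrightarrow> smooth_on T f \<Longrightarrow> open S \<Longrightarrow> open T \<Longrightarrow> smooth_on (S \<union> T) f"
  unfolding smooth_on_def by (auto intro: continuous_on_open_Un)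

lemma has_pd_cong_open:
  assumes "open S" "x \<in> S" "\<And>y. y \<in> S \<Longrightarrow> f y = g y"
  shows "has_pd f b D x \<longleftrightarrow> has_pd g b D x"
proof (rule DERIV_cong_ev[OF refl _ refl])
  have "((\<lambda>t. x + t *\<^sub>R b) \<longlongrightarrow> x + 0 *\<^sub>R b) (nhds 0)"
    by (intro tendsto_intros filterlim_ident)
  then have "eventually (\<lambda>t. x + t *\<^sub>R b \<in> S) (nhds 0)"
    using assms(1,2) topological_tendstoD by fastforce
  then show "eventually (\<lambda>t. f (x + t *\<^sub>R b) = g (x + t *\<^sub>R b)) (nhds 0)"
    by eventually_elim (use assms in auto)
qed

lemma has_pd_unique: "has_pd f b D x \<Longrightarrow> pd b f x = D"
  unfolding pd_def by (rule DERIV_imp_deriv)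

text \<open>\<open>iter_pd\<close> is built from the total \<open>deriv\<close>, so nothing is known
  about it off \<open>S\<close>. The class \<open>P\<close> therefore only has to contain functions
  that agree with the derivatives on \<open>S\<close>, and openness of \<open>S\<close> lets the
  agreement survive the next differentiation. Smoothness proofs reduce to finding a class closed
  under partial derivatives.\<close>

lemma smooth_on_coinduct:
  assumes S: "open S" and f: "P f"
    and step: "\<And>f. P f \<Longrightarrow> continuous_on S f \<and> (\<forall>b\<in>Basis. \<exists>g. P g \<and> (\<forall>x\<in>S. has_pd f b (g x) x))"
  shows "smooth_on S f"
proof -
  have *: "\<exists>g. P g \<and> (\<forall>x\<in>S. iter_pd bs f x = g x)" if "set bs \<subseteq> Basis" for bs
    using that
  proof (induction bs)
    case Nil
    then show ?case using f by auto
  next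
    case (Cons b bs)
    then obtain g where g: "P g" "\<And>x. x \<in> S \<Longrightarrow> iter_pd bs f x = g x" by auto
    obtain g' where g': "P g'" "\<And>x. x \<in> S \<Longrightarrow> has_pd g b (g' x) x"
      using step[OF g(1)] Cons.prems by auto
    have "iter_pd (b # bs) f x = g' x" if "x \<in> S" for x
      using has_pd_cong_open[where f = "iter_pd bs f" and g = g and b = b and D = "g' x", OF S that g(2)] g'(2)[OF that]
      by (simp add: has_pd_unique)
    then show ?case using g'(1) by blast
  qed
  show ?thesis
    unfolding smooth_on_def
  proof (intro allI impI conjI ballI)
    fix bs :: "'a list" assume "set bs \<subseteq> Basis"
    then obtain g where g: "P g" "\<And>x. x \<in> S \<Longrightarrow> iter_pd bs f x = g x" using * by blast
    show "continuous_on S (iter_pd bs f)"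
      using step[OF g(1)] g(2) by (simp cong: continuous_on_cong)
    fix b x assume b: "b \<in> (Basis::'a set)" and x: "x \<in> S"
    then obtain g' where "has_pd g b (g' x) x" using step[OF g(1)] by blast
    then have "has_pd (iter_pd bs f) b (g' x) x"
      using has_pd_cong_open[where f = "iter_pd bs f" and g = g and b = b and D = "g' x", OF S x g(2)] by blast
    then show "(\<lambda>t. iter_pd bs f (x + t *\<^sub>R b)) differentiable at 0"
      using real_differentiable_def by blast
  qed
qed

lemma smooth_onI:
  assumes "open S" "continuous_on S f"
    "\<And>b. b \<in> Basis \<Longrightarrow> \<exists>g. smooth_on S g \<and> (\<forall>x\<in>S. has_pd f b (g x) x)"
  shows "smooth_on S f"
proof (rule smooth_on_coinduct[where P = "\<lambda>h. smooth_on S h \<or> h = f"])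
  fix h assume "smooth_on S h \<or> h = f"
  then show "continuous_on S h \<and> (\<forall>b\<in>Basis. \<exists>g. (smooth_on S g \<or> g = f) \<and> (\<forall>x\<in>S. has_pd h b (g x) x))"
    using assms smooth_on_continuous smooth_on_ex_pd by metis
qed (use assms in auto)

lemma smooth_on_cong:
  assumes "open S" "smooth_on S f" "\<And>x. x \<in> S \<Longrightarrow> f x = g x"
  shows "smooth_on S g"
proof (rule smooth_onI)
  show "continuous_on S g"
    using smooth_on_continuous[OF assms(2)] assms(3) by (simp cong: continuous_on_cong)
  show "\<exists>h. smooth_on S h \<and> (\<forall>x\<in>S. has_pd g b (h x) x)" if "b \<in> Basis" for b
    using smooth_on_pd[OF assms(2) that] smooth_on_has_pd[OF assms(2) that]
      has_pd_cong_open[where f = f and g = g, OF assms(1) _ assms(3)] by blast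
qed (use assms in auto)

text \<open>The increment is split into moves along one basis vector at a time; the mean value
  theorem turns each into a partial derivative at a nearby point, whose deviation from the value at
  \<open>x\<close> is controlled by continuity.\<close>

lemma has_derivative_if_continuous_pd:
  fixes f :: "'a::euclidean_space \<Rightarrow> real"
  assumes S: "open S" and x: "x \<in> S"
    and pd: "\<And>b y. b \<in> Basis \<Longrightarrow> y \<in> S \<Longrightarrow> has_pd f b (f' b y) y"
    and cont: "\<And>b. b \<in> Basis \<Longrightarrow> continuous_on S (f' b)"
  shows "(f has_derivative (\<lambda>h. \<Sum>b\<in>Basis. (h \<bullet> b) * f' b x)) (at x)"
proof -
  have lin: "bounded_linear (\<lambda>h. \<Sum>b\<in>Basis. (h \<bullet> b) * f' b x)"
    by (intro bounded_linear_sum bounded_linear_mult_left[THEN bounded_linear_compose] bounded_linear_inner_left)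
  have *: "\<exists>d>0. \<forall>h. norm h < d \<longrightarrow>
      \<bar>f (x + h) - f x - (\<Sum>b\<in>Basis. (h \<bullet> b) * f' b x)\<bar> \<le> e * norm h" if "e > 0" for e
  proof -
    \<comment> \<open>Each of the \<open>DIM('a)\<close> coordinate moves costs at most
      \<open>e' * norm h\<close>.\<close>
    define e' where "e' = e / DIM('a)"
    have e': "e' > 0" using that unfolding e'_def by simp
    have "\<exists>d>0. ball x d \<subseteq> S \<and> (\<forall>b\<in>Basis. \<forall>y\<in>ball x d. \<bar>f' b y - f' b x\<bar> < e')"
    proof -
      have "\<forall>b\<in>Basis. eventually (\<lambda>y. dist (f' b y) (f' b x) < e') (nhds x)"
      proof
        fix b :: 'a assume b: "b \<in> Basis"
        have "isCont (f' b) x"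
          using cont[OF b] S x continuous_on_eq_continuous_at by blast
        then have "(f' b \<longlongrightarrow> f' b x) (nhds x)"
          by (simp add: isCont_def tendsto_at_iff_tendsto_nhds)
        then show "eventually (\<lambda>y. dist (f' b y) (f' b x) < e') (nhds x)"
          using tendstoD e' by blast
      qed
      then have "eventually (\<lambda>y. \<forall>b\<in>Basis. dist (f' b y) (f' b x) < e') (nhds x)"
        by (simp add: eventually_ball_finite_distrib)
      moreover have "eventually (\<lambda>y. y \<in> S) (nhds x)"
        using S x by (rule eventually_nhds_in_open)
      ultimately have "eventually (\<lambda>y. y \<in> S \<and> (\<forall>b\<in>Basis. dist (f' b y) (f' b x) < e')) (nhds x)"
        by eventually_elim auto
      then show ?thesis
        unfolding eventually_nhds_metric by (auto simp: dist_real_def dist_commute subset_iff)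
    qed
    then obtain d where d: "d > 0" "ball x d \<subseteq> S"
      and close: "\<And>b y. b \<in> Basis \<Longrightarrow> y \<in> ball x d \<Longrightarrow> \<bar>f' b y - f' b x\<bar> < e'" by blast
    have part: "\<bar>f (x + (\<Sum>b\<in>B. (h \<bullet> b) *\<^sub>R b)) - f x - (\<Sum>b\<in>B. (h \<bullet> b) * f' b x)\<bar> \<le> (\<Sum>b\<in>B. e' * \<bar>h \<bullet> b\<bar>)"
      if "B \<subseteq> Basis" "norm h < d" for B h
    proof -
      have "finite B" using that(1) finite_Basis finite_subset by blast
      then show ?thesis using that(1)
      proof (induction B)
        case empty
        then show ?case by simp
      next
        case (insert c B)
        define y where "y = x + (\<Sum>b\<in>B. (h \<bullet> b) *\<^sub>R b)"
        have c: "c \<in> Basis" using insert by auto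
        \<comment> \<open>Intermediate points have coordinates bounded by those of \<open>h\<close>,
          so the broken path stays in the ball where the partial derivatives are close to their
          values at \<open>x\<close>.\<close>
        have norm_le: "norm ((\<Sum>b\<in>B. (h \<bullet> b) *\<^sub>R b) + t *\<^sub>R c) \<le> norm h" if "\<bar>t\<bar> \<le> \<bar>h \<bullet> c\<bar>" for t
        proof (rule norm_le_componentwise)
          fix k :: 'a assume k: "k \<in> Basis"
          have "(\<Sum>b\<in>B. (h \<bullet> b) *\<^sub>R b) \<bullet> k = (\<Sum>b\<in>B. if b = k then h \<bullet> k else 0)"
            using insert.prems k
            by (auto simp: inner_sum_left inner_Basis subset_iff intro!: sum.cong)
          also have "\<dots> = (if k \<in> B then h \<bullet> k else 0)"
            using insert.hyps(1) by (simp add: sum.delta)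
          finally have "(\<Sum>b\<in>B. (h \<bullet> b) *\<^sub>R b) \<bullet> k = (if k \<in> B then h \<bullet> k else 0)" .
          then show "\<bar>((\<Sum>b\<in>B. (h \<bullet> b) *\<^sub>R b) + t *\<^sub>R c) \<bullet> k\<bar> \<le> \<bar>h \<bullet> k\<bar>"
            using that insert.hyps(2) c k by (auto simp: inner_add_left inner_Basis)
        qed
        have inb: "y + t *\<^sub>R c \<in> ball x d" if "\<bar>t\<bar> \<le> \<bar>h \<bullet> c\<bar>" for t
        proof -
          have "dist x (y + t *\<^sub>R c) = norm ((\<Sum>b\<in>B. (h \<bullet> b) *\<^sub>R b) + t *\<^sub>R c)"
            unfolding y_def dist_norm by (subst norm_minus_commute) (simp add: algebra_simps)
          then show ?thesis
            using norm_le[OF that] \<open>norm h < d\<close> by simp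
        qed
        have der: "((\<lambda>t. f (y + t *\<^sub>R c)) has_real_derivative f' c (y + t *\<^sub>R c)) (at t)" if "\<bar>t\<bar> \<le> \<bar>h \<bullet> c\<bar>" for t
        proof -
          have "has_pd f c (f' c (y + t *\<^sub>R c)) (y + t *\<^sub>R c)"
            using pd[OF c] inb[OF that] d(2) by blast
          then have "((\<lambda>s. f (y + (s + t) *\<^sub>R c)) has_real_derivative f' c (y + t *\<^sub>R c)) (at 0)"
            by (simp add: algebra_simps)
          then show ?thesis
            using DERIV_shift[of "\<lambda>s. f (y + s *\<^sub>R c)" _ 0 t] by simp
        qed
        have "\<exists>z. \<bar>z\<bar> \<le> \<bar>h \<bullet> c\<bar> \<and> f (y + (h \<bullet> c) *\<^sub>R c) - f y = (h \<bullet> c) * f' c (y + z *\<^sub>R c)"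
        proof -
          let ?k = "h \<bullet> c"
          have "((\<lambda>r. f (y + (?k * r) *\<^sub>R c)) has_real_derivative f' c (y + (?k * r) *\<^sub>R c) * ?k) (at r)"
            if "0 \<le> r" "r \<le> 1" for r
            by (rule DERIV_chain2[where f = "\<lambda>t. f (y + t *\<^sub>R c)", OF der])
              (use that in \<open>auto intro!: derivative_eq_intros simp: abs_mult mult_right_le_one_le\<close>)
          from MVT2[OF zero_less_one this] obtain r where r: "0 < r" "r < 1"
            "f (y + ?k *\<^sub>R c) - f y = ?k * f' c (y + (?k * r) *\<^sub>R c)" by (auto simp: mult.commute)
          then show ?thesis by (intro exI[of _ "?k * r"]) (auto simp: abs_mult mult_right_le_one_le)
        qed
        then obtain z where z: "\<bar>z\<bar> \<le> \<bar>h \<bullet> c\<bar>"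
          "f (y + (h \<bullet> c) *\<^sub>R c) - f y = (h \<bullet> c) * f' c (y + z *\<^sub>R c)" by blast
        have "\<bar>(h \<bullet> c) * f' c (y + z *\<^sub>R c) - (h \<bullet> c) * f' c x\<bar> \<le> e' * \<bar>h \<bullet> c\<bar>"
          using close[OF c inb[OF z(1)]]
          by (simp only: right_diff_distrib[symmetric] abs_mult mult.commute[of e']) (intro mult_left_mono, auto)
        moreover have "\<bar>f y - f x - (\<Sum>b\<in>B. (h \<bullet> b) * f' b x)\<bar> \<le> (\<Sum>b\<in>B. e' * \<bar>h \<bullet> b\<bar>)"
          using insert unfolding y_def by auto
        moreover have "x + (\<Sum>b\<in>insert c B. (h \<bullet> b) *\<^sub>R b) = y + (h \<bullet> c) *\<^sub>R c"
          using insert.hyps unfolding y_def by simp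
        ultimately show ?case
          using insert.hyps z(2) by (simp only: sum.insert not_False_eq_True)
      qed
    qed
    have "\<bar>f (x + h) - f x - (\<Sum>b\<in>Basis. (h \<bullet> b) * f' b x)\<bar> \<le> e * norm h" if "norm h < d" for h
    proof -
      have "\<bar>f (x + h) - f x - (\<Sum>b\<in>Basis. (h \<bullet> b) * f' b x)\<bar> \<le> (\<Sum>b\<in>Basis. e' * \<bar>h \<bullet> b\<bar>)"
        using part[OF subset_refl that] by (simp add: euclidean_representation)
      also have "\<dots> \<le> (\<Sum>b\<in>(Basis::'a set). e' * norm h)"
        using e' by (intro sum_mono mult_left_mono Basis_le_norm) auto
      also have "\<dots> = e * norm h" unfolding e'_def by simp
      finally show ?thesis .
    qed
    then show ?thesis using d(1) by blast
  qed
  show ?thesis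
    unfolding has_derivative_at_alt
  proof (intro conjI lin allI impI)
    fix e :: real assume "e > 0"
    then obtain d where d: "d > 0" "\<And>h. norm h < d \<Longrightarrow>
      \<bar>f (x + h) - f x - (\<Sum>b\<in>Basis. (h \<bullet> b) * f' b x)\<bar> \<le> e * norm h" using * by blast
    show "\<exists>d>0. \<forall>y. norm (y - x) < d \<longrightarrow>
        norm (f y - f x - (\<Sum>b\<in>Basis. ((y - x) \<bullet> b) * f' b x)) \<le> e * norm (y - x)"
      using d(1) d(2)[of "y - x" for y] by (intro exI[of _ d]) auto
  qed
qed

lemma smooth_on_has_derivative:
  fixes f :: "'a::euclidean_space \<Rightarrow> real"
  assumes "smooth_on S f" "open S" "x \<in> S"
  shows "(f has_derivative (\<lambda>h. \<Sum>b\<in>Basis. (h \<bullet> b) * pd b f x)) (at x)"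
  using assms by (intro has_derivative_if_continuous_pd[of S])
    (auto intro: smooth_on_has_pd smooth_on_continuous smooth_on_pd)

text \<open>Derivatives of products and composites leave a set of generators but stay in the algebra
  it generates. Only the generators then have to be differentiated; the sum and product rules do the
  rest.\<close>

inductive smooth_alg :: "('a::euclidean_space \<Rightarrow> real) set \<Rightarrow> ('a \<Rightarrow> real) \<Rightarrow> bool" for A where
  gen: "f \<in> A \<Longrightarrow> smooth_alg A f"
| add: "smooth_alg A f \<Longrightarrow> smooth_alg A g \<Longrightarrow> smooth_alg A (\<lambda>x. f x + g x)"
| mult: "smooth_alg A f \<Longrightarrow> smooth_alg A g \<Longrightarrow> smooth_alg A (\<lambda>x. f x * g x)"

lemma smooth_alg_sum:
  assumes "\<And>i. i \<in> I \<Longrightarrow> smooth_alg A (f i)" "smooth_alg A (\<lambda>x. 0)"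
  shows "smooth_alg A (\<lambda>x. \<Sum>i\<in>I. f i x)"
  using assms by (induction I rule: infinite_finite_induct) (auto intro: smooth_alg.add)

lemma smooth_alg_smooth:
  assumes S: "open S"
    and A: "\<And>f. f \<in> A \<Longrightarrow> continuous_on S f \<and> (\<forall>b\<in>Basis. \<exists>g. smooth_alg A g \<and> (\<forall>x\<in>S. has_pd f b (g x) x))"
    and f: "smooth_alg A f"
  shows "smooth_on S f"
proof (rule smooth_on_coinduct[OF S, where P = "smooth_alg A"])
  fix f assume "smooth_alg A f"
  then show "continuous_on S f \<and> (\<forall>b\<in>Basis. \<exists>g. smooth_alg A g \<and> (\<forall>x\<in>S. has_pd f b (g x) x))"
  proof induction
    case (gen f)
    then show ?case using A by auto
  next
    case (add f g)
    show ?case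
    proof (intro conjI ballI)
      fix b :: 'a assume "b \<in> Basis"
      with add.IH obtain f' g' where "smooth_alg A f'" "smooth_alg A g'"
        "\<And>x. x \<in> S \<Longrightarrow> has_pd f b (f' x) x" "\<And>x. x \<in> S \<Longrightarrow> has_pd g b (g' x) x" by meson
      then show "\<exists>h. smooth_alg A h \<and> (\<forall>x\<in>S. has_pd (\<lambda>x. f x + g x) b (h x) x)"
        by (intro exI[of _ "\<lambda>x. f' x + g' x"]) (auto intro!: smooth_alg.add DERIV_add)
    qed (use add.IH in \<open>auto intro: continuous_on_add\<close>)
  next
    case (mult f g)
    show ?case
    proof (intro conjI ballI)
      fix b :: 'a assume "b \<in> Basis"
      with mult.IH obtain f' g' where d: "smooth_alg A f'" "smooth_alg A g'"
        "\<And>x. x \<in> S \<Longrightarrow> has_pd f b (f' x) x" "\<And>x. x \<in> S \<Longrightarrow> has_pd g b (g' x) x" by meson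
      have "has_pd (\<lambda>x. f x * g x) b (f' x * g x + g' x * f x) x" if "x \<in> S" for x
        using DERIV_mult[OF d(3)[OF that] d(4)[OF that]] by simp
      then show "\<exists>h. smooth_alg A h \<and> (\<forall>x\<in>S. has_pd (\<lambda>x. f x * g x) b (h x) x)"
        using d mult.hyps
        by (intro exI[of _ "\<lambda>x. f' x * g x + g' x * f x"]) (auto intro!: smooth_alg.intros(2,3))
    qed (use mult.IH in \<open>auto intro: continuous_on_mult\<close>)
  qed
qed (fact f)

lemma smooth_on_const: "smooth_on S (\<lambda>x. c)"
proof -
  have "smooth_on UNIV (\<lambda>x::'a. c)"
  proof (rule smooth_on_coinduct[where P = "\<lambda>f. \<exists>c. f = (\<lambda>x. c)"])
    fix f :: "'a \<Rightarrow> real" assume "\<exists>c. f = (\<lambda>x. c)"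
    then show "continuous_on UNIV f \<and> (\<forall>b\<in>Basis. \<exists>g. (\<exists>c. g = (\<lambda>x. c)) \<and> (\<forall>x\<in>UNIV. has_pd f b (g x) x))"
      by (auto intro!: exI[of _ "\<lambda>x. 0"])
  qed auto
  then show ?thesis by (rule smooth_on_subset) simp
qed

lemma smooth_on_add:
  assumes "open S" "smooth_on S f" "smooth_on S g" shows "smooth_on S (\<lambda>x. f x + g x)"
    and smooth_on_mult: "smooth_on S (\<lambda>x. f x * g x)"
proof -
  have *: "smooth_on S h" if "smooth_alg {h. smooth_on S h} h" for h
    proof (rule smooth_alg_smooth[OF assms(1) _ that])
    fix f :: "'a \<Rightarrow> real" assume "f \<in> {h. smooth_on S h}"
    then have f: "smooth_on S f" by simp
    show "continuous_on S f \<and> (\<forall>b\<in>Basis. \<exists>g. smooth_alg {h. smooth_on S h} g \<and> (\<forall>x\<in>S. has_pd f b (g x) x))"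
      using smooth_on_ex_pd[OF f] smooth_on_continuous[OF f] by (metis mem_Collect_eq smooth_alg.gen)
  qed
  have gens: "smooth_alg {h. smooth_on S h} f" "smooth_alg {h. smooth_on S h} g"
    using assms by (auto intro!: smooth_alg.gen)
  show "smooth_on S (\<lambda>x. f x + g x)" by (rule *[OF smooth_alg.add[OF gens]])
  show "smooth_on S (\<lambda>x. f x * g x)" by (rule *[OF smooth_alg.mult[OF gens]])
qed

lemma smooth_on_sum:
  assumes "open S" "\<And>i. i \<in> I \<Longrightarrow> smooth_on S (f i)"
  shows "smooth_on S (\<lambda>x. \<Sum>i\<in>I. f i x)"
  using assms(2) by (induction I rule: infinite_finite_induct) (auto intro: smooth_on_add[OF assms(1)] smooth_on_const)

lemma smooth_on_minus: "open S \<Longrightarrow> smooth_on S f \<Longrightarrow> smooth_on S (\<lambda>x. - f x)"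
  using smooth_on_mult[of S "\<lambda>x. -1" f] by (simp add: smooth_on_const)

lemma smooth_on_diff: "open S \<Longrightarrow> smooth_on S f \<Longrightarrow> smooth_on S g \<Longrightarrow> smooth_on S (\<lambda>x. f x - g x)"
  using smooth_on_add[of S f "\<lambda>x. - g x"] smooth_on_minus by auto

lemma has_pd_bounded_linear:
  assumes "bounded_linear L" shows "has_pd L b (L b) x"
proof -
  interpret bounded_linear L by fact
  have "((\<lambda>t. L x + t * L b) has_real_derivative L b) (at 0)"
    by (auto intro!: derivative_eq_intros)
  then show ?thesis by (simp add: add scaleR)
qed

lemma smooth_on_bounded_linear:
  assumes "bounded_linear L" shows "smooth_on S L"
proof -
  have "smooth_on UNIV L"
    using has_pd_bounded_linear[OF assms] linear_continuous_on[OF assms] smooth_on_const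
    by (intro smooth_onI) blast+
  then show ?thesis by (rule smooth_on_subset) simp
qed

lemma smooth_on_compose:
  fixes f :: "'b::euclidean_space \<Rightarrow> real" and \<Phi> :: "'a::euclidean_space \<Rightarrow> 'b"
  assumes S: "open S" and T: "open T" and f: "smooth_on T f"
    and \<Phi>: "\<And>c. c \<in> Basis \<Longrightarrow> smooth_on S (\<lambda>x. \<Phi> x \<bullet> c)" and maps: "\<And>x. x \<in> S \<Longrightarrow> \<Phi> x \<in> T"
  shows "smooth_on S (\<lambda>x. f (\<Phi> x))"
proof -
  \<comment> \<open>By the chain rule a derivative of \<open>h (\<Phi> x)\<close> is a sum of
    products of a derivative of a component of \<open>\<Phi>\<close> and a partial derivative of
    \<open>h\<close> at \<open>\<Phi> x\<close>; both kinds of factor are generators.\<close>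
  let ?A = "{h. smooth_on S h} \<union> {\<lambda>x. h (\<Phi> x) | h. smooth_on T h}"
  have cont\<Phi>: "continuous_on S \<Phi>"
    using \<Phi> by (subst continuous_on_componentwise) (auto intro: smooth_on_continuous)
  have genS: "smooth_alg ?A h" if "smooth_on S h" for h
    using that by (intro smooth_alg.gen) simp
  have genT: "smooth_alg ?A (\<lambda>x. h (\<Phi> x))" if "smooth_on T h" for h
    using that by (intro smooth_alg.gen) auto
  have "smooth_alg ?A (\<lambda>x. f (\<Phi> x))" by (rule genT[OF f])
  then show ?thesis
  proof (rule smooth_alg_smooth[OF S, rotated])
    fix k assume "k \<in> ?A"
    then consider "smooth_on S k" | h where "smooth_on T h" "k = (\<lambda>x. h (\<Phi> x))" by auto
    then show "continuous_on S k \<and> (\<forall>b\<in>Basis. \<exists>g. smooth_alg ?A g \<and> (\<forall>x\<in>S. has_pd k b (g x) x))"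
    proof cases
      case 1
      then show ?thesis
        using smooth_on_ex_pd[OF 1] smooth_on_continuous[OF 1] genS by blast
    next
      case h: 2
      have "continuous_on S k"
        unfolding h(2) by (rule continuous_on_compose2[OF smooth_on_continuous[OF h(1)] cont\<Phi>])
          (use maps in auto)
      moreover have "\<exists>g. smooth_alg ?A g \<and> (\<forall>x\<in>S. has_pd k b (g x) x)" if b: "b \<in> Basis" for b
      proof (intro exI conjI ballI)
        let ?g = "\<lambda>x. \<Sum>c\<in>Basis. pd b (\<lambda>x. \<Phi> x \<bullet> c) x * pd c h (\<Phi> x)"
        show "smooth_alg ?A ?g"
        proof (intro smooth_alg_sum smooth_alg.mult)
          fix c :: 'b assume c: "c \<in> Basis"
          show "smooth_alg ?A (pd b (\<lambda>x. \<Phi> x \<bullet> c))"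
            by (rule genS[OF smooth_on_pd[OF \<Phi>[OF c] b]])
          show "smooth_alg ?A (\<lambda>x. pd c h (\<Phi> x))"
            by (rule genT[OF smooth_on_pd[OF h(1) c]])
        qed (intro genS smooth_on_const)
        fix x assume x: "x \<in> S"
        let ?d = "\<lambda>c. pd b (\<lambda>x. \<Phi> x \<bullet> c) x"
        have "((\<lambda>t. \<Phi> (x + t *\<^sub>R b)) has_derivative (\<lambda>t. \<Sum>c\<in>Basis. (t * ?d c) *\<^sub>R c)) (at 0)"
        proof (subst has_derivative_componentwise_within, intro ballI)
          fix c :: 'b assume c: "c \<in> Basis"
          have "((\<lambda>t. \<Phi> (x + t *\<^sub>R b) \<bullet> c) has_derivative (\<lambda>t. t * ?d c)) (at 0)"
            using smooth_on_has_pd[OF \<Phi>[OF c] b x]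
            by (simp only: has_field_derivative_def mult_commute_abs)
          then show "((\<lambda>t. \<Phi> (x + t *\<^sub>R b) \<bullet> c) has_derivative (\<lambda>t. (\<Sum>c\<in>Basis. (t * ?d c) *\<^sub>R c) \<bullet> c)) (at 0)"
            using c by simp
        qed
        from diff_chain_at[OF this, of h "\<lambda>v. \<Sum>c\<in>Basis. (v \<bullet> c) * pd c h (\<Phi> x)"]
          smooth_on_has_derivative[OF h(1) T maps[OF x]]
        have "((\<lambda>t. h (\<Phi> (x + t *\<^sub>R b))) has_derivative
            (\<lambda>t. \<Sum>c\<in>Basis. ((\<Sum>c\<in>Basis. (t * ?d c) *\<^sub>R c) \<bullet> c) * pd c h (\<Phi> x))) (at 0)"
          by (simp only: o_def scaleR_zero_left add_0_right)
        then show "has_pd k b (?g x) x"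
          unfolding h(2) has_field_derivative_def
          by (rule has_derivative_eq_rhs) (auto simp: sum_distrib_right sum_distrib_left mult_ac)
      qed
      ultimately show ?thesis by blast
    qed
  qed
qed

lemma smooth_on_real_compose:
  fixes h :: "real \<Rightarrow> real"
  assumes "open S" "open T" "smooth_on T h" "smooth_on S f" "\<And>x. x \<in> S \<Longrightarrow> f x \<in> T"
  shows "smooth_on S (\<lambda>x. h (f x))"
  by (rule smooth_on_compose[where \<Phi> = f, OF assms(1-3) _ assms(5)]) (use assms(4) in auto)

section \<open>Powers, the logarithm and the flat cutoff function\<close>

lemma has_pd_real: "has_pd f (1::real) D x \<longleftrightarrow> (f has_real_derivative D) (at x)"
  using DERIV_shift[of f D 0 x] by (simp only: add.commute[of 0] add_0_right add_0_left real_scaleR_def mult_1_right add.commute[of x])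

lemma smooth_on_powr: "smooth_on {0<..} (\<lambda>x::real. x powr a)"
proof (rule smooth_on_coinduct[where P = "\<lambda>f. \<exists>c a. f = (\<lambda>x. c * x powr a)"])
  show "\<exists>c b. (\<lambda>x. x powr a) = (\<lambda>x. c * x powr b)" by (rule exI[of _ 1]) auto
  fix f :: "real \<Rightarrow> real" assume "\<exists>c a. f = (\<lambda>x. c * x powr a)"
  then obtain c a where f: "f = (\<lambda>x. c * x powr a)" by blast
  have "has_pd f 1 (c * a * x powr (a - 1)) x" if "x > 0" for x
    unfolding has_pd_real f using that by (auto intro!: derivative_eq_intros)
  moreover have "continuous_on {0<..} f"
    unfolding f by (intro continuous_intros) auto
  ultimately show "continuous_on {0<..} f \<and>
      (\<forall>b\<in>Basis. \<exists>g. (\<exists>c a. g = (\<lambda>x. c * x powr a)) \<and> (\<forall>x\<in>{0<..}. has_pd f b (g x) x))"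
    unfolding Basis_real_def by (metis greaterThan_iff singletonD)
qed (rule open_greaterThan)

lemma smooth_on_ln: "smooth_on {0<..} (ln :: real \<Rightarrow> real)"
proof (rule smooth_onI)
  show "continuous_on {0<..} (ln :: real \<Rightarrow> real)" by (intro continuous_intros) auto
  have "has_pd ln 1 (x powr (-1)) x" if "x > 0" for x :: real
    unfolding has_pd_real using that
    by (auto intro!: derivative_eq_intros simp: powr_minus divide_inverse)
  then show "\<exists>g. smooth_on {0<..} g \<and> (\<forall>x\<in>{0<..}. has_pd ln b (g x) x)" if "b \<in> Basis" for b :: real
    using that smooth_on_powr[of "-1"] by auto
qed auto

text \<open>The classical flat function. Being nondecreasing matters as much as being smooth: the
  sign of its derivative is used in the weighted estimate.\<close>

definition exp_cutoff :: "real \<Rightarrow> real" where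
  "exp_cutoff x = (if x > 0 then exp (- 1 / x) else 0)"

lemma smooth_on_exp_cutoff: "smooth_on S exp_cutoff"
proof -
  \<comment> \<open>The functions \<open>q(1/x) exp(-1/x)\<close>, continued by 0, are closed under
    differentiation: the new polynomial is \<open>X^2 (q - q')\<close>, written
    \<open>[:0,0,1:] * (q - pderiv q)\<close>.\<close>
  define E where "E = (\<lambda>(q::real poly) x. if x > 0 then poly q (1 / x) * exp (- 1 / x) else (0::real))"
  have lim: "((\<lambda>x. poly q (1 / x) * exp (- 1 / x)) \<longlongrightarrow> 0) (at_right 0)" for q :: "real poly"
  proof -
    have "((\<lambda>y. poly q y / exp y) \<longlongrightarrow> 0) at_top"
    proof (induction q)
      case 0
      then show ?case by simp
    next
      case (pCons a q)
      have "((\<lambda>y::real. y ^ k / exp y) \<longlongrightarrow> 0) at_top" for k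
        by (rule tendsto_power_div_exp_0)
      have 1: "((\<lambda>y::real. (\<Sum>i\<le>degree (pCons a q). coeff (pCons a q) i * (y ^ i / exp y))) \<longlongrightarrow> (\<Sum>i\<le>degree (pCons a q). coeff (pCons a q) i * 0)) at_top"
        by (intro tendsto_intros tendsto_power_div_exp_0)
      then show ?case
        by (simp only: poly_altdef sum_divide_distrib) (simp add: times_divide_eq_right)
    qed
    then have "((\<lambda>x. poly q (inverse x) / exp (inverse x)) \<longlongrightarrow> 0) (at_right 0)"
      by (rule filterlim_compose[OF _ filterlim_inverse_at_top_right])
    then show ?thesis by (simp add: exp_minus divide_inverse)
  qed
  have der: "(E q has_real_derivative E ([:0,0,1:] * (q - pderiv q)) x) (at x)" for q x
  proof -
    consider "x > 0" | "x < 0" | "x = 0" by linarith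
    then show ?thesis
    proof cases
      case 1
      have "((\<lambda>x. poly q (1 / x) * exp (- 1 / x)) has_real_derivative E ([:0,0,1:] * (q - pderiv q)) x) (at x)"
        unfolding E_def using 1
        by (auto intro!: derivative_eq_intros simp: field_simps power2_eq_square)
      then show ?thesis
        by (rule has_field_derivative_transform_within_open[of _ _ _ "{0<..}"]) (use 1 in \<open>auto simp: E_def\<close>)
    next
      case 2
      have "((\<lambda>x. 0) has_real_derivative E ([:0,0,1:] * (q - pderiv q)) x) (at x)"
        unfolding E_def using 2 by auto
      then show ?thesis
        by (rule has_field_derivative_transform_within_open[of _ _ _ "{..<0}"]) (use 2 in \<open>auto simp: E_def\<close>)
    next
      case 3
      have "((\<lambda>h. (E q (0 + h) - E q 0) / h) \<longlongrightarrow> 0) (at 0)"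
      proof (rule filterlim_split_at)
        show "((\<lambda>h. (E q (0 + h) - E q 0) / h) \<longlongrightarrow> 0) (at_left 0)"
          by (rule tendsto_eventually) (auto simp: E_def eventually_at_filter)
        \<comment> \<open>From the right the difference quotient is again of this form, with
          \<open>X * q\<close> in place of \<open>q\<close>.\<close>
        show "((\<lambda>h. (E q (0 + h) - E q 0) / h) \<longlongrightarrow> 0) (at_right 0)"
          by (rule Lim_transform_eventually[OF lim[of "[:0,1:] * q"]])
            (auto simp: E_def eventually_at_filter)
      qed
      then show ?thesis using 3 by (simp add: DERIV_def E_def cong: if_cong)
    qed
  qed
  have "smooth_on UNIV exp_cutoff"
  proof (rule smooth_on_coinduct[where P = "\<lambda>f. \<exists>q. f = E q"])
    show "\<exists>q. exp_cutoff = E q" by (rule exI[of _ 1]) (auto simp: E_def exp_cutoff_def fun_eq_iff)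
    fix f assume "\<exists>q. f = E q"
    then obtain q where f: "f = E q" by blast
    have "continuous_on UNIV f"
      unfolding f using der DERIV_continuous_on by blast
    then show "continuous_on UNIV f \<and> (\<forall>b\<in>Basis. \<exists>g. (\<exists>q. g = E q) \<and> (\<forall>x\<in>UNIV. has_pd f b (g x) x))"
      using der unfolding f Basis_real_def by (force simp only: has_pd_real)
  qed auto
  then show ?thesis by (rule smooth_on_subset) simp
qed

lemma exp_cutoff_simps:
  "exp_cutoff x \<ge> 0" "exp_cutoff x \<le> 1" "x > 0 \<Longrightarrow> exp_cutoff x > 0" "x \<le> 0 \<Longrightarrow> exp_cutoff x = 0"
  by (auto simp: exp_cutoff_def)

lemma AE_lebesgue_neq: "AE x in (lebesgue :: 'a::euclidean_space measure). x \<noteq> a"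
  using AE_completion[OF AE_lborel_singleton] by blast

lemma test_fun_vanishing_outside:
  assumes S: "open S" "smooth_on S f" and K: "compact K" "K \<subseteq> S" "\<And>x. x \<notin> K \<Longrightarrow> f x = 0"
  shows "test_fun S f"
proof -
  have op: "open (- K)" using K(1) by (auto intro: compact_imp_closed)
  have "smooth_on (- K) f"
    by (rule smooth_on_cong[OF op smooth_on_const[of _ 0]]) (use K(3) in auto)
  then have "smooth_on (S \<union> - K) f" by (rule smooth_on_Un[OF S(2) _ S(1) op])
  moreover have "S \<union> - K = UNIV" using K(2) by auto
  ultimately show ?thesis unfolding test_fun_def using K by auto
qed

lemma exp_cutoff_mono: "x \<le> y \<Longrightarrow> exp_cutoff x \<le> exp_cutoff y"
  by (auto simp: exp_cutoff_def frac_le)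

section \<open>Carnot groups and homogeneous norms\<close>

lemma sum_Basis_vec: "(\<Sum>b\<in>(Basis::(real^'n) set). f b) = (\<Sum>i\<in>UNIV. f (axis i 1))"
proof -
  have B: "(Basis::(real^'n) set) = range (\<lambda>i. axis i 1)"
    by (auto simp: Basis_vec_def)
  have "inj (\<lambda>i::'n. axis i (1::real))"
    by (auto simp: inj_on_def axis_eq_axis)
  then show ?thesis unfolding B by (subst sum.reindex) (auto simp: o_def)
qed

lemma ball_Basis_vec: "(\<forall>b\<in>(Basis::(real^'n) set). P b) \<longleftrightarrow> (\<forall>i. P (axis i 1))"
  by (auto simp: Basis_vec_def)

lemma has_derivative_has_vector_pd:
  assumes "(f has_derivative D) (at x)"
  shows "((\<lambda>t. f (x + t *\<^sub>R b)) has_vector_derivative D b) (at 0)"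
proof -
  interpret D: bounded_linear D using assms by (rule has_derivative_bounded_linear)
  have "((\<lambda>t. x + t *\<^sub>R b) has_derivative (\<lambda>t. t *\<^sub>R b)) (at 0)"
    by (auto intro!: derivative_eq_intros)
  from diff_chain_at[OF this, of f D] assms
  show ?thesis
    by (simp add: has_vector_derivative_def o_def D.scaleR)
qed

lemma has_derivative_has_pd:
  fixes f :: "'a::euclidean_space \<Rightarrow> real"
  assumes "(f has_derivative D) (at x)"
  shows "has_pd f b (D b) x"
  using has_derivative_has_vector_pd[OF assms]
  by (simp add: has_real_derivative_iff_has_vector_derivative)

lemma vec_has_vector_derivative_iff:
  "(f has_vector_derivative D) (at x within S) \<longleftrightarrow>
    (\<forall>j. ((\<lambda>t. f t $ j :: real) has_real_derivative (D $ j)) (at x within S))"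
  unfolding has_vector_derivative_def has_field_derivative_def
  by (subst has_derivative_componentwise_within)
    (simp add: ball_Basis_vec inner_axis mult_commute_abs mult.commute)

lemma smooth_on_pair_compose:
  fixes f :: "(real^'m) \<times> (real^'n) \<Rightarrow> real"
  assumes "open S" "smooth_on UNIV f" "smooth_map_on S \<Phi>" "smooth_map_on S \<Psi>"
  shows "smooth_on S (\<lambda>x. f (\<Phi> x, \<Psi> x))"
proof (rule smooth_on_compose[OF assms(1) open_UNIV assms(2)])
  show "smooth_on S (\<lambda>x. (\<Phi> x, \<Psi> x) \<bullet> c)" if "c \<in> Basis" for c
    using that assms(3,4) by (auto simp: Basis_prod_def Basis_vec_def inner_axis smooth_map_on_def)
qed auto

lemma smooth_map_on_differentiable:
  assumes "smooth_map_on S \<Phi>" "open S" "x \<in> S"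
  shows "\<Phi> differentiable (at x)"
proof (subst differentiable_componentwise_within, intro ballI)
  fix b :: "real^'b" assume "b \<in> Basis"
  then obtain j where b: "b = axis j 1" by (auto simp: Basis_vec_def)
  show "(\<lambda>x. \<Phi> x \<bullet> b) differentiable at x"
    using smooth_on_has_derivative[of S "\<lambda>x. \<Phi> x $ j" x] assms
    by (auto simp: b inner_axis smooth_map_on_def differentiable_def)
qed

lemma smooth_map_on_continuous: "smooth_map_on S \<Phi> \<Longrightarrow> continuous_on S \<Phi>"
  by (subst continuous_on_componentwise)
    (auto simp: ball_Basis_vec inner_axis smooth_map_on_def intro: smooth_on_continuous)

lemma smooth_map_on_const: "smooth_map_on S (\<lambda>x. c)"
  by (simp add: smooth_map_on_def smooth_on_const)

lemma smooth_map_on_ident: "smooth_map_on S (\<lambda>x. x)"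
  unfolding smooth_map_on_def
  by (intro allI smooth_on_bounded_linear bounded_linear_vec_nth)

lemma smooth_on_differentiable:
  fixes f :: "'a::euclidean_space \<Rightarrow> real"
  shows "smooth_on S f \<Longrightarrow> open S \<Longrightarrow> x \<in> S \<Longrightarrow> f differentiable (at x)"
  using smooth_on_has_derivative differentiable_def by blast

lemma bounded_linear_dil: "bounded_linear (dil deg s)"
  unfolding linear_conv_bounded_linear[symmetric]
  by (rule linearI) (auto simp: dil_def vec_eq_iff algebra_simps)

lemma dil_dil: "dil deg s (dil deg t x) = dil deg (s * t) x"
  by (simp add: dil_def vec_eq_iff power_mult_distrib)

lemma dil_1 [simp]: "dil deg 1 x = x"
  by (simp add: dil_def vec_eq_iff)

lemma dil_0_right [simp]: "dil deg s 0 = 0"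
  by (simp add: dil_def vec_eq_iff)

lemma dil_axis: "dil deg s (t *\<^sub>R axis i 1) = (s ^ deg i * t) *\<^sub>R axis i 1"
  by (auto simp: dil_def vec_eq_iff axis_def)

lemma continuous_on_dil_scale: "continuous_on S (\<lambda>s. dil deg s x)"
  by (subst continuous_on_componentwise)
    (auto simp: ball_Basis_vec inner_axis dil_def intro!: continuous_intros)

locale carnot =
  fixes gmul :: "real^'n::finite \<Rightarrow> real^'n \<Rightarrow> real^'n" (infixl "\<odot>" 70)
    and ginv :: "real^'n \<Rightarrow> real^'n"
    and deg :: "'n \<Rightarrow> nat"
  assumes carnot: "carnot_group (\<odot>) ginv deg"
begin

abbreviation V :: "'n \<Rightarrow> real^'n \<Rightarrow> real^'n" where "V \<equiv> Vf (\<odot>)"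
abbreviation \<delta> :: "real \<Rightarrow> real^'n \<Rightarrow> real^'n" where "\<delta> \<equiv> dil deg"
abbreviation grad :: "(real^'n \<Rightarrow> real) \<Rightarrow> real^'n \<Rightarrow> real^'n" where "grad \<equiv> hgrad (\<odot>) deg"

lemma deg_ge_1: "deg i \<ge> 1"
  and gmul_assoc: "(x \<odot> y) \<odot> z = x \<odot> (y \<odot> z)"
  and gmul_0 [simp]: "0 \<odot> x = x" "x \<odot> 0 = x"
  and gmul_inv [simp]: "ginv x \<odot> x = 0" "x \<odot> ginv x = 0"
  and smooth_gmul: "smooth_map_on UNIV (\<lambda>z. fst z \<odot> snd z)"
  and smooth_ginv: "smooth_map_on UNIV ginv"
  and dil_gmul: "s > 0 \<Longrightarrow> \<delta> s (x \<odot> y) = \<delta> s x \<odot> \<delta> s y"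
  and bracket_generating: "span ((\<lambda>F. F 0) ` iter_brackets (V ` horiz deg)) = UNIV"
  using carnot unfolding carnot_group_def by auto

lemma dil_0_left: "\<delta> 0 x = 0"
  using deg_ge_1 by (auto simp: dil_def vec_eq_iff zero_power Suc_le_eq)

lemma dil_tendsto_0: "((\<lambda>s. \<delta> s x) \<longlongrightarrow> 0) (at_right 0)"
  using continuous_on_dil_scale[of UNIV deg x]
  by (simp add: continuous_on_def filterlim_at_split flip: dil_0_left[of x])

lemma gmul_inv_cancel [simp]: "ginv x \<odot> (x \<odot> y) = y" "x \<odot> (ginv x \<odot> y) = y"
  by (simp_all add: gmul_assoc[symmetric])

lemma ginv_unique: "x \<odot> y = 0 \<Longrightarrow> ginv x = y"
  by (metis gmul_0(2) gmul_inv_cancel(1))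

lemma ginv_0 [simp]: "ginv 0 = 0"
  by (rule ginv_unique) simp

lemma ginv_ginv [simp]: "ginv (ginv x) = x"
  by (rule ginv_unique) simp

lemma ginv_gmul: "ginv (x \<odot> y) = ginv y \<odot> ginv x"
  by (rule ginv_unique) (simp add: gmul_assoc)

lemma dil_ginv: "s > 0 \<Longrightarrow> \<delta> s (ginv x) = ginv (\<delta> s x)"
  by (rule ginv_unique[symmetric]) (simp add: dil_gmul[symmetric])

section \<open>Differentials of translations and left-invariant fields\<close>

definition Lder :: "real^'n \<Rightarrow> real^'n \<Rightarrow> real^'n \<Rightarrow> real^'n" where
  "Lder x y = frechet_derivative (\<lambda>z. x \<odot> z) (at y)"

definition Rder :: "real^'n \<Rightarrow> real^'n \<Rightarrow> real^'n \<Rightarrow> real^'n" where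
  "Rder x y = frechet_derivative (\<lambda>z. z \<odot> y) (at x)"

lemma gmul_has_derivative:
  shows "((\<lambda>z. x \<odot> z) has_derivative Lder x y) (at y)"
    and "((\<lambda>z. z \<odot> y) has_derivative Rder x y) (at x)"
    and "((\<lambda>z. fst z \<odot> snd z) has_derivative (\<lambda>z. Rder x y (fst z) + Lder x y (snd z))) (at (x, y))"
proof -
  obtain D where D: "((\<lambda>z. fst z \<odot> snd z) has_derivative D) (at (x, y))"
    using smooth_map_on_differentiable[OF smooth_gmul open_UNIV, of "(x, y)"] by (auto simp: differentiable_def)
  have "((\<lambda>z. (x, z)) has_derivative (\<lambda>v. (0, v))) (at y)"
    by (auto intro!: derivative_eq_intros)
  from diff_chain_at[OF this D] have 1: "((\<lambda>z. x \<odot> z) has_derivative (\<lambda>v. D (0, v))) (at y)"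
    by (simp add: o_def)
  have "((\<lambda>z. (z, y)) has_derivative (\<lambda>v. (v, 0))) (at x)"
    by (auto intro!: derivative_eq_intros)
  from diff_chain_at[OF this D] have 2: "((\<lambda>z. z \<odot> y) has_derivative (\<lambda>v. D (v, 0))) (at x)"
    by (simp add: o_def)
  show L: "((\<lambda>z. x \<odot> z) has_derivative Lder x y) (at y)"
    unfolding Lder_def using 1 frechet_derivative_works differentiable_def by blast
  show R: "((\<lambda>z. z \<odot> y) has_derivative Rder x y) (at x)"
    unfolding Rder_def using 2 frechet_derivative_works differentiable_def by blast
  have "D = (\<lambda>z. Rder x y (fst z) + Lder x y (snd z))"
  proof
    fix z
    have "D z = D ((fst z, 0) + (0, snd z))" by simp
    also have "\<dots> = D (fst z, 0) + D (0, snd z)"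
      using has_derivative_bounded_linear[OF D] by (metis bounded_linear.linear linear_add)
    finally show "D z = Rder x y (fst z) + Lder x y (snd z)"
      using has_derivative_unique[OF 1 L] has_derivative_unique[OF 2 R] by (metis (no_types))
  qed
  then show "((\<lambda>z. fst z \<odot> snd z) has_derivative (\<lambda>z. Rder x y (fst z) + Lder x y (snd z))) (at (x, y))"
    using D by simp
qed

lemma linear_Lder: "bounded_linear (Lder x y)" and linear_Rder: "bounded_linear (Rder x y)"
  using gmul_has_derivative has_derivative_bounded_linear by blast+

lemma Lder_0 [simp]: "Lder x y 0 = 0" and Rder_0 [simp]: "Rder x y 0 = 0"
  using linear_0 linear_Lder linear_Rder bounded_linear.linear by blast+

lemma gmul_comp_has_vector_derivative:
  assumes "(c has_vector_derivative c') (at t within S)" "(d has_vector_derivative d') (at t within S)"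
  shows "((\<lambda>t. c t \<odot> d t) has_vector_derivative (Rder (c t) (d t) c' + Lder (c t) (d t) d')) (at t within S)"
proof -
  have "((\<lambda>t. (c t, d t)) has_derivative (\<lambda>s. (s *\<^sub>R c', s *\<^sub>R d'))) (at t within S)"
    using assms unfolding has_vector_derivative_def by (rule has_derivative_Pair)
  from has_derivative_compose[OF this gmul_has_derivative(3)]
  show ?thesis
    by (simp add: has_vector_derivative_def o_def linear_scale[OF bounded_linear.linear[OF linear_Lder]]
        linear_scale[OF bounded_linear.linear[OF linear_Rder]] scaleR_add_right)
qed

lemma continuous_on_gmul [continuous_intros]:
  assumes "continuous_on S f" "continuous_on S g"
  shows "continuous_on S (\<lambda>x. f x \<odot> g x)"
  using continuous_on_compose2[OF smooth_map_on_continuous[OF smooth_gmul] continuous_on_Pair[OF assms] subset_UNIV]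
  by simp

lemma smooth_map_on_gmul:
  assumes "open S" "smooth_map_on S \<Phi>" "smooth_map_on S \<Psi>"
  shows "smooth_map_on S (\<lambda>x. \<Phi> x \<odot> \<Psi> x)"
  using smooth_on_pair_compose[OF assms(1) _ assms(2,3), of "\<lambda>z. (fst z \<odot> snd z) $ j" for j] smooth_gmul
  by (simp add: smooth_map_on_def)

text \<open>Written as partial derivatives of the jointly smooth product, the differentials of
  translations become smooth in both base points at once.\<close>

lemma Lder_pd: "Lder x y v $ j = pd (0, v) (\<lambda>z. (fst z \<odot> snd z) $ j) (x, y)"
  and Rder_pd: "Rder x y v $ j = pd (v, 0) (\<lambda>z. (fst z \<odot> snd z) $ j) (x, y)"
proof -
  have D: "((\<lambda>z. (fst z \<odot> snd z) $ j) has_derivative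
      (\<lambda>z. (Rder x y (fst z) + Lder x y (snd z)) $ j)) (at (x, y))"
    by (rule bounded_linear.has_derivative[OF bounded_linear_vec_nth gmul_has_derivative(3)])
  show "Lder x y v $ j = pd (0, v) (\<lambda>z. (fst z \<odot> snd z) $ j) (x, y)"
    using has_pd_unique[OF has_derivative_has_pd[OF D, of "(0, v)"]] by simp
  show "Rder x y v $ j = pd (v, 0) (\<lambda>z. (fst z \<odot> snd z) $ j) (x, y)"
    using has_pd_unique[OF has_derivative_has_pd[OF D, of "(v, 0)"]] by simp
qed

lemma smooth_map_on_der:
  assumes "open S" "smooth_map_on S \<Phi>" "smooth_map_on S \<Psi>"
  shows "smooth_map_on S (\<lambda>x. Lder (\<Phi> x) (\<Psi> x) (axis i 1))"
    and "smooth_map_on S (\<lambda>x. Rder (\<Phi> x) (\<Psi> x) (axis i 1))"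
proof -
  have "smooth_on UNIV (pd b (\<lambda>z. (fst z \<odot> snd z) $ j))" if "b \<in> Basis" for b j
    using smooth_gmul that by (auto simp: smooth_map_on_def intro: smooth_on_pd)
  moreover have "(0, axis i 1) \<in> (Basis :: ((real^'n) \<times> (real^'n)) set)" "(axis i 1, 0) \<in> (Basis :: ((real^'n) \<times> (real^'n)) set)"
    by (auto simp: Basis_prod_def Basis_vec_def)
  ultimately show "smooth_map_on S (\<lambda>x. Lder (\<Phi> x) (\<Psi> x) (axis i 1))"
    "smooth_map_on S (\<lambda>x. Rder (\<Phi> x) (\<Psi> x) (axis i 1))"
    unfolding smooth_map_on_def Lder_pd Rder_pd using smooth_on_pair_compose[OF assms(1) _ assms(2,3)] by blast+
qed

lemma V_has_vector_derivative:
  "((\<lambda>t. x \<odot> (t *\<^sub>R axis i 1)) has_vector_derivative Lder x 0 (axis i 1)) (at 0)"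
  using has_derivative_has_vector_pd[OF gmul_has_derivative(1), of x 0 "axis i 1"] by simp

lemma V_eq: "V i x = Lder x 0 (axis i 1)"
  unfolding Vf_def by (rule vector_derivative_at[OF V_has_vector_derivative])

lemma smooth_V: "smooth_map_on S (V i)"
proof -
  have "smooth_map_on UNIV (V i)"
    unfolding V_eq[abs_def] by (intro smooth_map_on_der smooth_map_on_const smooth_map_on_ident open_UNIV)
  then show ?thesis unfolding smooth_map_on_def by (auto intro: smooth_on_subset)
qed

lemma Xf_has_derivative:
  assumes "(f has_derivative f') (at x)"
  shows "((\<lambda>t. f (x \<odot> (t *\<^sub>R axis i 1))) has_real_derivative f' (V i x)) (at 0)"
proof -
  have "((\<lambda>t. f (x \<odot> (t *\<^sub>R axis i 1))) has_derivative (\<lambda>t. f' (t *\<^sub>R V i x))) (at 0)"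
    using diff_chain_at[of "\<lambda>t. x \<odot> (t *\<^sub>R axis i 1)" "\<lambda>t. t *\<^sub>R V i x" 0 f f']
      V_has_vector_derivative[of x i] assms
    by (simp add: o_def has_vector_derivative_def V_eq)
  then show ?thesis
    unfolding has_field_derivative_def
    by (simp add: linear_scale[OF has_derivative_linear[OF assms]] mult_commute_abs)
qed

lemma hgrad_eq:
  assumes "(f has_derivative f') (at x)"
  shows "grad f x = (\<chi> i. if i \<in> horiz deg then f' (V i x) else 0)"
  unfolding hgrad_def Xf_def using DERIV_imp_deriv[OF Xf_has_derivative[OF assms]]
  by (auto simp: vec_eq_iff)

lemma hgrad_compose:
  assumes "f differentiable (at x)" "(h has_real_derivative h') (at (f x))"
  shows "grad (\<lambda>x. h (f x)) x = h' *\<^sub>R grad f x"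
proof -
  obtain f' where f': "(f has_derivative f') (at x)" using assms(1) by (auto simp: differentiable_def)
  have "((\<lambda>x. h (f x)) has_derivative (\<lambda>v. h' * f' v)) (at x)"
    using diff_chain_at[OF f' assms(2)[unfolded has_field_derivative_def]] by (simp add: o_def)
  from hgrad_eq[OF this] hgrad_eq[OF f'] show ?thesis by (auto simp: vec_eq_iff)
qed

lemma hgrad_mult:
  assumes "f differentiable (at x)" "g differentiable (at x)"
  shows "grad (\<lambda>x. f x * g x) x = f x *\<^sub>R grad g x + g x *\<^sub>R grad f x"
proof -
  obtain f' where f': "(f has_derivative f') (at x)" using assms(1) by (auto simp: differentiable_def)
  obtain g' where g': "(g has_derivative g') (at x)" using assms(2) by (auto simp: differentiable_def)
  from hgrad_eq[OF has_derivative_mult[OF f' g']] hgrad_eq[OF f'] hgrad_eq[OF g']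
  show ?thesis by (auto simp: vec_eq_iff)
qed

lemma hgrad_cong_open:
  assumes "open S" "x \<in> S" "\<And>y. y \<in> S \<Longrightarrow> f y = g y" "f differentiable (at x)"
  shows "grad g x = grad f x"
proof -
  obtain f' where f': "(f has_derivative f') (at x)" using assms(4) by (auto simp: differentiable_def)
  have "(g has_derivative f') (at x)"
    by (rule has_derivative_transform_within_open[OF f' assms(1,2)]) (use assms(3) in auto)
  then show ?thesis using hgrad_eq f' by metis
qed

lemma hgrad_eq_0: "open S \<Longrightarrow> x \<in> S \<Longrightarrow> (\<And>y. y \<in> S \<Longrightarrow> f y = 0) \<Longrightarrow> grad f x = 0"
  using hgrad_cong_open[of S x "\<lambda>x. 0" f] hgrad_eq[of "\<lambda>x. 0" "\<lambda>x. 0" x]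
  by (auto simp: vec_eq_iff)

lemma Xf_smooth:
  assumes "smooth_on S f" "open S" "x \<in> S"
  shows "Xf (\<odot>) i f x = (\<Sum>j\<in>UNIV. V i x $ j * pd (axis j 1) f x)"
  unfolding Xf_def using DERIV_imp_deriv[OF Xf_has_derivative[OF smooth_on_has_derivative[OF assms]]]
  by (simp add: sum_Basis_vec inner_axis)

lemma continuous_on_hgrad:
  assumes "smooth_on S f" "open S"
  shows "continuous_on S (grad f)"
proof -
  have "continuous_on S (\<lambda>x. \<Sum>j\<in>UNIV. V i x $ j * pd (axis j 1) f x)" for i
    using smooth_V[of UNIV i] smooth_on_pd[OF assms(1), of "axis j 1" for j]
    by (intro continuous_intros) (auto simp: axis_in_Basis_iff
        intro: smooth_on_continuous smooth_map_on_continuous smooth_V)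
  then have "continuous_on S (Xf (\<odot>) i f)" for i
    using Xf_smooth[OF assms] by (simp cong: continuous_on_cong)
  then have "continuous_on S (\<lambda>x. if i \<in> horiz deg then Xf (\<odot>) i f x else 0)" for i
    by (cases "i \<in> horiz deg") auto
  then show ?thesis
    by (subst continuous_on_componentwise) (auto simp: hgrad_def ball_Basis_vec inner_axis)
qed

text \<open>A dilation is a homomorphism that maps the line along \<open>axis i 1\<close> to itself
  with speed \<open>s ^ deg i\<close>; the dilated curve is differentiated in both
  descriptions.\<close>

lemma dil_V:
  assumes "s > 0"
  shows "\<delta> s (V i x) = s ^ deg i *\<^sub>R V i (\<delta> s x)"
proof -
  have 1: "((\<lambda>t. \<delta> s (x \<odot> (t *\<^sub>R axis i 1))) has_vector_derivative \<delta> s (V i x)) (at 0)"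
    using bounded_linear.has_vector_derivative[OF bounded_linear_dil V_has_vector_derivative]
    by (simp add: V_eq)
  have "((\<lambda>t. \<delta> s x \<odot> (t *\<^sub>R axis i 1)) \<circ> (\<lambda>t. s ^ deg i * t) has_vector_derivative s ^ deg i *\<^sub>R V i (\<delta> s x)) (at 0)"
    by (rule vector_diff_chain_at) (auto intro!: derivative_eq_intros simp: V_has_vector_derivative V_eq)
  then have "((\<lambda>t. \<delta> s (x \<odot> (t *\<^sub>R axis i 1))) has_vector_derivative s ^ deg i *\<^sub>R V i (\<delta> s x)) (at 0)"
    using assms by (simp add: o_def dil_gmul dil_axis)
  from vector_derivative_at[OF this] vector_derivative_at[OF 1] show ?thesis by simp
qed

text \<open>The components of a horizontal field are smooth at the origin and homogeneous of degree
  one less than the layer; a derivative that would have to be homogeneous of negative degree vanishes.\<close>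
lemma pd_V_eq_0:
  assumes i: "i \<in> horiz deg" and jk: "deg j \<le> deg k"
  shows "pd (axis k 1) (\<lambda>x. V i x $ j) x = 0"
proof -
  let ?f = "\<lambda>x. V i x $ j" and ?e = "axis k 1 :: real^'n"
  have e: "?e \<in> Basis" by (simp add: axis_in_Basis_iff)
  have sm: "smooth_on UNIV ?f" using smooth_V by (simp add: smooth_map_on_def)
  have eq: "pd ?e ?f x = s ^ (1 + deg k - deg j) * pd ?e ?f (\<delta> s x)" if "s > 0" for s
  proof -
    have hom: "s ^ deg j * ?f y = s * ?f (\<delta> s y)" for y
      using arg_cong[OF dil_V[OF that, of i y], of "\<lambda>v. v $ j"] i by (simp add: dil_def horiz_def)
    have "((\<lambda>t. s ^ deg j * ?f (x + t *\<^sub>R ?e)) has_real_derivative s ^ deg j * pd ?e ?f x) (at 0)"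
      using smooth_on_has_pd[OF sm e, of x] by (intro DERIV_cmult) simp
    moreover have "(((\<lambda>t. ?f (\<delta> s x + t *\<^sub>R ?e)) \<circ> (\<lambda>t. s ^ deg k * t)) has_real_derivative pd ?e ?f (\<delta> s x) * s ^ deg k) (at 0)"
      using smooth_on_has_pd[OF sm e, of "\<delta> s x"]
      by (intro DERIV_chain) (auto intro!: derivative_eq_intros)
    then have "((\<lambda>t. s * ?f (\<delta> s (x + t *\<^sub>R ?e))) has_real_derivative s * (pd ?e ?f (\<delta> s x) * s ^ deg k)) (at 0)"
      by (intro DERIV_cmult)
        (simp add: o_def linear_add[OF bounded_linear.linear[OF bounded_linear_dil]] dil_axis)
    ultimately have "s ^ deg j * pd ?e ?f x = s * (pd ?e ?f (\<delta> s x) * s ^ deg k)"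
      unfolding hom by (rule DERIV_unique)
    moreover have "s * s ^ deg k = s ^ deg j * s ^ (1 + deg k - deg j)"
      using jk by (simp add: power_add[symmetric])
    ultimately have "s ^ deg j * pd ?e ?f x = s ^ deg j * (s ^ (1 + deg k - deg j) * pd ?e ?f (\<delta> s x))"
      by (simp add: mult_ac)
    then show ?thesis using that by simp
  qed
  have "isCont (pd ?e ?f) 0"
    using smooth_on_continuous[OF smooth_on_pd[OF sm e]] by (simp add: continuous_on_eq_continuous_at)
  with dil_tendsto_0[of x] have "((\<lambda>s. pd ?e ?f (\<delta> s x)) \<longlongrightarrow> pd ?e ?f 0) (at_right 0)"
    using isCont_tendsto_compose by metis
  then have "((\<lambda>s. s ^ (1 + deg k - deg j) * pd ?e ?f (\<delta> s x)) \<longlongrightarrow> 0 ^ (1 + deg k - deg j) * pd ?e ?f 0) (at_right 0)"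
    by (intro tendsto_intros)
  moreover have "(0::real) ^ (1 + deg k - deg j) = 0" using jk by (simp add: zero_power)
  ultimately have "((\<lambda>s. s ^ (1 + deg k - deg j) * pd ?e ?f (\<delta> s x)) \<longlongrightarrow> 0) (at_right 0)"
    by (simp only: mult_zero_left)
  then have "((\<lambda>s::real. pd ?e ?f x) \<longlongrightarrow> 0) (at_right 0)"
    by (rule Lim_transform_eventually)
      (simp only: eventually_at_filter, rule always_eventually, use eq in auto)
  then show ?thesis by (simp add: tendsto_const_iff)
qed

text \<open>On the segment from \<open>x\<close> to \<open>y\<close> only coordinates in layers
  \<open>deg j\<close> and above move, and the component has zero derivative in those
  directions.\<close>

lemma V_depends_on_lower:
  assumes i: "i \<in> horiz deg" and eq: "\<And>k. deg k < deg j \<Longrightarrow> x $ k = y $ k"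
  shows "V i x $ j = V i y $ j"
proof -
  let ?f = "\<lambda>x. V i x $ j"
  have sm: "smooth_on UNIV ?f" using smooth_V by (simp add: smooth_map_on_def)
  have "((\<lambda>t. ?f (x + t *\<^sub>R (y - x))) has_real_derivative 0) (at t)" for t
  proof -
    have D0: "(\<Sum>b\<in>Basis. ((y - x) \<bullet> b) * pd b ?f z) = 0" for z
      unfolding sum_Basis_vec using pd_V_eq_0[OF i] eq
      by (intro sum.neutral ballI) (auto simp: inner_axis, metis leI)
    have "has_pd ?f (y - x) 0 (x + t *\<^sub>R (y - x))"
      using has_derivative_has_pd[OF smooth_on_has_derivative[OF sm open_UNIV], of "x + t *\<^sub>R (y - x)" "y - x"] D0
      by simp
    then have "((\<lambda>s. ?f (x + (s + t) *\<^sub>R (y - x))) has_real_derivative 0) (at 0)"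
      by (simp add: algebra_simps)
    then show ?thesis
      using DERIV_shift[of "\<lambda>s. ?f (x + s *\<^sub>R (y - x))" _ 0 t] by simp
  qed
  then have "?f (x + 1 *\<^sub>R (y - x)) = ?f (x + 0 *\<^sub>R (y - x))"
    using DERIV_isconst_all[of "\<lambda>t. ?f (x + t *\<^sub>R (y - x))"] by blast
  then show ?thesis by simp
qed

lemma ex_dil_norm_1:
  assumes "x \<noteq> 0"
  obtains s where "s > 0" "norm (\<delta> s x) = 1"
proof -
  obtain i where i: "x $ i \<noteq> 0" using assms by (auto simp: vec_eq_iff)
  \<comment> \<open>\<open>b \<ge> 1\<close> gives \<open>b ^ deg i \<ge> b\<close>, and
    \<open>b * \<bar>x $ i\<bar> \<ge> 1\<close> then brings coordinate \<open>i\<close> of the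
    dilated point to absolute value at least 1, the upper end for the intermediate value
    theorem.\<close>
  define b where "b = max 1 (1 / \<bar>x $ i\<bar>)"
  have b: "b \<ge> 1" "b * \<bar>x $ i\<bar> \<ge> 1" using i by (auto simp: b_def field_simps max_def)
  have "1 \<le> b ^ deg i * \<bar>x $ i\<bar>"
    using b self_le_power[OF b(1), of "deg i"] deg_ge_1[of i] by (smt (verit) mult_right_mono abs_ge_zero zero_less_one less_le_trans)
  also have "\<dots> = \<bar>\<delta> b x $ i\<bar>" using b by (simp add: dil_def abs_mult)
  also have "\<dots> \<le> norm (\<delta> b x)" by (rule component_le_norm_cart)
  finally have 1: "1 \<le> norm (\<delta> b x)" .
  have "\<exists>s\<ge>0. s \<le> b \<and> norm (\<delta> s x) = 1"
    using b 1 by (intro IVT') (auto simp: dil_0_left intro!: continuous_intros continuous_on_dil_scale)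
  then obtain s where "s \<ge> 0" "norm (\<delta> s x) = 1" by blast
  moreover from this have "s \<noteq> 0" by (auto simp: dil_0_left)
  ultimately show ?thesis using that[of s] by simp
qed

end

locale carnot_norm = carnot gmul ginv deg
  for gmul :: "real^'n::finite \<Rightarrow> real^'n \<Rightarrow> real^'n" (infixl "\<odot>" 70)
    and ginv :: "real^'n \<Rightarrow> real^'n"
    and deg :: "'n \<Rightarrow> nat" +
  fixes N :: "real^'n \<Rightarrow> real"
  assumes fund_norm: "fund_norm (\<odot>) deg N"
begin

lemma continuous_N: "continuous_on S N"
  and smooth_N: "smooth_on (UNIV - {0}) N"
  and N_0 [simp]: "N 0 = 0"
  and N_pos: "x \<noteq> 0 \<Longrightarrow> N x > 0"
  and N_dil: "s > 0 \<Longrightarrow> N (\<delta> s x) = s * N x"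
  using fund_norm unfolding fund_norm_def by (auto intro: continuous_on_subset)

lemma N_nonneg: "N x \<ge> 0"
  using N_pos[of x] by (cases "x = 0") auto

lemma N_differentiable: "x \<noteq> 0 \<Longrightarrow> N differentiable (at x)"
  using smooth_on_differentiable[OF smooth_N] by auto

text \<open>The factor \<open>s\<close> from the homogeneity of \<open>N\<close> cancels the factor
  \<open>s\<close> by which a horizontal field scales, so the horizontal gradient has degree
  0.\<close>

lemma hgrad_N_dil:
  assumes "s > 0" "x \<noteq> 0"
  shows "grad N (\<delta> s x) = grad N x"
proof -
  have ne: "\<delta> s x \<noteq> 0" using N_dil[OF assms(1), of x] N_pos[OF assms(2)] assms(1) by (metis N_0 mult_pos_pos less_irrefl)
  obtain D where D: "(N has_derivative D) (at x)" using N_differentiable[OF assms(2)] by (auto simp: differentiable_def)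
  obtain E where E: "(N has_derivative E) (at (\<delta> s x))" using N_differentiable[OF ne] by (auto simp: differentiable_def)
  have "(N \<circ> \<delta> s has_derivative E \<circ> \<delta> s) (at x)"
    by (intro diff_chain_at E bounded_linear_imp_has_derivative bounded_linear_dil)
  moreover have "(N \<circ> \<delta> s has_derivative (\<lambda>v. s * D v)) (at x)"
    using has_derivative_mult_right[OF D, of s] N_dil[OF assms(1)] by (simp add: o_def)
  ultimately have "E \<circ> \<delta> s = (\<lambda>v. s * D v)" by (rule has_derivative_unique)
  then have "E (\<delta> s (V i x)) = s * D (V i x)" for i by (metis comp_apply)
  moreover have "\<delta> s (V i x) = s *\<^sub>R V i (\<delta> s x)" if "i \<in> horiz deg" for i
    using dil_V[OF assms(1), of i x] that by (simp add: horiz_def)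
  ultimately have "E (V i (\<delta> s x)) = D (V i x)" if "i \<in> horiz deg" for i
    using that assms(1) linear_scale[OF has_derivative_linear[OF E]]
    by (metis mult_left_cancel less_irrefl real_scaleR_def)
  then show ?thesis
    unfolding hgrad_eq[OF D] hgrad_eq[OF E] by (auto simp: vec_eq_iff)
qed

lemma continuous_on_hgrad_N: "0 \<notin> S \<Longrightarrow> continuous_on S (grad N)"
  using continuous_on_hgrad[OF smooth_N] by (rule continuous_on_subset) auto

lemma hgrad_N_bounded: "\<exists>M. \<forall>x. norm (grad N x) \<le> M"
proof -
  have "compact (grad N ` sphere 0 1)"
    by (intro compact_continuous_image continuous_on_hgrad_N) auto
  then obtain M where M: "\<And>x. norm x = 1 \<Longrightarrow> norm (grad N x) \<le> M"
    using compact_imp_bounded by (force simp: bounded_iff)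
  \<comment> \<open>\<open>N\<close> need not be differentiable at 0; whatever \<open>deriv\<close>
    returns there is a fixed number and joins the maximum.\<close>
  have "norm (grad N x) \<le> max M (norm (grad N 0))" for x
  proof (cases "x = 0")
    case False
    then obtain s where "s > 0" "norm (\<delta> s x) = 1" by (rule ex_dil_norm_1)
    then have "norm (grad N x) \<le> M" using M hgrad_N_dil[of s x] False by metis
    then show ?thesis by simp
  qed simp
  then show ?thesis by blast
qed

text \<open>\<open>N\<close> has a positive minimum on the Euclidean unit sphere. A point with
  \<open>N x \<le> r\<close> reaches that sphere by a dilation whose \<open>1 / s\<close> is
  bounded, and undoing the dilation bounds every coordinate.\<close>

lemma compact_N_le: "compact {x. N x \<le> r}"
proof -
  have "compact (N ` sphere 0 1)" by (intro compact_continuous_image continuous_N) auto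
  moreover have "N ` sphere 0 1 \<noteq> {}"
    by (metis empty_iff imageI mem_sphere_0 norm_axis_1)
  ultimately obtain y where y: "norm y = 1" and ymin: "\<And>x. norm x = 1 \<Longrightarrow> N y \<le> N x"
    using compact_attains_inf[of "N ` sphere 0 1"] by auto
  have "y \<noteq> 0" using y by auto
  then have Ny: "N y > 0" by (rule N_pos)
  define B where "B = (\<Sum>i\<in>UNIV. (max r 0 / N y) ^ deg i)"
  have B0: "B \<ge> 0" unfolding B_def using Ny by (intro sum_nonneg zero_le_power divide_nonneg_pos) auto
  have "norm x \<le> B" if "N x \<le> r" for x
  proof (cases "x = 0")
    case False
    then obtain s where s: "s > 0" "norm (\<delta> s x) = 1" by (rule ex_dil_norm_1)
    have "N y \<le> s * N x" using ymin[OF s(2)] N_dil[OF s(1)] by simp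
    also have "\<dots> \<le> s * max r 0" using that s(1) by (intro mult_left_mono) auto
    finally have "N y \<le> s * max r 0" .
    then have s': "1 / s \<le> max r 0 / N y" 
  proof -
    have "1 / s \<le> b / a" if "a \<le> s * b" "a > 0" for a b using s(1) that by (simp add: field_simps)
    then show ?thesis using \<open>N y \<le> s * max r 0\<close> Ny by blast
  qed
    have "norm x \<le> (\<Sum>i\<in>UNIV. \<bar>x $ i\<bar>)" by (rule norm_le_l1_cart)
    also have "\<dots> \<le> B" unfolding B_def
    proof (rule sum_mono)
      fix i
      have "\<bar>\<delta> s x $ i\<bar> \<le> 1" using component_le_norm_cart[of "\<delta> s x" i] s(2) by simp
      then have "\<bar>x $ i\<bar> \<le> (1 / s) ^ deg i" using s(1) by (simp add: dil_def abs_mult field_simps)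
      also have "\<dots> \<le> (max r 0 / N y) ^ deg i" using s' s(1) by (intro power_mono) auto
      finally show "\<bar>x $ i\<bar> \<le> (max r 0 / N y) ^ deg i" .
    qed
    finally show ?thesis .
  qed (use B0 in auto)
  then have "bounded {x. N x \<le> r}" unfolding bounded_iff by auto
  moreover have "closed {x. N x \<le> r}"
    by (intro closed_Collect_le continuous_N continuous_on_const)
  ultimately show ?thesis by (simp add: compact_eq_bounded_closed)
qed

end

section \<open>Connectivity by horizontal curves\<close>

text \<open>The mean value theorem is applied along \<open>a\<close> to the increment of
  \<open>f\<close> in direction \<open>b\<close>, and then along \<open>b\<close> to the resulting
  difference of \<open>a\<close>-derivatives.\<close>

lemma second_difference_MVT:
  assumes f: "smooth_on UNIV f" and a: "a \<in> Basis" and b: "b \<in> Basis" and h: "h > 0"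
  shows "\<exists>s t. \<bar>s\<bar> \<le> h \<and> \<bar>t\<bar> \<le> h \<and>
    f (x + h *\<^sub>R a + h *\<^sub>R b) - f (x + h *\<^sub>R a) - f (x + h *\<^sub>R b) + f x
      = h * h * pd b (pd a f) (x + s *\<^sub>R a + t *\<^sub>R b)"
proof -
  have line: "((\<lambda>s. g (y + s *\<^sub>R e)) has_real_derivative pd e g (y + s *\<^sub>R e)) (at s)"
    if "smooth_on UNIV g" "e \<in> Basis" for g y e s
  proof -
    have "((\<lambda>r. g (y + (r + s) *\<^sub>R e)) has_real_derivative pd e g (y + s *\<^sub>R e)) (at 0)"
      using smooth_on_has_pd[OF that, of "y + s *\<^sub>R e"] by (simp add: algebra_simps)
    then show ?thesis using DERIV_shift[of "\<lambda>r. g (y + r *\<^sub>R e)" _ 0 s] by simp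
  qed
  define \<phi> where "\<phi> s = f (x + h *\<^sub>R b + s *\<^sub>R a) - f (x + s *\<^sub>R a)" for s
  have "(\<phi> has_real_derivative pd a f (x + h *\<^sub>R b + s *\<^sub>R a) - pd a f (x + s *\<^sub>R a)) (at s)" for s
    unfolding \<phi>_def by (intro DERIV_diff line f a)
  then obtain s where s: "s > 0" "s < h"
    "\<phi> h - \<phi> 0 = h * (pd a f (x + h *\<^sub>R b + s *\<^sub>R a) - pd a f (x + s *\<^sub>R a))"
    using MVT2[of 0 h \<phi> "\<lambda>s. pd a f (x + h *\<^sub>R b + s *\<^sub>R a) - pd a f (x + s *\<^sub>R a)"] h by auto
  obtain t where t: "t > 0" "t < h"
    "pd a f (x + s *\<^sub>R a + h *\<^sub>R b) - pd a f (x + s *\<^sub>R a) = h * pd b (pd a f) (x + s *\<^sub>R a + t *\<^sub>R b)"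
    using MVT2[of 0 h "\<lambda>t. pd a f (x + s *\<^sub>R a + t *\<^sub>R b)" "\<lambda>t. pd b (pd a f) (x + s *\<^sub>R a + t *\<^sub>R b)"]
      line[OF smooth_on_pd[OF f a] b] h by auto
  show ?thesis
    using s t unfolding \<phi>_def by (intro exI[of _ s] exI[of _ t]) (auto simp: algebra_simps)
qed

text \<open>Schwarz's theorem: the second difference is symmetric in \<open>a\<close> and
  \<open>b\<close>, so the mixed derivatives take a common value at suitable, possibly different,
  points near \<open>x\<close>; by continuity they cannot differ at \<open>x\<close>.\<close>

lemma pd_commute:
  assumes f: "smooth_on UNIV f" and a: "a \<in> Basis" and b: "b \<in> Basis"
  shows "pd b (pd a f) x = pd a (pd b f) x"
proof (rule ccontr)
  let ?A = "pd b (pd a f)" and ?B = "pd a (pd b f)"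
  assume ne: "?A x \<noteq> ?B x"
  define e where "e = \<bar>?A x - ?B x\<bar> / 2"
  have e: "e > 0" using ne by (simp add: e_def)
  have "isCont ?A x" "isCont ?B x"
    using smooth_on_continuous[OF smooth_on_pd[OF smooth_on_pd[OF f a] b]]
      smooth_on_continuous[OF smooth_on_pd[OF smooth_on_pd[OF f b] a]]
    by (simp_all add: continuous_on_eq_continuous_at)
  then obtain d1 d2 where d: "d1 > 0" "d2 > 0" "\<And>y. dist y x < d1 \<Longrightarrow> dist (?A y) (?A x) < e"
    "\<And>y. dist y x < d2 \<Longrightarrow> dist (?B y) (?B x) < e"
    using e unfolding continuous_at_eps_delta by metis
  define h where "h = min d1 d2 / 3"
  have h: "h > 0" "h + h < d1" "h + h < d2" using d by (auto simp: h_def)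
  have near: "dist (x + s *\<^sub>R a + t *\<^sub>R b) x \<le> h + h" "dist (x + t *\<^sub>R b + s *\<^sub>R a) x \<le> h + h" if "\<bar>s\<bar> \<le> h" "\<bar>t\<bar> \<le> h" for s t
    using norm_triangle_ineq[of "s *\<^sub>R a" "t *\<^sub>R b"] a b that by (simp_all add: dist_norm algebra_simps)
  obtain s t where st: "\<bar>s\<bar> \<le> h" "\<bar>t\<bar> \<le> h"
    "f (x + h *\<^sub>R a + h *\<^sub>R b) - f (x + h *\<^sub>R a) - f (x + h *\<^sub>R b) + f x = h * h * ?A (x + s *\<^sub>R a + t *\<^sub>R b)"
    using second_difference_MVT[OF f a b h(1), of x] by blast
  obtain s' t' where st': "\<bar>s'\<bar> \<le> h" "\<bar>t'\<bar> \<le> h"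
    "f (x + h *\<^sub>R b + h *\<^sub>R a) - f (x + h *\<^sub>R b) - f (x + h *\<^sub>R a) + f x = h * h * ?B (x + s' *\<^sub>R b + t' *\<^sub>R a)"
    using second_difference_MVT[OF f b a h(1), of x] by blast
  have "h * h * ?A (x + s *\<^sub>R a + t *\<^sub>R b) = h * h * ?B (x + s' *\<^sub>R b + t' *\<^sub>R a)"
    using st(3) st'(3) by (simp add: algebra_simps)
  then have "?A (x + s *\<^sub>R a + t *\<^sub>R b) = ?B (x + s' *\<^sub>R b + t' *\<^sub>R a)" using h(1) by simp
  moreover have "dist (?A (x + s *\<^sub>R a + t *\<^sub>R b)) (?A x) < e"
    using near(1)[OF st(1,2)] h by (intro d) auto
  moreover have "dist (?B (x + s' *\<^sub>R b + t' *\<^sub>R a)) (?B x) < e"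
    using near(2)[OF st'(2,1)] h by (intro d) auto
  ultimately show False unfolding e_def dist_real_def by argo
qed

lemma ex_antiderivative:
  fixes f :: "real \<Rightarrow> real"
  assumes "continuous_on UNIV f"
  shows "\<exists>F. F 0 = 0 \<and> (\<forall>t. (F has_real_derivative f t) (at t))"
proof -
  have "\<exists>F. \<forall>x::real. -\<infinity> < ereal x \<longrightarrow> ereal x < \<infinity> \<longrightarrow> (F has_vector_derivative f x) (at x)"
    by (rule einterval_antiderivative) (use assms in \<open>auto simp: continuous_on_eq_continuous_at\<close>)
  then obtain F where F: "\<And>t. (F has_real_derivative f t) (at t)"
    by (auto simp: has_real_derivative_iff_has_vector_derivative)
  show ?thesis
    by (rule exI[of _ "\<lambda>t. F t - F 0"]) (auto intro!: derivative_eq_intros F)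
qed

lemma vec_expansion: "v = (\<Sum>j\<in>UNIV. (v $ j) *\<^sub>R axis j (1::real))"
  using euclidean_representation[of v] by (simp add: sum_Basis_vec inner_axis)

section \<open>Integral curves, concatenation and the reachable subgroup\<close>

context carnot
begin

text \<open>Since the components of a horizontal field only depend on coordinates in lower layers,
  its integral curves are found layer by layer by integration.\<close>
lemma ex_integral_curve:
  assumes i: "i \<in> horiz deg"
  obtains c where "c 0 = 0" "\<And>t. (c has_vector_derivative V i (c t)) (at t)"
proof -
  have "\<exists>c. c 0 = 0 \<and> continuous_on UNIV c \<and>
      (\<forall>j t. deg j < d \<longrightarrow> ((\<lambda>t. c t $ j) has_real_derivative V i (c t) $ j) (at t))" for d
  proof (induction d)
    case 0
    show ?case by (rule exI[of _ "\<lambda>t. 0"]) auto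
  next
    case (Suc d)
    then obtain c where c: "c 0 = 0" "continuous_on UNIV c"
      "\<And>j t. deg j < d \<Longrightarrow> ((\<lambda>t. c t $ j) has_real_derivative V i (c t) $ j) (at t)" by blast
    have "continuous_on UNIV (\<lambda>t. V i (c t) $ j)" for j
      using continuous_on_compose2[OF smooth_map_on_continuous[OF smooth_V[of UNIV i]] c(2)]
      by (intro continuous_intros) auto
    then have "\<forall>j. \<exists>F. F 0 = 0 \<and> (\<forall>t. (F has_real_derivative V i (c t) $ j) (at t))"
      using ex_antiderivative by blast
    then obtain F where F: "\<And>j. F j 0 = 0" "\<And>j t. (F j has_real_derivative V i (c t) $ j) (at t)"
      by metis
    \<comment> \<open>Components in layer \<open>d\<close> receive their final values here. Higher
      ones are integrated too, but only as continuous placeholders that later stages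
      replace.\<close>
    define c' where "c' t = (\<chi> j. if deg j < d then c t $ j else F j t)" for t
    have der: "((\<lambda>t. c' t $ j) has_real_derivative V i (c t) $ j) (at t)" for j t
      using c(3) F(2) by (cases "deg j < d") (simp_all add: c'_def)
    have "V i (c' t) $ j = V i (c t) $ j" if "deg j < Suc d" for j t
      by (rule V_depends_on_lower[OF i]) (use that in \<open>auto simp: c'_def\<close>)
    moreover have "continuous_on UNIV c'"
      by (subst continuous_on_componentwise)
        (auto simp: ball_Basis_vec inner_axis intro: DERIV_continuous_on[OF der])
    ultimately show ?case
      using der c(1) F(1) by (intro exI[of _ c']) (auto simp: c'_def vec_eq_iff)
  qed
  from this[of "Suc (Max (range deg))"] obtain c where c: "c 0 = 0"
    "\<And>j t. deg j < Suc (Max (range deg)) \<Longrightarrow> ((\<lambda>t. c t $ j) has_real_derivative V i (c t) $ j) (at t)" by blast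
  have "deg j < Suc (Max (range deg))" for j by (simp add: less_Suc_eq_le)
  then have "(c has_vector_derivative V i (c t)) (at t)" for t
    using c(2) by (simp add: vec_has_vector_derivative_iff)
  then show ?thesis using that c(1) by blast
qed

text \<open>One-parameter subgroups in horizontal directions, encoded by their differential
  equation. With constant coefficients the equation is stable under dilation, time reversal and left
  translation, and the length density is constant.\<close>

definition horizontal_line :: "(real \<Rightarrow> real^'n) \<Rightarrow> bool" where
  "horizontal_line c \<longleftrightarrow> c 0 = 0 \<and>
    (\<exists>a. \<forall>t. (c has_vector_derivative (\<Sum>i\<in>horiz deg. a i *\<^sub>R V i (c t))) (at t))"

lemma horizontal_line_dil:
  assumes "horizontal_line c" "s > 0"
  shows "horizontal_line (\<lambda>t. \<delta> s (c t))"
proof -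
  obtain a where a: "c 0 = 0" "\<And>t. (c has_vector_derivative (\<Sum>i\<in>horiz deg. a i *\<^sub>R V i (c t))) (at t)"
    using assms(1) unfolding horizontal_line_def by blast
  have lin: "linear (\<delta> s)" using bounded_linear_dil by (rule bounded_linear.linear)
  have "\<delta> s (\<Sum>i\<in>horiz deg. a i *\<^sub>R V i x) = (\<Sum>i\<in>horiz deg. (a i * s) *\<^sub>R V i (\<delta> s x))" for x
    unfolding linear_sum[OF lin] linear_scale[OF lin] dil_V[OF assms(2)]
    by (intro sum.cong) (auto simp: horiz_def)
  then show ?thesis
    unfolding horizontal_line_def using a(1)
      bounded_linear.has_vector_derivative[OF bounded_linear_dil a(2), of deg s]
    by (auto intro!: exI[of _ "\<lambda>i. a i * s"])
qed

lemma horizontal_line_reverse: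
  assumes "horizontal_line c"
  shows "horizontal_line (\<lambda>t. c (- t))"
proof -
  obtain a where a: "c 0 = 0" "\<And>t. (c has_vector_derivative (\<Sum>i\<in>horiz deg. a i *\<^sub>R V i (c t))) (at t)"
    using assms(1) unfolding horizontal_line_def by blast
  have "(c \<circ> uminus has_vector_derivative (-1) *\<^sub>R (\<Sum>i\<in>horiz deg. a i *\<^sub>R V i (c (- t)))) (at t)" for t
    by (rule vector_diff_chain_at) (auto intro!: derivative_eq_intros a)
  then show ?thesis
    unfolding horizontal_line_def using a(1)
    by (auto intro!: exI[of _ "\<lambda>i. - a i"] simp: o_def sum_negf)
qed

lemma Lder_V: "Lder x y (V i y) = V i (x \<odot> y)"
proof -
  have "((\<lambda>t. x \<odot> (y \<odot> (t *\<^sub>R axis i 1))) has_vector_derivative Rder x y 0 + Lder x y (V i y)) (at 0)"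
    using gmul_comp_has_vector_derivative[OF has_vector_derivative_const[of x] V_has_vector_derivative[of y i]]
    by (simp add: V_eq)
  moreover have "((\<lambda>t. x \<odot> (y \<odot> (t *\<^sub>R axis i 1))) has_vector_derivative V i (x \<odot> y)) (at 0)"
    using V_has_vector_derivative[of "x \<odot> y" i] by (simp add: V_eq gmul_assoc)
  ultimately show ?thesis
    using vector_derivative_unique_at by fastforce
qed

lemma translate_horizontal:
  assumes "(c has_vector_derivative (\<Sum>i\<in>horiz deg. a i *\<^sub>R V i (c t))) (at t)"
  shows "((\<lambda>t. x \<odot> c t) has_vector_derivative (\<Sum>i\<in>horiz deg. a i *\<^sub>R V i (x \<odot> c t))) (at t)"
proof -
  have lin: "linear (Lder x y)" for y using linear_Lder by (rule bounded_linear.linear)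
  show ?thesis
    using gmul_comp_has_vector_derivative[OF has_vector_derivative_const[of x] assms]
    by (simp add: linear_sum[OF lin] linear_scale[OF lin] Lder_V)
qed

definition cc_connected :: "real^'n \<Rightarrow> real^'n \<Rightarrow> bool" where
  "cc_connected x y \<longleftrightarrow> cc_lengths (\<odot>) deg x y \<noteq> {}"

lemma cc_connected_refl: "cc_connected x x"
proof -
  have "0 \<in> cc_lengths (\<odot>) deg x x"
    unfolding cc_lengths_def mem_Collect_eq
    by (rule exI[of _ 0], rule exI[of _ 0], rule exI[of _ "\<lambda>t. x"], rule exI[of _ "\<lambda>t i. 0"], rule exI[of _ "{0}"])
      (auto intro: C1_differentiable_imp_piecewise simp: integrable_0)
  then show ?thesis unfolding cc_connected_def by blast
qed

text \<open>Left translation preserves horizontality, so a translated piece of \<open>c\<close> may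
  be appended to a given curve.\<close>

lemma cc_connected_extend:
  assumes y: "cc_connected \<xi> (x \<odot> c s)" and c: "horizontal_line c" and st: "s \<le> t"
  shows "cc_connected \<xi> (x \<odot> c t)"
proof -
  obtain k where k: "\<And>t. (c has_vector_derivative (\<Sum>i\<in>horiz deg. k i *\<^sub>R V i (c t))) (at t)"
    using c unfolding horizontal_line_def by blast
  from y obtain a b \<gamma> h S where 1: "a \<le> b" "\<gamma> a = \<xi>" "\<gamma> b = x \<odot> c s" "\<gamma> piecewise_C1_differentiable_on {a..b}" "finite S"
    "\<And>t. t \<in> {a..b} - S \<Longrightarrow> (\<gamma> has_vector_derivative (\<Sum>i\<in>horiz deg. h t i *\<^sub>R V i (\<gamma> t))) (at t)"
    "(\<lambda>t. sqrt (\<Sum>i\<in>horiz deg. (h t i)\<^sup>2)) integrable_on {a..b}"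
    unfolding cc_connected_def cc_lengths_def by blast
  \<comment> \<open>The time shift makes \<open>d b\<close> the old endpoint and
    \<open>d (b + (t - s))\<close> the new one; the junction \<open>b\<close> joins the exceptional
    times.\<close>
  define d where "d r = x \<odot> c (r - b + s)" for r
  have d: "(d has_vector_derivative (\<Sum>i\<in>horiz deg. k i *\<^sub>R V i (d r))) (at r)" for r
  proof -
    have "((\<lambda>t. x \<odot> c t) \<circ> (\<lambda>r. r - b + s) has_vector_derivative 1 *\<^sub>R (\<Sum>i\<in>horiz deg. k i *\<^sub>R V i (x \<odot> c (r - b + s)))) (at r)"
      by (rule vector_diff_chain_at) (auto intro!: derivative_eq_intros translate_horizontal k)
    then show ?thesis by (simp add: d_def[abs_def] o_def)
  qed
  have "continuous_on S d" for S
    using d has_vector_derivative_continuous continuous_at_imp_continuous_on by blast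
  then have "continuous_on S (\<lambda>r. \<Sum>i\<in>horiz deg. k i *\<^sub>R V i (d r))" for S
    by (intro continuous_intros continuous_on_compose2[OF smooth_map_on_continuous[OF smooth_V[of UNIV]]]) auto
  then have "d C1_differentiable_on S" for S
    unfolding C1_differentiable_on_def
    by (intro exI[of _ "\<lambda>r. \<Sum>i\<in>horiz deg. k i *\<^sub>R V i (d r)"]) (use d in auto)
  then have dC1: "d piecewise_C1_differentiable_on S" for S by (rule C1_differentiable_imp_piecewise)
  let ?e = "b + (t - s)"
  let ?\<gamma> = "\<lambda>r. if r \<le> b then \<gamma> r else d r" and ?h = "\<lambda>r. if r \<le> b then h r else k"
  let ?l = "\<lambda>r. sqrt (\<Sum>i\<in>horiz deg. (?h r i)\<^sup>2)"
  have C1: "?\<gamma> piecewise_C1_differentiable_on {a..?e}"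
    using 1 st by (intro piecewise_C1_differentiable_cases dC1) (auto simp: d_def)
  have der: "(?\<gamma> has_vector_derivative (\<Sum>i\<in>horiz deg. ?h r i *\<^sub>R V i (?\<gamma> r))) (at r)" if "r \<in> {a..?e} - insert b S" for r
  proof (cases "r < b")
    case True
    have "(?\<gamma> has_vector_derivative (\<Sum>i\<in>horiz deg. h r i *\<^sub>R V i (\<gamma> r))) (at r)"
      by (rule has_vector_derivative_transform_within_open[OF 1(6), of _ "{..<b}"]) (use True that in auto)
    then show ?thesis using True by simp
  next
    case False
    have "(?\<gamma> has_vector_derivative (\<Sum>i\<in>horiz deg. k i *\<^sub>R V i (d r))) (at r)"
      by (rule has_vector_derivative_transform_within_open[OF d, of "{b<..}"]) (use False that in auto)
    then show ?thesis using False that by simp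
  qed
  have i1: "?l integrable_on {a..b}"
    using 1(7) by (rule integrable_eq) auto
  have "(\<lambda>r. sqrt (\<Sum>i\<in>horiz deg. (k i)\<^sup>2)) integrable_on {b..?e}"
    by (rule integrable_const_ivl)
  then have i2: "?l integrable_on {b..?e}"
    by (rule integrable_spike_finite[of "{b}", rotated 2]) auto
  have "?l integrable_on {a..?e}"
    using Henstock_Kurzweil_Integration.integrable_combine[OF _ _ i1 i2] 1(1) st by auto
  then have "integral {a..?e} ?l \<in> cc_lengths (\<odot>) deg \<xi> (x \<odot> c t)"
    unfolding cc_lengths_def mem_Collect_eq using 1 st C1 der
    by (intro exI[of _ a] exI[of _ ?e] exI[of _ ?\<gamma>] exI[of _ ?h] exI[of _ "insert b S"]) (auto simp: d_def)
  then show ?thesis unfolding cc_connected_def by blast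
qed

text \<open>Inverse steps have their own constructor, so \<open>reach\<close> becomes a subgroup
  without first identifying \<open>ginv (c t)\<close> with \<open>c (- t)\<close>.\<close>

inductive_set reach :: "(real^'n) set" where
  zero: "0 \<in> reach"
| fwd: "x \<in> reach \<Longrightarrow> horizontal_line c \<Longrightarrow> x \<odot> c t \<in> reach"
| bwd: "x \<in> reach \<Longrightarrow> horizontal_line c \<Longrightarrow> x \<odot> ginv (c t) \<in> reach"

lemma cc_connected_reach: "x \<in> reach \<Longrightarrow> cc_connected \<xi> (\<xi> \<odot> x)"
proof (induction rule: reach.induct)
  case zero
  then show ?case by (simp add: cc_connected_refl)
next
  case (fwd x c t)
  have c0: "c 0 = 0" using fwd(2) by (simp add: horizontal_line_def)
  show ?case
  proof (cases "t \<ge> 0")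
    case True
    then show ?thesis
      using cc_connected_extend[of \<xi> "\<xi> \<odot> x" c 0 t] fwd c0 by (simp add: gmul_assoc)
  next
    case False
    then show ?thesis
      using cc_connected_extend[OF _ horizontal_line_reverse[OF fwd(2)], of \<xi> "\<xi> \<odot> x" 0 "-t"] fwd c0
      by (simp add: gmul_assoc)
  qed
next
  case (bwd x c t)
  have c0: "c 0 = 0" using bwd(2) by (simp add: horizontal_line_def)
  \<comment> \<open>Since \<open>?x \<odot> c t\<close> equals \<open>\<xi> \<odot> x\<close>, the
    new point is reached by running \<open>c\<close> from parameter \<open>t\<close> to 0. For
    positive \<open>t\<close> the reversed line provides the forward orientation.\<close>
  let ?x = "\<xi> \<odot> x \<odot> ginv (c t)"
  have start: "cc_connected \<xi> (?x \<odot> c t)" using bwd by (simp add: gmul_assoc)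
  show ?case
  proof (cases "t \<le> 0")
    case True
    then show ?thesis
      using cc_connected_extend[OF start bwd(2), of 0] c0 by (simp add: gmul_assoc)
  next
    case False
    then show ?thesis
      using cc_connected_extend[OF _ horizontal_line_reverse[OF bwd(2)], of \<xi> ?x "-t" 0] c0 start
      by (simp add: gmul_assoc)
  qed
qed

lemma reach_gmul: "y \<in> reach \<Longrightarrow> x \<in> reach \<Longrightarrow> x \<odot> y \<in> reach"
  by (induction rule: reach.induct) (auto simp: gmul_assoc[symmetric] intro: reach.intros)

lemma reach_line: "horizontal_line c \<Longrightarrow> c t \<in> reach" "horizontal_line c \<Longrightarrow> ginv (c t) \<in> reach"
  using reach.fwd[OF reach.zero] reach.bwd[OF reach.zero] by simp_all

lemma reach_ginv: "x \<in> reach \<Longrightarrow> ginv x \<in> reach"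
  by (induction rule: reach.induct) (auto simp: ginv_gmul reach.zero intro: reach_gmul reach_line)

lemma reach_dil: "x \<in> reach \<Longrightarrow> s > 0 \<Longrightarrow> \<delta> s x \<in> reach"
proof (induction rule: reach.induct)
  case (fwd x c t)
  then show ?case
    using reach.fwd[OF _ horizontal_line_dil[of c s]] by (simp add: dil_gmul)
next
  case (bwd x c t)
  then show ?case
    using reach.bwd[OF _ horizontal_line_dil[of c s]] by (simp add: dil_gmul dil_ginv)
qed (auto intro: reach.zero)

lemma horizontal_line_integral_curve:
  assumes "i \<in> horiz deg"
  obtains c where "horizontal_line c" "(c has_vector_derivative axis i 1) (at 0)"
proof -
  obtain c where c: "c 0 = 0" "\<And>t. (c has_vector_derivative V i (c t)) (at t)"
    using ex_integral_curve[OF assms] by blast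
  have "(\<Sum>j\<in>horiz deg. (if j = i then 1 else 0) *\<^sub>R V j x) = V i x" for x
    using assms by (simp add: if_distrib[of "\<lambda>r. r *\<^sub>R _"] sum.delta cong: if_cong)
  then have "horizontal_line c"
    unfolding horizontal_line_def using c by (auto intro!: exI[of _ "\<lambda>j. if j = i then 1 else 0"])
  moreover have "V i 0 = axis i 1"
  proof -
    have "((\<lambda>t. t *\<^sub>R axis i 1) has_vector_derivative (axis i 1 :: real^'n)) (at 0)"
      by (auto intro!: derivative_eq_intros)
    then show ?thesis
      using V_has_vector_derivative[of 0 i] unfolding V_eq by (simp add: vector_derivative_unique_at)
  qed
  ultimately show ?thesis using that c by metis
qed

section \<open>The right-invariant frame and the bracket condition\<close>

abbreviation B :: "'n \<Rightarrow> real^'n \<Rightarrow> real^'n" where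
  "B k x \<equiv> Rder 0 x (axis k 1)"

lemma Rder_0_expand: "Rder 0 x v = (\<Sum>k\<in>UNIV. v $ k *\<^sub>R B k x)"
proof -
  have lin: "linear (Rder 0 x)" using linear_Rder by (rule bounded_linear.linear)
  show ?thesis by (subst vec_expansion) (simp add: linear_sum[OF lin] linear_scale[OF lin])
qed

lemma smooth_B: "smooth_map_on UNIV (B k)"
  by (intro smooth_map_on_der smooth_map_on_const smooth_map_on_ident open_UNIV)

text \<open>Left- and right-invariant fields commute because left and right translations do.\<close>
lemma left_right_commute:
  assumes DB: "(B k has_derivative DB) (at x)" and DV: "(V i has_derivative DV) (at x)"
  shows "DB (V i x) = DV (B k x)"
proof -
  have "DB (V i x) $ j = DV (B k x) $ j" for j
  proof -
    \<comment> \<open>In \<open>(s e_k) x (t e_i)\<close> the derivative in \<open>s\<close> at 0 is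
      a right-invariant field, the one in \<open>t\<close> at 0 a left-invariant field; the two
      orders of differentiation give the two sides.\<close>
    define f where "f z = ((fst z *\<^sub>R axis k 1) \<odot> (x \<odot> (snd z *\<^sub>R axis i 1))) $ j" for z :: "real \<times> real"
    have sm: "smooth_map_on UNIV (\<lambda>z::real \<times> real. L z *\<^sub>R (axis m 1 :: real^'n))" if "bounded_linear L" for L m
      unfolding smooth_map_on_def
      by (auto intro!: smooth_on_bounded_linear bounded_linear_mult_const[THEN bounded_linear_compose, OF that])
    have f: "smooth_on UNIV f"
      unfolding f_def[abs_def]
      using smooth_map_on_gmul[OF open_UNIV sm[OF bounded_linear_fst, of k]
          smooth_map_on_gmul[OF open_UNIV smooth_map_on_const[of UNIV x] sm[OF bounded_linear_snd, of i]]]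
      by (simp add: smooth_map_on_def)
    have nth: "((\<lambda>t. g t $ j) has_real_derivative (v $ j)) (at 0)" if "(g has_vector_derivative v) (at 0)"
      for g :: "real \<Rightarrow> real^'n" and v using that by (simp add: vec_has_vector_derivative_iff)
    have line0: "((\<lambda>s. s *\<^sub>R axis k 1) has_vector_derivative (axis k 1 :: real^'n)) (at 0)"
      by (auto intro!: derivative_eq_intros)
    have Bk: "((\<lambda>s. (s *\<^sub>R axis k 1) \<odot> y) has_vector_derivative B k y) (at 0)" for y
      using gmul_comp_has_vector_derivative[OF line0 has_vector_derivative_const[of y]]
      by simp
    have p1: "pd (1, 0) f (0, t) = B k (x \<odot> (t *\<^sub>R axis i 1)) $ j" for t
      by (rule has_pd_unique) (use nth[OF Bk] in \<open>simp add: f_def\<close>)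
    have "pd (0, 1) (pd (1, 0) f) (0, 0) = DB (V i x) $ j"
      by (rule has_pd_unique)
        (use Xf_has_derivative[OF bounded_linear.has_derivative[OF bounded_linear_vec_nth DB, of j], of i] in \<open>simp add: p1\<close>)
    moreover have p2: "pd (0, 1) f (s, 0) = V i ((s *\<^sub>R axis k 1) \<odot> x) $ j" for s
      by (rule has_pd_unique) (use nth[OF V_has_vector_derivative] in \<open>simp add: f_def gmul_assoc[symmetric] V_eq\<close>)
    have "pd (1, 0) (pd (0, 1) f) (0, 0) = DV (B k x) $ j"
    proof (rule has_pd_unique)
      have "((\<lambda>s. V i ((s *\<^sub>R axis k 1) \<odot> x)) has_vector_derivative DV (B k x)) (at 0)"
        using diff_chain_at[of "\<lambda>s. (s *\<^sub>R axis k 1) \<odot> x" "\<lambda>s. s *\<^sub>R B k x" 0 "V i" DV] Bk[of x] DV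
        by (simp add: has_vector_derivative_def o_def linear_scale[OF has_derivative_linear[OF DV]])
      then show "has_pd (pd (0, 1) f) (1, 0) (DV (B k x) $ j) (0, 0)"
        using nth by (simp add: p2)
    qed
    ultimately show ?thesis
      using pd_commute[OF f, of "(1, 0)" "(0, 1)" "(0, 0)"] by (simp add: Basis_prod_def)
  qed
  then show ?thesis by (simp add: vec_eq_iff)
qed

text \<open>Each \<open>B k\<close> commutes with \<open>V i\<close>, so in the difference of
  directional derivatives all terms that do not differentiate \<open>g\<close> cancel.\<close>

lemma lie_bracket_frame:
  assumes g: "smooth_map_on UNIV g"
  shows "lie_bracket (V i) (\<lambda>x. \<Sum>k\<in>UNIV. g x $ k *\<^sub>R B k x) x
    = (\<Sum>k\<in>UNIV. Xf (\<odot>) i (\<lambda>x. g x $ k) x *\<^sub>R B k x)"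
proof -
  obtain Dg where Dg: "(g has_derivative Dg) (at x)"
    using smooth_map_on_differentiable[OF g open_UNIV, of x] by (auto simp: differentiable_def)
  obtain DV where DV: "(V i has_derivative DV) (at x)"
    using smooth_map_on_differentiable[OF smooth_V[of UNIV i] open_UNIV, of x] by (auto simp: differentiable_def)
  have "\<forall>k. \<exists>DB. (B k has_derivative DB) (at x)"
    using smooth_map_on_differentiable[OF smooth_B open_UNIV, of x] by (auto simp: differentiable_def)
  then obtain DB where DB: "\<And>k. (B k has_derivative DB k) (at x)" by metis
  let ?G = "\<lambda>x. \<Sum>k\<in>UNIV. g x $ k *\<^sub>R B k x"
  have Dgk: "((\<lambda>x. g x $ k) has_derivative (\<lambda>v. Dg v $ k)) (at x)" for k
    by (rule bounded_linear.has_derivative[OF bounded_linear_vec_nth Dg])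
  have "(?G has_derivative (\<lambda>v. \<Sum>k\<in>UNIV. g x $ k *\<^sub>R DB k v + Dg v $ k *\<^sub>R B k x)) (at x)"
    by (intro has_derivative_sum has_derivative_scaleR Dgk DB)
  from vector_derivative_at[OF has_derivative_has_vector_pd[OF this]]
  have 1: "vector_derivative (\<lambda>t. ?G (x + t *\<^sub>R V i x)) (at 0)
      = (\<Sum>k\<in>UNIV. g x $ k *\<^sub>R DB k (V i x) + Dg (V i x) $ k *\<^sub>R B k x)" .
  have "vector_derivative (\<lambda>t. V i (x + t *\<^sub>R ?G x)) (at 0) = DV (?G x)"
    by (rule vector_derivative_at[OF has_derivative_has_vector_pd[OF DV]])
  also have "\<dots> = (\<Sum>k\<in>UNIV. g x $ k *\<^sub>R DV (B k x))"
    using has_derivative_linear[OF DV] by (simp add: linear_sum linear_scale)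
  also have "\<dots> = (\<Sum>k\<in>UNIV. g x $ k *\<^sub>R DB k (V i x))"
    using left_right_commute[OF DB DV] by simp
  finally have 2: "vector_derivative (\<lambda>t. V i (x + t *\<^sub>R ?G x)) (at 0) = (\<Sum>k\<in>UNIV. g x $ k *\<^sub>R DB k (V i x))" .
  have "Xf (\<odot>) i (\<lambda>x. g x $ k) x = Dg (V i x) $ k" for k
    unfolding Xf_def by (rule DERIV_imp_deriv[OF Xf_has_derivative[OF Dgk]])
  then show ?thesis
    unfolding lie_bracket_def 1 2 by (simp add: sum.distrib)
qed

lemma smooth_Xf:
  assumes "smooth_on UNIV f"
  shows "smooth_on UNIV (Xf (\<odot>) i f)"
proof -
  have "smooth_on UNIV (\<lambda>x. \<Sum>j\<in>UNIV. V i x $ j * pd (axis j 1) f x)"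
    using smooth_V[of UNIV i] smooth_on_pd[OF assms]
    by (intro smooth_on_sum smooth_on_mult) (auto simp: smooth_map_on_def axis_in_Basis_iff)
  then show ?thesis
    by (rule smooth_on_cong[rotated]) (simp_all add: Xf_smooth[OF assms])
qed

text \<open>The vector is \<open>Ad x\<close> applied to \<open>axis i 1\<close>, the velocity at
  \<open>t = 0\<close> of the conjugated curve \<open>x (t e_i) (ginv x)\<close>.\<close>

lemma smooth_Ad: "smooth_map_on UNIV (\<lambda>x. Rder x (ginv x) (V i x))"
proof -
  have eq: "Rder x (ginv x) (V i x) = (\<Sum>j\<in>UNIV. V i x $ j *\<^sub>R Rder x (ginv x) (axis j 1))" for x
  proof -
    have lin: "linear (Rder x (ginv x))" using linear_Rder by (rule bounded_linear.linear)
    show ?thesis by (subst vec_expansion) (simp add: linear_sum[OF lin] linear_scale[OF lin])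
  qed
  have "smooth_map_on UNIV (\<lambda>x. Rder x (ginv x) (axis j 1))" for j
    by (intro smooth_map_on_der smooth_map_on_ident smooth_ginv open_UNIV)
  then show ?thesis
    unfolding eq smooth_map_on_def using smooth_V[of UNIV i]
    by (auto simp: smooth_map_on_def intro!: smooth_on_sum smooth_on_mult)
qed

text \<open>Multiplying the conjugated curve by \<open>x\<close> on the right gives back
  \<open>x (t e_i)\<close>. Hence \<open>Ad x\<close> of \<open>axis i 1\<close> is the coefficient
  vector of \<open>V i\<close> at \<open>x\<close> in the right-invariant frame.\<close>

lemma Rder_Ad: "Rder 0 x (Rder x (ginv x) (V i x)) = V i x"
proof -
  have "((\<lambda>t. (x \<odot> (t *\<^sub>R axis i 1)) \<odot> ginv x) has_vector_derivative Rder x (ginv x) (V i x)) (at 0)"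
    using gmul_comp_has_vector_derivative[OF V_has_vector_derivative[of x i] has_vector_derivative_const[of "ginv x"]]
    by (simp add: V_eq)
  from gmul_comp_has_vector_derivative[OF this has_vector_derivative_const[of x]]
  have "((\<lambda>t. x \<odot> (t *\<^sub>R axis i 1)) has_vector_derivative Rder 0 x (Rder x (ginv x) (V i x))) (at 0)"
    by (simp add: gmul_assoc)
  then show ?thesis
    using V_has_vector_derivative[of x i] by (simp add: V_eq vector_derivative_unique_at)
qed

text \<open>A covector that annihilates the tangent vectors \<open>Ad x X\<^sub>i\<close> of conjugated horizontal
  curves annihilates, along the reachable set, all iterated brackets written in the right-invariant
  frame, because taking the bracket with \<open>X\<^sub>i\<close> differentiates the coefficients along \<open>X\<^sub>i\<close>.\<close>
lemma span_Ad_horizontal: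
  "span {Rder x (ginv x) (V i x) | x i. x \<in> reach \<and> i \<in> horiz deg} = UNIV" (is "span ?T = UNIV")
proof (rule ccontr)
  assume "span ?T \<noteq> UNIV"
  then obtain l where l: "l \<noteq> 0" "span ?T \<subseteq> {x. l \<bullet> x = 0}"
    using span_not_univ_subset_hyperplane by blast
  have lT: "l \<bullet> Rder x (ginv x) (V i x) = 0" if "x \<in> reach" "i \<in> horiz deg" for x i
    using l(2) span_base[of "Rder x (ginv x) (V i x)" ?T] that by blast
  have main: "\<exists>g. smooth_map_on UNIV g \<and> G = (\<lambda>x. \<Sum>k\<in>UNIV. g x $ k *\<^sub>R B k x) \<and> (\<forall>x\<in>reach. l \<bullet> g x = 0)"
    if "G \<in> iter_brackets (V ` horiz deg)" for G
    using that
  proof (induction rule: iter_brackets.induct)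
    case (gen F)
    then obtain i where i: "i \<in> horiz deg" "F = V i" by blast
    show ?case
      by (rule exI[of _ "\<lambda>x. Rder x (ginv x) (V i x)"])
        (auto simp: smooth_Ad i lT Rder_Ad Rder_0_expand[symmetric])
  next
    case (br F G)
    then obtain i where i: "i \<in> horiz deg" "F = V i" by blast
    obtain g where g: "smooth_map_on UNIV g" "G = (\<lambda>x. \<Sum>k\<in>UNIV. g x $ k *\<^sub>R B k x)" "\<And>x. x \<in> reach \<Longrightarrow> l \<bullet> g x = 0"
      using br.IH by blast
    define g' where "g' x = (\<chi> k. Xf (\<odot>) i (\<lambda>x. g x $ k) x)" for x
    have "l \<bullet> g' x = 0" if x: "x \<in> reach" for x
    proof -
      obtain c where c: "horizontal_line c" "(c has_vector_derivative axis i 1) (at 0)"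
        using horizontal_line_integral_curve[OF i(1)] by blast
      have c0: "c 0 = 0" using c(1) by (simp add: horizontal_line_def)
      have cx: "((\<lambda>t. x \<odot> c t) has_vector_derivative V i x) (at 0)"
        using gmul_comp_has_vector_derivative[OF has_vector_derivative_const[of x] c(2)]
        by (simp add: c0 V_eq)
      obtain Dg where Dg: "(g has_derivative Dg) (at x)"
        using smooth_map_on_differentiable[OF g(1) open_UNIV, of x] by (auto simp: differentiable_def)
      have "((\<lambda>t. l \<bullet> g (x \<odot> c t)) has_derivative (\<lambda>t. l \<bullet> Dg (t *\<^sub>R V i x))) (at 0)"
        using has_derivative_inner_right[OF diff_chain_at[of "\<lambda>t. x \<odot> c t" "\<lambda>t. t *\<^sub>R V i x" 0 g Dg], of l] cx Dg
        by (simp add: has_vector_derivative_def o_def c0)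
      \<comment> \<open>The annihilation holds along a whole horizontal curve inside
        \<open>reach\<close>, so it can be differentiated. This is why the induction speaks about
        all of \<open>reach\<close> and not only about 0.\<close>
      moreover have "(\<lambda>t. l \<bullet> g (x \<odot> c t)) = (\<lambda>t. 0)"
        using g(3) reach.fwd[OF x c(1)] by auto
      ultimately have "(\<lambda>t. l \<bullet> Dg (t *\<^sub>R V i x)) = (\<lambda>t. 0)"
        using has_derivative_unique[OF _ has_derivative_const] by metis
      then have "l \<bullet> Dg (1 *\<^sub>R V i x) = 0" by meson
      moreover have "g' x = Dg (V i x)"
        unfolding g'_def Xf_def vec_eq_iff
        using DERIV_imp_deriv[OF Xf_has_derivative[OF bounded_linear.has_derivative[OF bounded_linear_vec_nth Dg]]]
        by simp
      ultimately show ?thesis by simp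
    qed
    moreover have "smooth_map_on UNIV g'"
      using g(1) smooth_Xf by (simp add: smooth_map_on_def g'_def)
    moreover have "lie_bracket F G = (\<lambda>x. \<Sum>k\<in>UNIV. g' x $ k *\<^sub>R B k x)"
      unfolding i(2) g(2) g'_def using lie_bracket_frame[OF g(1)] by auto
    ultimately show ?case by blast
  qed
  \<comment> \<open>At the origin the frame is the standard basis, so the coefficient vector of a
    bracket is its value there.\<close>
  have B0: "Rder 0 0 = (\<lambda>v. v)"
    using has_derivative_unique[OF gmul_has_derivative(2)[where x = 0 and y = 0]] has_derivative_ident by simp
  have "l \<bullet> G 0 = 0" if G: "G \<in> iter_brackets (V ` horiz deg)" for G
  proof -
    obtain g where g: "G = (\<lambda>x. \<Sum>k\<in>UNIV. g x $ k *\<^sub>R B k x)" "l \<bullet> g 0 = 0"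
      using main[OF G] reach.zero by blast
    have "G 0 = g 0" unfolding g(1) B0 by (rule vec_expansion[symmetric])
    then show ?thesis using g(2) by simp
  qed
  then have "(\<lambda>F. F 0) ` iter_brackets (V ` horiz deg) \<subseteq> {v. l \<bullet> v = 0}" by auto
  then have "span ((\<lambda>F. F 0) ` iter_brackets (V ` horiz deg)) \<subseteq> {v. l \<bullet> v = 0}"
    using span_minimal subspace_hyperplane by blast
  then have "l \<bullet> l = 0" using bracket_generating by blast
  then show False using l(1) by simp
qed

text \<open>Curves through 0 inside \<open>reach\<close> with linearly independent velocities are
  multiplied in a fixed order, one parameter per coordinate. The product map is known to be
  continuous and to be differentiable at the single point 0, which is exactly what
  \<open>sussmann_open_mapping\<close> accepts.\<close>

lemma reach_interior: "0 \<in> interior reach"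
proof -
  let ?T = "{Rder x (ginv x) (V i x) | x i. x \<in> reach \<and> i \<in> horiz deg}"
  obtain A where A: "A \<subseteq> ?T" "independent A" "?T \<subseteq> span A" "card A = dim ?T"
    using basis_exists[of ?T] by blast
  have spanA: "span A = UNIV"
    using span_Ad_horizontal span_minimal[OF A(3) subspace_span] by blast
  have "finite A" using A(2) by (rule independent_imp_finite)
  moreover have "card A = CARD('n)"
    using spanA dim_span[of A] dim_eq_card_independent[OF A(2)] by simp
  ultimately obtain f where f: "bij_betw f (UNIV::'n set) A"
    using finite_same_card_bij[of "UNIV::'n set" A] by auto
  have "\<exists>c. c 0 = 0 \<and> continuous_on UNIV c \<and> (c has_vector_derivative f k) (at 0) \<and> range c \<subseteq> reach" for k
  proof -
    have "f k \<in> ?T" using f A(1) bij_betwE by blast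
    then obtain x i where xi: "x \<in> reach" "i \<in> horiz deg" "f k = Rder x (ginv x) (V i x)" by blast
    obtain d where d: "horizontal_line d" "(d has_vector_derivative axis i 1) (at 0)"
      using horizontal_line_integral_curve[OF xi(2)] by blast
    have d0: "d 0 = 0" using d(1) by (simp add: horizontal_line_def)
    have "continuous_on UNIV d"
      using d(1) has_vector_derivative_continuous continuous_at_imp_continuous_on
      unfolding horizontal_line_def by blast
    then have "continuous_on UNIV (\<lambda>t. (x \<odot> d t) \<odot> ginv x)" by (intro continuous_intros)
    moreover have dx: "((\<lambda>t. x \<odot> d t) has_vector_derivative V i x) (at 0)"
      using gmul_comp_has_vector_derivative[OF has_vector_derivative_const[of x] d(2)]
      by (simp add: d0 V_eq)
    have "((\<lambda>t. (x \<odot> d t) \<odot> ginv x) has_vector_derivative f k) (at 0)"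
      using gmul_comp_has_vector_derivative[OF dx has_vector_derivative_const[of "ginv x"]]
      by (simp add: d0 xi(3))
    moreover have "range (\<lambda>t. (x \<odot> d t) \<odot> ginv x) \<subseteq> reach"
      using xi(1) d(1) by (auto intro: reach_gmul reach_ginv reach.fwd)
    ultimately show ?thesis by (intro exI[of _ "\<lambda>t. (x \<odot> d t) \<odot> ginv x"]) (auto simp: d0)
  qed
  then obtain c where c: "\<And>k. c k 0 = 0" "\<And>k. continuous_on UNIV (c k)"
    "\<And>k. (c k has_vector_derivative f k) (at 0)" "\<And>k t. c k t \<in> reach"
    by (metis rangeI subsetD)
  define \<Psi> where "\<Psi> ks s = foldr (\<lambda>k y. c k (s $ k) \<odot> y) ks 0" for ks and s :: "real^'n"
  have \<Psi>: "\<Psi> ks 0 = 0 \<and> continuous_on UNIV (\<Psi> ks) \<and> range (\<Psi> ks) \<subseteq> reach \<and>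
      (\<Psi> ks has_derivative (\<lambda>v. \<Sum>k\<in>set ks. v $ k *\<^sub>R f k)) (at 0)" if "distinct ks" for ks
    using that
  proof (induction ks)
    case Nil
    then show ?case by (auto simp: \<Psi>_def[abs_def] reach.zero)
  next
    case (Cons k ks)
    have eq: "\<Psi> (k # ks) = (\<lambda>s. c k (s $ k) \<odot> \<Psi> ks s)" by (simp add: \<Psi>_def[abs_def])
    have ck: "((\<lambda>s. c k (s $ k)) has_derivative (\<lambda>v. v $ k *\<^sub>R f k)) (at 0)"
      using diff_chain_at[OF bounded_linear_imp_has_derivative[OF bounded_linear_vec_nth[of k]],
          of "c k" "\<lambda>t. t *\<^sub>R f k" 0] c(3)[of k]
      by (simp add: o_def has_vector_derivative_def)
    \<comment> \<open>At the identity both translations have the identity as differential, so the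
      velocities of the factors add up.\<close>
    have id: "Rder 0 0 = (\<lambda>v. v)" "Lder 0 0 = (\<lambda>v. v)"
      using has_derivative_unique[OF gmul_has_derivative(2)[where x = 0 and y = 0]]
        has_derivative_unique[OF gmul_has_derivative(1)[where x = 0 and y = 0]] has_derivative_ident by simp_all
    have "((\<lambda>s. (c k (s $ k), \<Psi> ks s)) has_derivative (\<lambda>v. (v $ k *\<^sub>R f k, \<Sum>k\<in>set ks. v $ k *\<^sub>R f k))) (at 0)"
      using Cons by (intro has_derivative_Pair ck) auto
    from diff_chain_at[OF this, of "\<lambda>z. fst z \<odot> snd z" "\<lambda>z. Rder 0 0 (fst z) + Lder 0 0 (snd z)"]
    have "((\<lambda>s. c k (s $ k) \<odot> \<Psi> ks s) has_derivative (\<lambda>v. v $ k *\<^sub>R f k + (\<Sum>k\<in>set ks. v $ k *\<^sub>R f k))) (at 0)"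
      using gmul_has_derivative(3)[of 0 0] Cons c(1) by (simp add: o_def id)
    moreover have "continuous_on UNIV (\<lambda>s. c k (s $ k) \<odot> \<Psi> ks s)"
      using Cons by (intro continuous_intros continuous_on_compose2[OF c(2)]) auto
    moreover have "c k (s $ k) \<odot> \<Psi> ks s \<in> reach" for s
      using Cons c(4) by (intro reach_gmul) auto
    ultimately show ?case unfolding eq using Cons c(1) by auto
  qed
  obtain ks where ks: "distinct ks" "set ks = (UNIV::'n set)"
    using finite_distinct_list[of "UNIV::'n set"] by auto
  let ?L = "\<lambda>v::real^'n. \<Sum>k\<in>UNIV. v $ k *\<^sub>R f k"
  have D: "(\<Psi> ks has_derivative ?L) (at 0)" using \<Psi>[OF ks(1)] ks(2) by simp
  have linL: "linear ?L" by (rule has_derivative_linear[OF D])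
  have "surj ?L"
  proof (rule surjI)
    fix y :: "real^'n"
    have "y \<in> range (\<lambda>u. \<Sum>v\<in>A. u v *\<^sub>R v)"
      using span_finite[OF \<open>finite A\<close>] spanA by auto
    then have "\<exists>u. y = (\<Sum>v\<in>A. u v *\<^sub>R v)" by blast
    then have "y = (\<Sum>v\<in>A. (SOME u. y = (\<Sum>v\<in>A. u v *\<^sub>R v)) v *\<^sub>R v)" by (rule someI_ex)
    also have "\<dots> = (\<Sum>k\<in>UNIV. (SOME u. y = (\<Sum>v\<in>A. u v *\<^sub>R v)) (f k) *\<^sub>R f k)"
      using f by (simp add: sum.reindex_bij_betw[symmetric])
    finally show "?L (\<chi> k. (SOME u. y = (\<Sum>v\<in>A. u v *\<^sub>R v)) (f k)) = y" by simp
  qed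
  then obtain g where g: "linear g" "?L \<circ> g = id"
    using linear_surjective_right_inverse[OF linL] by blast
  have "\<Psi> ks 0 \<in> interior (\<Psi> ks ` UNIV)"
    by (rule sussmann_open_mapping[OF open_UNIV _ _ D _ g(2)])
      (use \<Psi>[OF ks(1)] g(1) in \<open>auto simp: linear_conv_bounded_linear\<close>)
  then show ?thesis
    using \<Psi>[OF ks(1)] interior_mono[of "range (\<Psi> ks)" reach] by auto
qed

lemma reach_UNIV: "reach = UNIV"
proof -
  obtain e where e: "e > 0" "ball 0 e \<subseteq> reach"
    using reach_interior by (auto simp: mem_interior)
  have "x \<in> reach" for x
  proof -
    have "eventually (\<lambda>s. \<delta> s x \<in> ball 0 e) (at_right 0)"
      using tendstoD[OF dil_tendsto_0 e(1), of x] by simp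
    moreover have "eventually (\<lambda>s::real. s > 0) (at_right 0)" by (simp add: eventually_at_filter)
    ultimately have "eventually (\<lambda>s. s > 0 \<and> \<delta> s x \<in> ball 0 e) (at_right 0)" by eventually_elim auto
    then obtain s where s: "s > 0" "\<delta> s x \<in> ball 0 e"
      using eventually_happens[of _ "at_right (0::real)"] by auto
    then have "\<delta> (1 / s) (\<delta> s x) \<in> reach" using e(2) by (intro reach_dil[of "\<delta> s x"]) auto
    then show ?thesis using s(1) by (simp add: dil_dil)
  qed
  then show ?thesis by blast
qed

text \<open>Chow's theorem. Without it \<open>d_CC\<close> would be the unspecified infimum of an empty set.\<close>
theorem cc_lengths_nonempty: "cc_lengths (\<odot>) deg \<xi> \<eta> \<noteq> {}"
  using cc_connected_reach[of "ginv \<xi> \<odot> \<eta>" \<xi>] by (simp add: reach_UNIV cc_connected_def)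

end

section \<open>Growth of the norm along horizontal curves\<close>

context carnot_norm
begin

lemma borel_grad_N: "grad N \<in> borel_measurable borel"
proof -
  have "(\<lambda>x. if x \<in> UNIV - {0} then grad N x else grad N 0) \<in> borel_measurable borel"
    by (rule borel_measurable_continuous_on_if) (auto intro: continuous_on_hgrad_N)
  moreover have "(\<lambda>x. if x \<in> UNIV - {0} then grad N x else grad N 0) = grad N" by auto
  ultimately show ?thesis by simp
qed

lemma measurable_grad_N [measurable]: "grad N \<in> borel_measurable lebesgue"
  using borel_grad_N by (intro measurable_completion) simp

lemma measurable_N [measurable]: "N \<in> borel_measurable lebesgue"
  using borel_measurable_continuous_onI[OF continuous_N] by (intro measurable_completion) simp

definition C2 :: real where
  "C2 = real_of_ereal (esssup lebesgue (\<lambda>\<xi>. ereal (norm (grad N \<xi>))))"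

text \<open>Off the origin the gradient is continuous, so the set where an essential bound fails is
  open and null, hence empty.\<close>

lemma C2_nonneg: "C2 \<ge> 0"
  and grad_N_le_C2: "x \<noteq> 0 \<Longrightarrow> norm (grad N x) \<le> C2"
proof -
  let ?f = "\<lambda>\<xi>. ereal (norm (grad N \<xi>))"
  let ?e = "esssup lebesgue ?f"
  obtain M where M: "\<And>x. norm (grad N x) \<le> M" using hgrad_N_bounded by blast
  have "?e \<le> ereal M" by (rule esssup_I) (use M in auto)
  moreover have ae: "AE x in lebesgue. ?f x \<le> ?e" by (rule esssup_AE)
  \<comment> \<open>Since the measure is nontrivial, the bound by the supremum holds at some point.
    The supremum is therefore nonnegative and finite, and \<open>real_of_ereal\<close> preserves
    it.\<close>
  have "\<not> (AE x in (lebesgue :: (real^'n) measure). False)"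
    using AE_iff_null_sets[of UNIV "lebesgue :: (real^'n) measure"] negligible_iff_null_sets[of "UNIV :: (real^'n) set"]
    by simp
  then have "\<exists>x. ?f x \<le> ?e" using ae by (metis (mono_tags, lifting) eventually_mono)
  then have "0 \<le> ?e" by (meson ereal_less_eq(5) norm_ge_zero order_trans)
  ultimately have e: "?e = ereal C2" and nn: "C2 \<ge> 0"
    unfolding C2_def by (auto simp: ereal_real real_of_ereal_pos)
  show "C2 \<ge> 0" by fact
  show "norm (grad N x) \<le> C2" if x: "x \<noteq> 0"
  proof (rule ccontr)
    assume "\<not> norm (grad N x) \<le> C2"
    define U where "U = (UNIV - {0}) \<inter> (\<lambda>y. norm (grad N y)) -` {C2<..}"
    have "open U" unfolding U_def
      by (rule continuous_open_preimage) (auto intro!: continuous_intros continuous_on_hgrad_N)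
    moreover have "x \<in> U" using x \<open>\<not> norm (grad N x) \<le> C2\<close> by (auto simp: U_def)
    ultimately have "\<not> negligible U" using open_not_negligible by blast
    moreover have "AE y in lebesgue. y \<notin> U"
      using ae by eventually_elim (auto simp: U_def e)
    then have "U \<in> null_sets lebesgue"
      using AE_iff_null_sets[of U lebesgue] \<open>open U\<close> by auto
    ultimately show False by (simp add: negligible_iff_null_sets)
  qed
qed

lemma N_growth_along_curve:
  assumes L: "L \<in> cc_lengths (\<odot>) deg \<xi> \<eta>" and \<xi>: "\<xi> \<noteq> 0"
  shows "N \<eta> - N \<xi> \<le> C2 * L"
proof -
  obtain a b \<gamma> h S where g: "a \<le> b" "\<gamma> a = \<xi>" "\<gamma> b = \<eta>" "\<gamma> piecewise_C1_differentiable_on {a..b}" "finite S"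
    "\<And>t. t \<in> {a..b} - S \<Longrightarrow> (\<gamma> has_vector_derivative (\<Sum>i\<in>horiz deg. h t i *\<^sub>R V i (\<gamma> t))) (at t)"
    "(\<lambda>t. sqrt (\<Sum>i\<in>horiz deg. (h t i)\<^sup>2)) integrable_on {a..b}"
    "L = integral {a..b} (\<lambda>t. sqrt (\<Sum>i\<in>horiz deg. (h t i)\<^sup>2))"
    using L unfolding cc_lengths_def by blast
  let ?l = "\<lambda>t. sqrt (\<Sum>i\<in>horiz deg. (h t i)\<^sup>2)"
  have l0: "?l t \<ge> 0" for t by (simp add: sum_nonneg)
  have cont: "continuous_on {a..b} \<gamma>" using g(4) by (simp add: piecewise_C1_differentiable_on_def)
  have contN: "continuous_on {a..b} (\<lambda>t. N (\<gamma> t))"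
    by (rule continuous_on_compose2[OF continuous_N[of UNIV] cont]) auto
  \<comment> \<open>\<open>N\<close> is not differentiable at \<open>0\<close>; after the last time \<open>\<tau>\<close> with \<open>N \<le> N \<xi>\<close> the curve avoids \<open>0\<close>.\<close>
  define A where "A = {a..b} \<inter> (\<lambda>t. N (\<gamma> t)) -` {..N \<xi>}"
  have "closed A" unfolding A_def by (rule continuous_closed_preimage[OF contN]) auto
  moreover have "bounded A" using bounded_closed_interval[of a b] by (rule bounded_subset) (auto simp: A_def)
  ultimately have "compact A" by (simp add: compact_eq_bounded_closed)
  then obtain \<tau> where \<tau>: "\<tau> \<in> A" "\<And>t. t \<in> A \<Longrightarrow> t \<le> \<tau>"
    using compact_attains_sup[of A] g(1,2) by (force simp: A_def)
  have \<tau>': "a \<le> \<tau>" "\<tau> \<le> b" "N (\<gamma> \<tau>) \<le> N \<xi>" using \<tau>(1) by (auto simp: A_def)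
  have ne: "\<gamma> t \<noteq> 0" if "t \<in> {\<tau><..b}" for t
  proof
    assume "\<gamma> t = 0"
    then have "t \<in> A" using that \<tau>' N_nonneg[of \<xi>] by (auto simp: A_def)
    then show False using \<tau>(2) that by force
  qed
  \<comment> \<open>Setting the derivative to 0 at the exceptional times and outside the open
    interval makes the bound \<open>f' t \<le> C2 * ?l t\<close> valid for every \<open>t\<close>;
    the fundamental theorem tolerates the finite set \<open>S\<close>.\<close>
  define f' where "f' t = (if t \<in> {\<tau><..<b} - S then \<Sum>i\<in>horiz deg. h t i * grad N (\<gamma> t) $ i else 0)" for t
  have "(f' has_integral (N (\<gamma> b) - N (\<gamma> \<tau>))) {\<tau>..b}"
  proof (rule fundamental_theorem_of_calculus_interior_strong[OF g(5)])
    fix t assume t: "t \<in> {\<tau><..<b} - S"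
    then obtain D where D: "(N has_derivative D) (at (\<gamma> t))"
      using N_differentiable[OF ne[of t]] by (auto simp: differentiable_def)
    have lin: "linear D" using D by (rule has_derivative_linear)
    have "((\<lambda>t. N (\<gamma> t)) has_vector_derivative D (\<Sum>i\<in>horiz deg. h t i *\<^sub>R V i (\<gamma> t))) (at t)"
      using diff_chain_at[OF g(6)[unfolded has_vector_derivative_def] D] t \<tau>'
      by (simp add: has_vector_derivative_def o_def linear_scale[OF lin])
    moreover have "D (\<Sum>i\<in>horiz deg. h t i *\<^sub>R V i (\<gamma> t)) = f' t"
      using t by (auto simp: f'_def linear_sum[OF lin] linear_scale[OF lin] hgrad_eq[OF D] intro!: sum.cong)
    ultimately show "((\<lambda>t. N (\<gamma> t)) has_vector_derivative f' t) (at t)" by simp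
  qed (use \<tau>' contN in \<open>auto intro: continuous_on_subset\<close>)
  moreover have int: "?l integrable_on {\<tau>..b}"
    using g(7) \<tau>' by (auto intro: integrable_subinterval_real)
  then have "((\<lambda>t. C2 * ?l t) has_integral C2 * integral {\<tau>..b} ?l) {\<tau>..b}"
    by (intro has_integral_mult_right integrable_integral)
  moreover have "f' t \<le> C2 * ?l t" for t
  proof (cases "t \<in> {\<tau><..<b} - S")
    case True
    define k where "k = (\<chi> i. if i \<in> horiz deg then h t i else 0)"
    have "f' t = k \<bullet> grad N (\<gamma> t)"
      using True by (auto simp: f'_def k_def inner_vec_def if_distrib[of "\<lambda>r. r * _"] sum.If_cases cong: if_cong)
    also have "\<dots> \<le> norm k * norm (grad N (\<gamma> t))" by (rule norm_cauchy_schwarz)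
    also have "\<dots> \<le> norm k * C2" using True by (intro mult_left_mono grad_N_le_C2 ne) auto
    also have "norm k = ?l t"
      by (auto simp: norm_vec_def L2_set_def k_def if_distrib[of abs] if_distrib[of "\<lambda>r. r ^ 2"] sum.If_cases cong: if_cong)
    finally show ?thesis by (simp add: mult.commute)
  next
    case False
    then have "f' t = 0" unfolding f'_def by (simp only: if_False)
    then show ?thesis using l0[of t] C2_nonneg by (simp only: mult_nonneg_nonneg)
  qed
  ultimately have "N (\<gamma> b) - N (\<gamma> \<tau>) \<le> C2 * integral {\<tau>..b} ?l"
    by (rule has_integral_le)
  also have "\<dots> \<le> C2 * L"
    unfolding g(8) using \<tau>' g(7) int l0 by (intro mult_left_mono integral_subset_le C2_nonneg) auto
  finally show ?thesis using g(3) \<tau>'(3) by simp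
qed

text \<open>If \<open>C2\<close> were 0, \<open>N\<close> could not grow along a horizontal curve,
  yet Chow's theorem joins \<open>x\<close> to \<open>\<delta> 2 x\<close>, where \<open>N\<close>
  is twice as large.\<close>

lemma C2_pos: "C2 > 0"
proof -
  obtain i :: 'n where True by simp
  define x :: "real^'n" where "x = axis i 1"
  have x: "x \<noteq> 0" by (simp add: x_def axis_eq_0_iff)
  obtain L where L: "L \<in> cc_lengths (\<odot>) deg x (\<delta> 2 x)" using cc_lengths_nonempty by blast
  have "N x \<le> C2 * L" using N_growth_along_curve[OF L x] by (simp add: N_dil)
  then have "C2 * L > 0" using N_pos[OF x] by linarith
  then show ?thesis using C2_nonneg by (metis less_eq_real_def mult_zero_left less_irrefl)
qed

lemma N_diff_le_d_CC:
  assumes "\<xi> \<noteq> 0"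
  shows "(N \<eta> - N \<xi>) / C2 \<le> d_CC (\<odot>) deg \<xi> \<eta>"
  unfolding d_CC_def
proof (rule cInf_greatest[OF cc_lengths_nonempty])
  fix L assume "L \<in> cc_lengths (\<odot>) deg \<xi> \<eta>"
  then show "(N \<eta> - N \<xi>) / C2 \<le> L"
    using N_growth_along_curve[OF _ assms] C2_pos by (simp add: field_simps)
qed

lemma open_N_ball: "open {\<xi>. N \<xi> < R}"
  by (intro open_Collect_less continuous_N continuous_on_const)

text \<open>Nonemptiness gives the infima over the frontier a meaning: a suitable dilate of a
  nonzero point lies outside the ball.\<close>

lemma frontier_N_ball:
  assumes "R > 0"
  shows "frontier {\<xi>. N \<xi> < R} \<noteq> {}" and "\<eta> \<in> frontier {\<xi>. N \<xi> < R} \<Longrightarrow> N \<eta> = R"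
proof -
  let ?\<Omega> = "{\<xi>. N \<xi> < R}"
  obtain i :: 'n where True by simp
  define x :: "real^'n" where "x = axis i 1"
  have x: "N x > 0" by (rule N_pos) (simp add: x_def axis_eq_0_iff)
  have "\<delta> (R / N x) x \<notin> ?\<Omega>" using x assms by (simp add: N_dil)
  moreover have "0 \<in> ?\<Omega>" using assms by simp
  ultimately show "frontier ?\<Omega> \<noteq> {}" unfolding frontier_eq_empty by blast
  have "closed {\<xi>. N \<xi> \<le> R}" by (intro closed_Collect_le continuous_N continuous_on_const)
  then have "closure ?\<Omega> \<subseteq> {\<xi>. N \<xi> \<le> R}" by (intro closure_minimal) auto
  then show "N \<eta> = R" if "\<eta> \<in> frontier ?\<Omega>"
    using that interior_open[OF open_N_ball[of R]] by (auto simp: frontier_def)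
qed

lemma d_CC_frontier_ge:
  assumes "R > 0" "\<xi> \<noteq> 0"
  shows "(R - N \<xi>) / C2 \<le> Inf ((\<lambda>\<eta>. d_CC (\<odot>) deg \<xi> \<eta>) ` frontier {\<xi>. N \<xi> < R})"
proof (rule cInf_greatest)
  fix d assume "d \<in> (\<lambda>\<eta>. d_CC (\<odot>) deg \<xi> \<eta>) ` frontier {\<xi>. N \<xi> < R}"
  then obtain \<eta> where "\<eta> \<in> frontier {\<xi>. N \<xi> < R}" "d = d_CC (\<odot>) deg \<xi> \<eta>" by blast
  then show "(R - N \<xi>) / C2 \<le> d"
    using N_diff_le_d_CC[OF assms(2), of \<eta>] frontier_N_ball(2)[OF assms(1)] by simp
qed (use frontier_N_ball(1)[OF assms(1)] in auto)

lemma norm_distance_frontier_ge: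
  assumes "R > 0" and dist: "is_distance (\<lambda>\<xi> \<eta>. N (ginv \<xi> \<odot> \<eta>))"
  shows "R - N \<xi> \<le> Inf ((\<lambda>\<eta>. N (ginv \<xi> \<odot> \<eta>)) ` frontier {\<xi>. N \<xi> < R})"
proof (rule cInf_greatest)
  fix d assume "d \<in> (\<lambda>\<eta>. N (ginv \<xi> \<odot> \<eta>)) ` frontier {\<xi>. N \<xi> < R}"
  then obtain \<eta> where \<eta>: "\<eta> \<in> frontier {\<xi>. N \<xi> < R}" "d = N (ginv \<xi> \<odot> \<eta>)" by blast
  have "N (ginv 0 \<odot> \<eta>) \<le> N (ginv 0 \<odot> \<xi>) + N (ginv \<xi> \<odot> \<eta>)"
    using dist unfolding is_distance_def by blast
  then show "R - N \<xi> \<le> d"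
    using frontier_N_ball(2)[OF assms(1) \<eta>(1)] \<eta>(2) by simp
qed (use frontier_N_ball(1)[OF assms(1)] in auto)

text \<open>Serves both distances, with \<open>C = C2\<close> and \<open>C = 1\<close>. The bound on
  \<open>d\<close> is asked off the null set containing only the origin, and the integrals are
  compared by monotonicity, which holds for arbitrary integrands; measurability of \<open>d\<close>
  is not known.\<close>

lemma hardy_weight_transfer:
  assumes p: "p > 1" and C: "C > 0"
    and u: "u \<in> borel_measurable lebesgue"
    and \<delta>: "\<And>\<xi>. \<xi> \<noteq> 0 \<Longrightarrow> (R - N \<xi>) / C \<le> d \<xi>"
  shows "ennreal (((p - 1) / p * (1 / C)) powr p) *
      (\<integral>\<^sup>+\<xi>\<in>{\<xi>. N \<xi> < R}. ennreal (\<bar>u \<xi>\<bar> powr p / d \<xi> powr p * norm (grad N \<xi>) powr p) \<partial>lebesgue)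
    \<le> ennreal (((p - 1) / p) powr p) *
      (\<integral>\<^sup>+\<xi>\<in>{\<xi>. N \<xi> < R}. ennreal (\<bar>u \<xi>\<bar> powr p / (R - N \<xi>) powr p * norm (grad N \<xi>) powr p) \<partial>lebesgue)"
proof -
  let ?\<Omega> = "{\<xi>. N \<xi> < R}" and ?f = "\<lambda>\<xi>. ennreal (\<bar>u \<xi>\<bar> powr p / (R - N \<xi>) powr p * norm (grad N \<xi>) powr p)"
  have [measurable]: "?\<Omega> \<in> sets lebesgue" using open_N_ball by auto
  note u [measurable]
  have le: "ennreal (\<bar>u \<xi>\<bar> powr p / d \<xi> powr p * norm (grad N \<xi>) powr p) \<le> ennreal (C powr p) * ?f \<xi>"
    if "\<xi> \<noteq> 0" "N \<xi> < R" for \<xi>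
  proof -
    have r: "R - N \<xi> > 0" using that by simp
    have "(R - N \<xi>) powr p / C powr p = ((R - N \<xi>) / C) powr p"
      using r C by (simp add: powr_divide)
    also have "\<dots> \<le> d \<xi> powr p"
      using \<delta>[OF that(1)] r C p by (intro powr_mono2) auto
    finally have le: "(R - N \<xi>) powr p / C powr p \<le> d \<xi> powr p" .
    have pos: "0 < (R - N \<xi>) powr p / C powr p" using r C by simp
    have "\<bar>u \<xi>\<bar> powr p / d \<xi> powr p \<le> \<bar>u \<xi>\<bar> powr p / ((R - N \<xi>) powr p / C powr p)"
      using le pos less_le_trans[OF pos le] by (intro divide_left_mono mult_pos_pos) auto
    also have "\<dots> = C powr p * (\<bar>u \<xi>\<bar> powr p / (R - N \<xi>) powr p)" by simp
    finally have "\<bar>u \<xi>\<bar> powr p / d \<xi> powr p * norm (grad N \<xi>) powr p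
        \<le> C powr p * (\<bar>u \<xi>\<bar> powr p / (R - N \<xi>) powr p * norm (grad N \<xi>) powr p)"
      by (subst mult.assoc[symmetric]) (rule mult_right_mono, auto)
    then have "ennreal (\<bar>u \<xi>\<bar> powr p / d \<xi> powr p * norm (grad N \<xi>) powr p)
        \<le> ennreal (C powr p * (\<bar>u \<xi>\<bar> powr p / (R - N \<xi>) powr p * norm (grad N \<xi>) powr p))"
      by (rule ennreal_leI)
    also have "\<dots> = ennreal (C powr p) * ?f \<xi>" by (rule ennreal_mult') simp
    finally show ?thesis .
  qed
  from AE_lebesgue_neq[of "0 :: real^'n"] have "(\<integral>\<^sup>+\<xi>\<in>?\<Omega>. ennreal (\<bar>u \<xi>\<bar> powr p / d \<xi> powr p * norm (grad N \<xi>) powr p) \<partial>lebesgue)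
      \<le> (\<integral>\<^sup>+\<xi>. ennreal (C powr p) * (?f \<xi> * indicator ?\<Omega> \<xi>) \<partial>lebesgue)"
    by (intro nn_integral_mono_AE) (use le in \<open>auto simp: indicator_def elim!: eventually_mono\<close>)
  also have "\<dots> = ennreal (C powr p) * (\<integral>\<^sup>+\<xi>\<in>?\<Omega>. ?f \<xi> \<partial>lebesgue)"
    by (intro nn_integral_cmult) measurable
  finally have "ennreal (((p - 1) / p * (1 / C)) powr p) *
      (\<integral>\<^sup>+\<xi>\<in>?\<Omega>. ennreal (\<bar>u \<xi>\<bar> powr p / d \<xi> powr p * norm (grad N \<xi>) powr p) \<partial>lebesgue)
    \<le> ennreal (((p - 1) / p * (1 / C)) powr p) * (ennreal (C powr p) * (\<integral>\<^sup>+\<xi>\<in>?\<Omega>. ?f \<xi> \<partial>lebesgue))"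
    by (intro mult_left_mono) auto
  also have "ennreal (((p - 1) / p * (1 / C)) powr p) * (ennreal (C powr p) * X) = ennreal (((p - 1) / p) powr p) * X" for X
  proof -
    have "((p - 1) / p * (1 / C)) powr p * C powr p = ((p - 1) / p) powr p"
      using C p by (subst powr_mult[symmetric]) auto
    then show ?thesis by (simp add: mult.assoc[symmetric] ennreal_mult[symmetric] del: mult_1_right)
  qed
  finally show ?thesis .
qed

end

section \<open>The Hardy inequality for test functions\<close>

text \<open>Young's inequality for \<open>s * a\<close> and \<open>b powr (p - 1) / s\<close> with
  exponents \<open>p\<close> and \<open>p / (p - 1)\<close>. The scale \<open>s\<close> is chosen so
  that \<open>b powr p\<close> receives the coefficient \<open>(p - 1)\<^sup>2 / p\<close>, which
  subtracted from \<open>p - 1\<close> leaves \<open>(p - 1) / p\<close>.\<close>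

lemma young_hardy:
  fixes a b p :: real
  assumes p: "p > 1" and a: "a \<ge> 0" and b: "b \<ge> 0"
  shows "p * a * b powr (p - 1) \<le> (p / (p - 1)) powr (p - 1) * a powr p + (p - 1)\<^sup>2 / p * b powr p"
proof -
  define s where "s = (p / (p - 1)) powr ((p - 1) / p)"
  have s: "s > 0" using p by (simp add: s_def)
  have sp: "s powr p = (p / (p - 1)) powr (p - 1)" using p by (simp add: s_def powr_powr)
  have sq: "s powr (p / (p - 1)) = p / (p - 1)" using p by (simp add: s_def powr_powr)
  have "(s * a) * (b powr (p - 1) / s) \<le> (s * a) powr p / p + (b powr (p - 1) / s) powr (p / (p - 1)) / (p / (p - 1))"
    by (rule Youngs_inequality) (use p a b s in \<open>auto simp: field_simps\<close>)
  also have "(s * a) powr p = (p / (p - 1)) powr (p - 1) * a powr p"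
    using s a by (simp add: powr_mult sp)
  also have "(b powr (p - 1) / s) powr (p / (p - 1)) = b powr p / (p / (p - 1))"
    using s b p by (simp add: powr_divide sq powr_powr)
  finally have "p * (a * b powr (p - 1)) \<le> p * ((p / (p - 1)) powr (p - 1) * a powr p / p + b powr p / (p / (p - 1)) / (p / (p - 1)))"
    using s p by (intro mult_left_mono) auto
  also have "\<dots> = (p / (p - 1)) powr (p - 1) * a powr p + (p - 1)\<^sup>2 / p * b powr p"
    using p by (simp add: distrib_left power2_eq_square)
  finally show ?thesis by (simp add: mult.assoc)
qed

text \<open>Used with \<open>v\<close> and \<open>z\<close> the horizontal gradients of
  \<open>N\<close> and \<open>u\<close>, \<open>\<rho> = R - N\<close>, \<open>h\<close> the cutoff
  and \<open>c1\<close> the weighted derivative of the radial profile. The right side is then the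
  integrand of the harmonicity identity, whose integral is 0. The term with \<open>\<eta>\<close> is
  the price of replacing \<open>\<bar>u\<bar> powr p\<close> by the smooth \<open>w\<close>.\<close>

lemma hardy_pointwise:
  fixes v z :: "'a::real_inner" and u :: real
  assumes p: "p > 1" and h: "h \<ge> 0" and \<rho>: "\<rho> > 0" and \<eta>: "\<eta> > 0"
    and c1: "c1 \<ge> (p - 1) * h * \<rho> powr (- p)"
  defines "w \<equiv> (u\<^sup>2 + \<eta>\<^sup>2) powr (p / 2) - \<eta> powr p"
    and "w' \<equiv> p * u * (u\<^sup>2 + \<eta>\<^sup>2) powr (p / 2 - 1)"
    and "W \<equiv> norm v powr p / \<rho> powr p"
  shows "h * ((p - 1) / p * (W * \<bar>u\<bar> powr p) - (p - 1) * \<eta> powr p * W - (p / (p - 1)) powr (p - 1) * norm z powr p)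
    \<le> norm v powr (p - 2) * (v \<bullet> ((c1 * w) *\<^sub>R v + (h * \<rho> powr (1 - p) * w') *\<^sub>R z))"
proof -
  define s where "s = sqrt (u\<^sup>2 + \<eta>\<^sup>2)"
  have s: "s > 0" unfolding s_def using \<eta> by (simp add: sum_power2_gt_zero_iff)
  have us: "\<bar>u\<bar> \<le> s" unfolding s_def by (simp add: real_le_rsqrt)
  have s2: "u\<^sup>2 + \<eta>\<^sup>2 = s powr 2" using s by (simp add: s_def)
  have sp: "(u\<^sup>2 + \<eta>\<^sup>2) powr a = s powr (2 * a)" for a unfolding s2 by (simp add: powr_powr)
  have w: "w = s powr p - \<eta> powr p" unfolding w_def sp by simp
  have "\<bar>u\<bar> powr p \<le> s powr p" using us p by (intro powr_mono2) auto
  then have wu: "w \<ge> \<bar>u\<bar> powr p - \<eta> powr p" unfolding w by simp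
  have "\<eta> \<le> s" unfolding s_def by (simp add: real_le_rsqrt)
  then have w0: "w \<ge> 0" unfolding w using \<eta> p powr_mono2[of p \<eta> s] by simp
  have w': "\<bar>w'\<bar> \<le> p * s powr (p - 1)"
  proof -
    have "\<bar>w'\<bar> = p * (\<bar>u\<bar> * s powr (p - 2))" unfolding w'_def sp using p by (simp add: abs_mult algebra_simps)
    also have "\<dots> \<le> p * (s powr 1 * s powr (p - 2))" using us s p by (intro mult_left_mono mult_right_mono) auto
    also have "\<dots> = p * s powr (p - 1)" by (simp only: powr_add[symmetric]) simp
    finally show ?thesis .
  qed
  have h1: "norm v powr (p - 2) * (v \<bullet> v) = norm v powr p"
  proof (cases "v = 0")
    case False
    then have "v \<bullet> v = norm v powr 2" by (simp add: dot_square_norm)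
    then show ?thesis by (simp only: powr_add[symmetric]) simp
  qed (use p in auto)
  have h2: "norm v powr (p - 2) * \<bar>v \<bullet> z\<bar> \<le> norm v powr (p - 1) * norm z"
  proof (cases "v = 0")
    case False
    have "norm v powr (p - 2) * \<bar>v \<bullet> z\<bar> \<le> norm v powr (p - 2) * (norm v powr 1 * norm z)"
      using Cauchy_Schwarz_ineq2[of v z] by (intro mult_left_mono) auto
    also have "\<dots> = norm v powr (p - 1) * norm z"
      by (simp only: mult.assoc[symmetric] powr_add[symmetric]) simp
    finally show ?thesis .
  qed auto
  \<comment> \<open>With this \<open>b\<close>, Young's inequality produces \<open>b powr p\<close>,
    which is the Hardy weight times \<open>w + \<eta> powr p\<close> and can be absorbed by the term
    with \<open>c1\<close>.\<close>
  define b where "b = norm v * s / \<rho>"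
  have b: "b \<ge> 0" using s \<rho> by (simp add: b_def)
  have bp: "b powr a = norm v powr a * s powr a * \<rho> powr (- a)" for a
    unfolding b_def using s \<rho> by (simp add: powr_divide powr_mult powr_minus_divide)
  have W: "W = norm v powr p * \<rho> powr (- p)" unfolding W_def by (simp add: powr_minus divide_inverse)
  have W0: "W \<ge> 0" unfolding W_def by simp
  have bpp: "b powr p = W * (w + \<eta> powr p)" unfolding bp W w by simp
  have "norm v powr (p - 2) * \<bar>(h * \<rho> powr (1 - p) * w') * (v \<bullet> z)\<bar>
      = (h * \<rho> powr (1 - p) * \<bar>w'\<bar>) * (norm v powr (p - 2) * \<bar>v \<bullet> z\<bar>)"
    using h by (simp add: abs_mult algebra_simps)
  also have "\<dots> \<le> (h * \<rho> powr (1 - p) * (p * s powr (p - 1))) * (norm v powr (p - 1) * norm z)"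
    using h w' p by (intro mult_mono[OF mult_left_mono[OF w'] h2]) auto
  also have "\<dots> = h * (p * norm z * b powr (p - 1))" unfolding bp by (simp add: algebra_simps)
  also have "\<dots> \<le> h * ((p / (p - 1)) powr (p - 1) * norm z powr p + (p - 1)\<^sup>2 / p * b powr p)"
    using h by (intro mult_left_mono young_hardy p b) auto
  finally have "\<bar>norm v powr (p - 2) * ((h * \<rho> powr (1 - p) * w') * (v \<bullet> z))\<bar>
      \<le> h * ((p / (p - 1)) powr (p - 1) * norm z powr p + (p - 1)\<^sup>2 / p * (W * (w + \<eta> powr p)))"
    unfolding bpp by (simp only: abs_mult abs_of_nonneg[OF powr_ge_zero])
  then have 2: "norm v powr (p - 2) * ((h * \<rho> powr (1 - p) * w') * (v \<bullet> z))
      \<ge> - (h * ((p / (p - 1)) powr (p - 1) * norm z powr p + (p - 1)\<^sup>2 / p * (W * (w + \<eta> powr p))))"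
    by linarith
  have "(p - 1) * h * \<rho> powr (- p) * (w * norm v powr p) \<le> c1 * (w * norm v powr p)"
    using c1 w0 by (intro mult_right_mono) auto
  then have 1: "h * ((p - 1) * (W * w)) \<le> norm v powr (p - 2) * ((c1 * w) * (v \<bullet> v))"
    using h1 unfolding W by (simp add: algebra_simps)
  have "norm v powr (p - 2) * (v \<bullet> ((c1 * w) *\<^sub>R v + (h * \<rho> powr (1 - p) * w') *\<^sub>R z))
     = norm v powr (p - 2) * ((c1 * w) * (v \<bullet> v)) + norm v powr (p - 2) * ((h * \<rho> powr (1 - p) * w') * (v \<bullet> z))"
    by (simp add: inner_add_right distrib_left)
  also have "\<dots> \<ge> h * ((p - 1) * (W * w)) - h * ((p / (p - 1)) powr (p - 1) * norm z powr p + (p - 1)\<^sup>2 / p * (W * (w + \<eta> powr p)))"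
    using 1 2 by linarith
  also have "h * ((p - 1) * (W * w)) - h * ((p / (p - 1)) powr (p - 1) * norm z powr p + (p - 1)\<^sup>2 / p * (W * (w + \<eta> powr p)))
      = h * ((p - 1) / p * (W * w) - (p - 1)\<^sup>2 / p * (W * \<eta> powr p) - (p / (p - 1)) powr (p - 1) * norm z powr p)"
  proof -
    have "(p - 1) - (p - 1)\<^sup>2 / p = (p - 1) / p" using p by (simp add: field_simps power2_eq_square)
    then have e: "(p - 1) * (W * w) - (p - 1)\<^sup>2 / p * (W * w) = (p - 1) / p * (W * w)"
      by (simp only: left_diff_distrib[symmetric])
    have gen: "h * (a * (W * w)) - h * (B + c * (W * (w + y))) = h * ((a * (W * w) - c * (W * w)) - c * (W * y) - B)"
      for a c y B by (simp add: algebra_simps)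
    show ?thesis by (simp only: gen e)
  qed
  also have "\<dots> \<ge> h * ((p - 1) / p * (W * \<bar>u\<bar> powr p) - (p - 1) * \<eta> powr p * W - (p / (p - 1)) powr (p - 1) * norm z powr p)"
  proof -
    have "(p - 1) / p * (W * (\<bar>u\<bar> powr p - \<eta> powr p)) \<le> (p - 1) / p * (W * w)"
      using p W0 wu by (intro mult_left_mono) auto
    moreover have "(p - 1) / p + (p - 1)\<^sup>2 / p = p - 1" using p by (simp add: field_simps power2_eq_square)
    then have "(p - 1) / p * (W * \<eta> powr p) + (p - 1)\<^sup>2 / p * (W * \<eta> powr p) = (p - 1) * (W * \<eta> powr p)"
      by (simp only: distrib_right[symmetric])
    ultimately have "(p - 1) / p * (W * \<bar>u\<bar> powr p) - (p - 1) * \<eta> powr p * W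
        \<le> (p - 1) / p * (W * w) - (p - 1)\<^sup>2 / p * (W * \<eta> powr p)"
      by (simp add: right_diff_distrib mult_ac)
    then show ?thesis using h by (intro mult_left_mono) auto
  qed
  finally show ?thesis .
qed

lemma DERIV_nonneg_of_mono:
  fixes f :: "real \<Rightarrow> real"
  assumes "mono f" "(f has_real_derivative D) (at x)"
  shows "D \<ge> 0"
proof (rule ccontr)
  assume "\<not> D \<ge> 0"
  then obtain d where "d > 0" "\<And>h. h > 0 \<Longrightarrow> h < d \<Longrightarrow> f (x + h) < f x"
    using DERIV_neg_dec_right[OF assms(2)] by auto
  then have "f (x + d / 2) < f x" by simp
  then show False using monoD[OF assms(1), of x "x + d / 2"] \<open>d > 0\<close> by simp
qed

text \<open>All three terms of the product rule are nonnegative, as \<open>q \<ge> 1\<close> and the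
  cutoff is nondecreasing. Only the term from \<open>(R - r) powr (1 - p)\<close> is kept.\<close>

lemma hardy_weight_derivative:
  fixes R q p n r :: real
  assumes p: "p > 1" and q: "q \<ge> 1" and n: "n > 0" and r: "0 < r" "r < R"
  shows "\<exists>D. ((\<lambda>r. r powr (q - 1) * exp_cutoff (n * r - 1) * (R - r) powr (1 - p)) has_real_derivative D) (at r)
    \<and> (p - 1) * exp_cutoff (n * r - 1) * (R - r) powr (- p) \<le> r powr (1 - q) * D"
proof -
  let ?h = "\<lambda>r. exp_cutoff (n * r - 1)"
  have "has_pd exp_cutoff 1 (pd 1 exp_cutoff (n * r - 1)) (n * r - 1)"
    using smooth_on_has_pd[OF smooth_on_exp_cutoff[of UNIV]] by simp
  then have "(exp_cutoff has_real_derivative pd 1 exp_cutoff (n * r - 1)) (at (n * r - 1))"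
    by (simp only: has_pd_real)
  moreover have "((\<lambda>r. n * r - 1) has_real_derivative n) (at r)" by (auto intro!: derivative_eq_intros)
  ultimately obtain E where E: "(?h has_real_derivative E) (at r)"
    using DERIV_chain2[where f = exp_cutoff and g = "\<lambda>r. n * r - 1"] by blast
  have "mono ?h" using n by (intro monoI exp_cutoff_mono) simp
  then have E0: "E \<ge> 0" using E by (rule DERIV_nonneg_of_mono)
  let ?D = "(q - 1) * r powr (q - 2) * ?h r * (R - r) powr (1 - p) + r powr (q - 1) * E * (R - r) powr (1 - p)
    + r powr (q - 1) * ?h r * ((p - 1) * (R - r) powr (- p))"
  have "((\<lambda>r. r powr (q - 1) * ?h r * (R - r) powr (1 - p)) has_real_derivative ?D) (at r)"
  proof -
    have 1: "((\<lambda>r. r powr (q - 1)) has_real_derivative (q - 1) * r powr (q - 2)) (at r)"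
      and 2: "((\<lambda>r. (R - r) powr (1 - p)) has_real_derivative (p - 1) * (R - r) powr (- p)) (at r)"
      using r by (auto intro!: derivative_eq_intros simp: algebra_simps)
    show ?thesis
      by (rule DERIV_cong[OF DERIV_mult[OF DERIV_mult[OF 1 E] 2]]) (simp add: algebra_simps)
  qed
  moreover have eq: "(p - 1) * ?h r * (R - r) powr (- p) = r powr (1 - q) * (r powr (q - 1) * ?h r * ((p - 1) * (R - r) powr (- p)))"
  proof -
    have "r powr (1 - q) * r powr (q - 1) = 1" using r by (simp add: powr_add[symmetric])
    then have e: "r powr (1 - q) * (r powr (q - 1) * ?h r * c) = ?h r * c" for c
      by (simp only: mult.assoc[symmetric] mult_1)
    show ?thesis unfolding e by (simp only: mult_ac)
  qed
  moreover have "r powr (1 - q) * (r powr (q - 1) * ?h r * ((p - 1) * (R - r) powr (- p))) \<le> r powr (1 - q) * ?D"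
    using q E0 r exp_cutoff_simps(1) by (intro mult_left_mono) auto
  ultimately show ?thesis by (intro exI[of _ ?D] conjI) (simp_all only:)
qed

lemma integrable_lebesgue_bounded_compact:
  fixes f :: "'a::euclidean_space \<Rightarrow> real"
  assumes "f \<in> borel_measurable lebesgue" "compact K" "\<And>x. x \<notin> K \<Longrightarrow> f x = 0" "\<And>x. x \<in> K \<Longrightarrow> \<bar>f x\<bar> \<le> M"
  shows "integrable lebesgue f"
proof (rule integrableI_bounded_set[where A = K and B = M])
  show "K \<in> sets lebesgue" using assms(2) by (rule fmeasurableD[OF lmeasurable_compact])
  show "emeasure lebesgue K < \<infinity>"
    using fmeasurableD2[OF lmeasurable_compact[OF assms(2)]] by (simp add: less_top)
qed (use assms in auto)

lemma test_fun_measurable: "test_fun \<Omega> \<phi> \<Longrightarrow> \<phi> \<in> borel_measurable lebesgue"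
  unfolding test_fun_def
  by (intro measurable_completion) (auto intro!: borel_measurable_continuous_onI smooth_on_continuous)

context carnot
begin

lemma test_fun_grad_continuous: "test_fun \<Omega> \<phi> \<Longrightarrow> continuous_on UNIV (grad \<phi>)"
  unfolding test_fun_def by (intro continuous_on_hgrad) auto

lemma test_fun_grad_measurable: "test_fun \<Omega> \<phi> \<Longrightarrow> grad \<phi> \<in> borel_measurable lebesgue"
  using borel_measurable_continuous_onI[OF test_fun_grad_continuous] by (intro measurable_completion) simp

lemma test_fun_differentiable: "test_fun \<Omega> \<phi> \<Longrightarrow> \<phi> differentiable (at x)"
  unfolding test_fun_def by (auto intro: smooth_on_differentiable)

text \<open>Makes \<open>r powr (Q - 1)\<close> nondecreasing and keeps
  \<open>N x powr (1 - Q)\<close> bounded away from the origin.\<close>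

lemma hom_dim_ge_1: "hom_dim deg \<ge> 1"
proof -
  obtain i :: 'n where True by simp
  have "1 \<le> real (deg i)" using deg_ge_1[of i] by simp
  also have "\<dots> \<le> hom_dim deg" unfolding hom_dim_def by (rule member_le_sum) auto
  finally show ?thesis .
qed

end

locale hardy = carnot_norm gmul ginv deg N
  for gmul :: "real^'n::finite \<Rightarrow> real^'n \<Rightarrow> real^'n" (infixl "\<odot>" 70)
    and ginv :: "real^'n \<Rightarrow> real^'n"
    and deg :: "'n \<Rightarrow> nat"
    and N :: "real^'n \<Rightarrow> real" +
  fixes p R :: real
  assumes p: "p > 1" and R: "R > 0"
    and harmonic: "Lp_harmonic (\<odot>) deg p (UNIV - {0}) (Gamma_p deg N p)"
begin

abbreviation Q :: real where "Q \<equiv> hom_dim deg"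
abbreviation \<Omega> :: "(real^'n) set" where "\<Omega> \<equiv> {\<xi>. N \<xi> < R}"
abbreviation hw :: "(real^'n \<Rightarrow> real) \<Rightarrow> real^'n \<Rightarrow> real" where
  "hw u x \<equiv> \<bar>u x\<bar> powr p / (R - N x) powr p * norm (grad N x) powr p"

text \<open>Hence the vector field \<open>\<bar>\<nabla>\<Gamma>\<bar>\<^sup>p\<^sup>-\<^sup>2\<nabla>\<Gamma>\<close> is a constant multiple of
  \<open>N\<^sup>1\<^sup>-\<^sup>Q\<bar>\<nabla>N\<bar>\<^sup>p\<^sup>-\<^sup>2\<nabla>N\<close>, whether or not \<open>p = Q\<close>.\<close>
lemma grad_Gamma_p:
  obtains \<kappa> where "\<kappa> \<noteq> 0"
    "\<And>x. x \<noteq> 0 \<Longrightarrow> grad (Gamma_p deg N p) x = (\<kappa> * N x powr ((1 - Q) / (p - 1))) *\<^sub>R grad N x"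
proof (cases "p = Q")
  case True
  have "grad (\<lambda>x. - ln (N x)) x = (- 1 * N x powr ((1 - Q) / (p - 1))) *\<^sub>R grad N x" if "x \<noteq> 0" for x
  proof (rule hgrad_compose[OF N_differentiable[OF that]])
    have "(1 - Q) / (p - 1) = - 1" using True p by (simp add: field_simps)
    then show "((\<lambda>r. - ln r) has_real_derivative - 1 * N x powr ((1 - Q) / (p - 1))) (at (N x))"
      using N_pos[OF that] by (auto intro!: derivative_eq_intros simp: powr_minus_divide)
  qed
  moreover have "Gamma_p deg N p = (\<lambda>x. - ln (N x))" using True by (simp add: Gamma_p_def fun_eq_iff)
  ultimately show ?thesis using that[of "-1"] by simp
next
  case False
  let ?a = "(p - Q) / (p - 1)"
  have "grad (\<lambda>x. N x powr ?a) x = (?a * N x powr ((1 - Q) / (p - 1))) *\<^sub>R grad N x" if "x \<noteq> 0" for x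
  proof (rule hgrad_compose[OF N_differentiable[OF that]])
    have "(1 - Q) / (p - 1) = ?a - 1" using p by (simp add: field_simps)
    then show "((\<lambda>r. r powr ?a) has_real_derivative ?a * N x powr ((1 - Q) / (p - 1))) (at (N x))"
      using N_pos[OF that] by (auto intro!: derivative_eq_intros)
  qed
  moreover have "Gamma_p deg N p = (\<lambda>x. N x powr ?a)" using False by (simp add: Gamma_p_def fun_eq_iff)
  ultimately show ?thesis using that[of ?a] False p by simp
qed

lemma harmonic_N:
  assumes "test_fun (UNIV - {0}) \<phi>"
  shows "(\<integral>x. N x powr (1 - Q) * (norm (grad N x) powr (p - 2) * (grad N x \<bullet> grad \<phi> x)) \<partial>lebesgue) = 0"
proof -
  obtain \<kappa> where \<kappa>: "\<kappa> \<noteq> 0"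
    "\<And>x. x \<noteq> 0 \<Longrightarrow> grad (Gamma_p deg N p) x = (\<kappa> * N x powr ((1 - Q) / (p - 1))) *\<^sub>R grad N x"
    by (rule grad_Gamma_p) (rule that)
  let ?I = "\<lambda>x. N x powr (1 - Q) * (norm (grad N x) powr (p - 2) * (grad N x \<bullet> grad \<phi> x))"
  let ?H = "\<lambda>x. norm (grad (Gamma_p deg N p) x) powr (p - 2) * (grad (Gamma_p deg N p) x \<bullet> grad \<phi> x)"
  \<comment> \<open>The exponent \<open>(1 - Q) / (p - 1)\<close> enters once through the vector and
    \<open>p - 2\<close> times through its norm, in total \<open>1 - Q\<close>; the remaining
    constant is nonzero.\<close>
  have eq: "?H x = (\<bar>\<kappa>\<bar> powr (p - 2) * \<kappa>) * ?I x" if x: "x \<noteq> 0" for x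
  proof -
    let ?a = "N x powr ((1 - Q) / (p - 1))"
    have "?a powr (p - 2) * ?a = ?a powr (p - 2) * ?a powr 1" using N_pos[OF x] by simp
    also have "\<dots> = N x powr (1 - Q)"
    proof -
      have "(1 - Q) / (p - 1) * (p - 2) + (1 - Q) / (p - 1) * 1 = (1 - Q) / (p - 1) * (p - 1)"
        by (simp only: distrib_left[symmetric]) simp
      also have "\<dots> = 1 - Q" using p by simp
      finally have "(1 - Q) / (p - 1) * (p - 2) + (1 - Q) / (p - 1) * 1 = 1 - Q" .
      then show ?thesis by (simp only: powr_powr powr_add[symmetric])
    qed
    finally have a: "?a powr (p - 2) * ?a = N x powr (1 - Q)" .
    have "norm (grad (Gamma_p deg N p) x) powr (p - 2) = \<bar>\<kappa>\<bar> powr (p - 2) * ?a powr (p - 2) * norm (grad N x) powr (p - 2)"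
      using \<kappa>(2)[OF x] by (simp add: abs_mult powr_mult)
    then have "?H x = \<bar>\<kappa>\<bar> powr (p - 2) * \<kappa> * ((?a powr (p - 2) * ?a) * (norm (grad N x) powr (p - 2) * (grad N x \<bullet> grad \<phi> x)))"
      using \<kappa>(2)[OF x] by (simp add: mult_ac)
    then show ?thesis unfolding a .
  qed
  have m: "grad \<phi> \<in> borel_measurable lebesgue" by (rule test_fun_grad_measurable[OF assms])
  note m [measurable]
  have IM [measurable]: "?I \<in> borel_measurable lebesgue" by measurable
  note ae = AE_lebesgue_neq[of "0 :: real^'n"]
  have "0 = (\<integral>x. ?H x \<partial>lebesgue)" using harmonic assms unfolding Lp_harmonic_def by simp
  also have "\<dots> = (\<integral>x. (\<bar>\<kappa>\<bar> powr (p - 2) * \<kappa>) * ?I x \<partial>lebesgue)"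
  proof (rule integral_cong_AE)
    show "AE x in lebesgue. ?H x = (\<bar>\<kappa>\<bar> powr (p - 2) * \<kappa>) * ?I x"
      using ae by eventually_elim (rule eq)
    show "(\<lambda>x. (\<bar>\<kappa>\<bar> powr (p - 2) * \<kappa>) * ?I x) \<in> borel_measurable lebesgue" by measurable
    \<comment> \<open>The value of the gradient of \<open>Gamma_p\<close> at 0 is unknown, so
      measurability is carried over from a function equal to \<open>?H\<close> off that
      point.\<close>
    show "?H \<in> borel_measurable lebesgue"
    proof (rule measurable_discrete_difference[where X = "{0}"])
      show "(\<lambda>x. (\<bar>\<kappa>\<bar> powr (p - 2) * \<kappa>) * ?I x) \<in> borel_measurable lebesgue" by measurable
      show "(\<bar>\<kappa>\<bar> powr (p - 2) * \<kappa>) * ?I x = ?H x" if "x \<notin> {0}" for x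
        using that by (intro eq[symmetric]) blast
    qed auto
  qed
  also have "\<dots> = (\<bar>\<kappa>\<bar> powr (p - 2) * \<kappa>) * (\<integral>x. ?I x \<partial>lebesgue)" by simp
  finally show ?thesis using \<kappa>(1) by simp
qed

text \<open>Zero where \<open>N x \<le> 1 / (n + 1)\<close>, so products with it vanish near the
  origin; as \<open>n\<close> grows it tends to 1 at every other point.\<close>

definition cutoff :: "nat \<Rightarrow> real^'n \<Rightarrow> real" where
  "cutoff n x = exp_cutoff (real (Suc n) * N x - 1)"

text \<open>The cutoff stays on the left and is dropped on the right. On the compact set
  \<open>K\<close> the gap \<open>R - N\<close> is bounded below, so all integrals involved are
  finite and may be subtracted.\<close>

lemma hardy_cutoff:
  assumes u: "smooth_on UNIV u" and K: "compact K" "K \<subseteq> \<Omega>" and u0: "\<And>x. x \<notin> K \<Longrightarrow> u x = 0"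
  defines "W \<equiv> \<lambda>x. norm (grad N x) powr p / (R - N x) powr p"
  shows "integrable lebesgue (\<lambda>x. indicator K x * (cutoff n x * (W x * \<bar>u x\<bar> powr p)))" (is "integrable _ ?A1")
    and "integrable lebesgue (\<lambda>x. indicator K x * norm (grad u x) powr p)"
    and "((p - 1) / p) powr p * (\<integral>x. indicator K x * (cutoff n x * (W x * \<bar>u x\<bar> powr p)) \<partial>lebesgue)
      \<le> (\<integral>x. indicator K x * norm (grad u x) powr p \<partial>lebesgue)"
proof -
  have tu: "test_fun \<Omega> u" unfolding test_fun_def using u K u0 by blast
  note [measurable] = test_fun_measurable[OF tu] test_fun_grad_measurable[OF tu]
  have [measurable]: "K \<in> sets lebesgue" using K(1) by (rule fmeasurableD[OF lmeasurable_compact])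
  have cutoff_m [measurable]: "cutoff n \<in> borel_measurable lebesgue"
  proof -
    have "continuous_on UNIV exp_cutoff" by (rule smooth_on_continuous[OF smooth_on_exp_cutoff])
    then have "continuous_on UNIV (cutoff n)" unfolding cutoff_def[abs_def]
      by (rule continuous_on_compose2) (auto intro!: continuous_intros continuous_N)
    then show ?thesis using borel_measurable_continuous_onI by (intro measurable_completion) auto
  qed
  have W_m [measurable]: "W \<in> borel_measurable lebesgue" unfolding W_def by measurable
  have cut: "cutoff n x \<ge> 0" "cutoff n x \<le> 1" for x by (auto simp: cutoff_def exp_cutoff_simps)
  obtain M where M: "\<And>x. norm (grad N x) \<le> M" using hgrad_N_bounded by blast
  have M0: "M \<ge> 0" using M[of 0] norm_ge_zero order_trans by blast
  obtain \<rho> where \<rho>: "\<rho> > 0" "\<And>x. x \<in> K \<Longrightarrow> \<rho> \<le> R - N x"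
  proof (cases "K = {}")
    case False
    obtain y where "y \<in> K" "\<And>x. x \<in> K \<Longrightarrow> N x \<le> N y"
      using continuous_attains_sup[OF K(1) False continuous_N] by blast
    then show ?thesis using that[of "R - N y"] K(2) by force
  qed (use that[of 1] in auto)
  have bound: "\<exists>B. \<forall>x\<in>K. norm (f x) \<le> B" if "continuous_on UNIV f" for f :: "real^'n \<Rightarrow> 'b::real_normed_vector"
    using compact_imp_bounded[OF compact_continuous_image[OF continuous_on_subset[OF that subset_UNIV] K(1)]]
    by (auto simp: bounded_iff)
  obtain U where U: "\<And>x. x \<in> K \<Longrightarrow> \<bar>u x\<bar> \<le> U" using bound[OF smooth_on_continuous[OF u]] by auto
  obtain G where G: "\<And>x. x \<in> K \<Longrightarrow> norm (grad u x) \<le> G" using bound[OF test_fun_grad_continuous[OF tu]] by auto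
  have W0: "W x \<ge> 0" for x by (simp add: W_def)
  have WB: "W x \<le> M powr p / \<rho> powr p" if "x \<in> K" for x
    unfolding W_def using M \<rho> that p by (intro frac_le powr_mono2) auto
  have uB: "\<bar>u x\<bar> powr p \<le> U powr p" if "x \<in> K" for x using U[OF that] p by (intro powr_mono2) auto
  have gB: "norm (grad u x) powr p \<le> G powr p" if "x \<in> K" for x using G[OF that] p by (intro powr_mono2) auto
  have prod: "\<bar>c * a\<bar> \<le> A" if "0 \<le> c" "c \<le> 1" "0 \<le> a" "a \<le> A" for c a A :: real
    using that mult_left_le_one_le[of a c] by (simp add: abs_mult)
  show i1: "integrable lebesgue ?A1"
  proof (rule integrable_lebesgue_bounded_compact[OF _ K(1), where M = "M powr p / \<rho> powr p * U powr p"])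
    show "\<bar>?A1 x\<bar> \<le> M powr p / \<rho> powr p * U powr p" if "x \<in> K" for x
      using that cut[of x] W0[of x] WB[OF that] uB[OF that]
      by (simp only: indicator_simps mult_1) (intro prod mult_mono mult_nonneg_nonneg, auto)
  qed auto
  have i2: "integrable lebesgue (\<lambda>x. indicator K x * (cutoff n x * W x))"
  proof (rule integrable_lebesgue_bounded_compact[OF _ K(1), where M = "M powr p / \<rho> powr p"])
    show "\<bar>indicator K x * (cutoff n x * W x)\<bar> \<le> M powr p / \<rho> powr p" if "x \<in> K" for x
      using that cut[of x] W0[of x] WB[OF that]
      by (simp only: indicator_simps mult_1) (intro prod, auto)
  qed auto
  show i3: "integrable lebesgue (\<lambda>x. indicator K x * norm (grad u x) powr p)"
    by (rule integrable_lebesgue_bounded_compact[OF _ K(1), where M = "G powr p"]) (use gB in auto)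
  have i4: "integrable lebesgue (\<lambda>x. indicator K x * (cutoff n x * norm (grad u x) powr p))"
  proof (rule integrable_lebesgue_bounded_compact[OF _ K(1), where M = "G powr p"])
    show "\<bar>indicator K x * (cutoff n x * norm (grad u x) powr p)\<bar> \<le> G powr p" if "x \<in> K" for x
      using that cut[of x] gB[OF that]
      by (simp only: indicator_simps mult_1) (intro prod, auto)
  qed auto
  let ?k = "(p / (p - 1)) powr (p - 1)"
  let ?a1 = "\<integral>x. ?A1 x \<partial>lebesgue" and ?a2 = "\<integral>x. indicator K x * (cutoff n x * W x) \<partial>lebesgue"
    and ?a4 = "\<integral>x. indicator K x * (cutoff n x * norm (grad u x) powr p) \<partial>lebesgue"
    and ?a3 = "\<integral>x. indicator K x * norm (grad u x) powr p \<partial>lebesgue"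
  have main: "(p - 1) / p * ?a1 \<le> (p - 1) * \<eta> powr p * ?a2 + ?k * ?a4" if \<eta>: "\<eta> > 0" for \<eta>
  proof -
    \<comment> \<open>The test function is \<open>\<Phi>(N) w(u)\<close>, where \<open>w(u)\<close> is a smooth substitute for \<open>\<bar>u\<bar>\<^sup>p\<close>. The cutoff in \<open>\<Phi>\<close> is
      nondecreasing, so its derivative enters with the favourable sign and need not be estimated.\<close>
    define w where "w s = (s\<^sup>2 + \<eta>\<^sup>2) powr (p / 2) - \<eta> powr p" for s :: real
    define w' where "w' s = p * s * (s\<^sup>2 + \<eta>\<^sup>2) powr (p / 2 - 1)" for s :: real
    define \<Phi> where "\<Phi> r = r powr (Q - 1) * exp_cutoff (real (Suc n) * r - 1) * (R - r) powr (1 - p)" for r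
    define \<phi> where "\<phi> x = \<Phi> (N x) * w (u x)" for x
    \<comment> \<open>\<open>\<phi>\<close> vanishes off this compact set, which avoids both the
      origin and the boundary; hence \<open>\<phi>\<close> is admissible in the harmonicity
      assumption.\<close>
    define K' where "K' = K \<inter> {x. 1 / real (Suc n) \<le> N x}"
    have pos: "s\<^sup>2 + \<eta>\<^sup>2 > 0" for s using \<eta> by (simp add: add_nonneg_pos)
    \<comment> \<open>The subtracted \<open>\<eta> powr p\<close> makes \<open>w\<close> vanish at
      0, so \<open>\<phi>\<close> vanishes wherever \<open>u\<close> does.\<close>
    have w0: "w 0 = 0" using \<eta> by (simp add: w_def powr_powr flip: powr_numeral)
    have wder: "(w has_real_derivative w' s) (at s)" for s
      unfolding w_def w'_def using pos[of s] by (auto intro!: derivative_eq_intros simp: field_simps)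
    have K': "compact K'" unfolding K'_def
      by (intro compact_Int_closed K closed_Collect_le continuous_N continuous_on_const)
    have K'0: "x \<noteq> 0 \<and> N x > 0 \<and> N x < R \<and> 1 / real (Suc n) \<le> N x" if "x \<in> K'" for x
    proof -
      have "0 < 1 / real (Suc n)" by simp
      also have "\<dots> \<le> N x" using that by (simp add: K'_def)
      finally show ?thesis using that K(2) by (auto simp: K'_def)
    qed
    have \<phi>0: "\<phi> x = 0" if "x \<notin> K'" for x
    proof (cases "x \<in> K")
      case True
      then have "real (Suc n) * N x - 1 \<le> 0" using that by (simp add: K'_def field_simps)
      then show ?thesis by (simp only: \<phi>_def \<Phi>_def exp_cutoff_simps(4) mult_zero_right mult_zero_left)
    qed (simp add: \<phi>_def u0 w0)
    have sm\<Phi>: "smooth_on {0<..<R} \<Phi>"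
    proof -
      have lin: "smooth_on {0<..<R} (\<lambda>r. a * r + b)" for a b :: real
        by (intro smooth_on_add smooth_on_mult smooth_on_const smooth_on_bounded_linear bounded_linear_ident) auto
      have "smooth_on {0<..<R} (\<lambda>r. exp_cutoff (real (Suc n) * r + (-1)))"
        by (rule smooth_on_real_compose[OF _ open_UNIV smooth_on_exp_cutoff lin]) auto
      moreover have "smooth_on {0<..<R} (\<lambda>r. (-1 * r + R) powr (1 - p))"
        by (rule smooth_on_real_compose[OF _ _ smooth_on_powr lin]) auto
      moreover have "smooth_on {0<..<R} (\<lambda>r. r powr (Q - 1))"
        by (rule smooth_on_subset[OF smooth_on_powr]) auto
      ultimately show ?thesis
        unfolding \<Phi>_def[abs_def] by (intro smooth_on_mult) (auto simp: algebra_simps)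
    qed
    have smw: "smooth_on UNIV w"
    proof -
      have quad: "smooth_on UNIV (\<lambda>s::real. s * s + \<eta>\<^sup>2)"
        by (intro smooth_on_add smooth_on_mult smooth_on_const smooth_on_bounded_linear bounded_linear_ident) auto
      have "smooth_on UNIV (\<lambda>s::real. (s * s + \<eta>\<^sup>2) powr (p / 2))"
        by (rule smooth_on_real_compose[OF _ _ smooth_on_powr quad]) (use pos in \<open>auto simp: power2_eq_square\<close>)
      then show ?thesis unfolding w_def[abs_def]
        by (intro smooth_on_diff smooth_on_const) (auto simp: power2_eq_square)
    qed
    have op: "open (\<Omega> - {0})" using open_N_ball by (intro open_Diff) auto
    have "smooth_on (\<Omega> - {0}) \<phi>"
      unfolding \<phi>_def[abs_def]
    proof (intro smooth_on_mult op)
      show "smooth_on (\<Omega> - {0}) (\<lambda>x. \<Phi> (N x))"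
        by (rule smooth_on_real_compose[OF op _ sm\<Phi> smooth_on_subset[OF smooth_N]]) (auto intro: N_pos)
      show "smooth_on (\<Omega> - {0}) (\<lambda>x. w (u x))"
        by (rule smooth_on_real_compose[OF op open_UNIV smw smooth_on_subset[OF u]]) auto
    qed
    then have "test_fun (\<Omega> - {0}) \<phi>"
      by (rule test_fun_vanishing_outside[OF op _ K']) (use K'0 \<phi>0 in auto)
    then have t\<phi>: "test_fun (UNIV - {0}) \<phi>" unfolding test_fun_def by blast
    let ?I = "\<lambda>x. N x powr (1 - Q) * (norm (grad N x) powr (p - 2) * (grad N x \<bullet> grad \<phi> x))"
    let ?J = "\<lambda>x. (p - 1) / p * ?A1 x - (p - 1) * \<eta> powr p * (indicator K x * (cutoff n x * W x))
        - ?k * (indicator K x * (cutoff n x * norm (grad u x) powr p))"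
    have g0: "grad \<phi> x = 0" if "x \<notin> K'" for x
      by (rule hgrad_eq_0[of "- K'"]) (use that \<phi>0 K' in \<open>auto intro: compact_imp_closed\<close>)
    note [measurable] = test_fun_grad_measurable[OF t\<phi>]
    have "\<exists>B. \<forall>x\<in>K'. norm (grad \<phi> x) \<le> B"
      using compact_imp_bounded[OF compact_continuous_image[OF continuous_on_subset[OF test_fun_grad_continuous[OF t\<phi>] subset_UNIV] K']]
      by (auto simp: bounded_iff)
    then obtain B where B: "\<And>x. x \<in> K' \<Longrightarrow> norm (grad \<phi> x) \<le> B" by blast
    have intI: "integrable lebesgue ?I"
    proof (rule integrable_lebesgue_bounded_compact[OF _ K', where M = "(1 / real (Suc n)) powr (1 - Q) * (M powr (p - 1) * B)"])
      show "?I \<in> borel_measurable lebesgue" by measurable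
      show "?I x = 0" if "x \<notin> K'" for x using g0[OF that] by simp
      fix x assume x: "x \<in> K'"
      have "N x powr (1 - Q) \<le> (1 / real (Suc n)) powr (1 - Q)"
        using K'0[OF x] hom_dim_ge_1 by (intro powr_mono2') auto
      moreover have "norm (grad N x) powr (p - 2) * \<bar>grad N x \<bullet> grad \<phi> x\<bar> \<le> M powr (p - 1) * B"
      proof (cases "grad N x = 0")
        case True
        have "B \<ge> 0" using B[OF x] norm_ge_zero order_trans by blast
        then show ?thesis using True by simp
      next
        case False
        have "norm (grad N x) powr (p - 2) * \<bar>grad N x \<bullet> grad \<phi> x\<bar>
            \<le> norm (grad N x) powr (p - 2) * (norm (grad N x) powr 1 * norm (grad \<phi> x))"
          using Cauchy_Schwarz_ineq2[of "grad N x" "grad \<phi> x"] by (intro mult_left_mono) auto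
        also have "\<dots> = norm (grad N x) powr (p - 1) * norm (grad \<phi> x)"
          by (simp only: mult.assoc[symmetric] powr_add[symmetric]) simp
        also have "\<dots> \<le> M powr (p - 1) * B"
          using M[of x] B[OF x] p by (intro mult_mono powr_mono2) auto
        finally show ?thesis .
      qed
      ultimately show "\<bar>?I x\<bar> \<le> (1 / real (Suc n)) powr (1 - Q) * (M powr (p - 1) * B)"
        by (simp only: abs_mult abs_of_nonneg[OF powr_ge_zero])
          (rule mult_mono, auto)
    qed
    have JI: "?J x \<le> ?I x" for x
    proof (cases "x \<in> K'")
      case True
      note x = K'0[OF True]
      obtain D where D: "(\<Phi> has_real_derivative D) (at (N x))"
        "(p - 1) * cutoff n x * (R - N x) powr (- p) \<le> N x powr (1 - Q) * D"
        using hardy_weight_derivative[OF p hom_dim_ge_1, of "real (Suc n)" "N x" R] x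
        unfolding \<Phi>_def cutoff_def by auto
      have d\<Phi>: "(\<lambda>x. \<Phi> (N x)) differentiable (at x)"
        by (rule differentiable_compose[of \<Phi>]) (use D(1) x N_differentiable in \<open>auto simp: has_field_derivative_def differentiable_def\<close>)
      have dw: "(\<lambda>x. w (u x)) differentiable (at x)"
        by (rule differentiable_compose[of w]) (use wder test_fun_differentiable[OF tu] in \<open>auto simp: has_field_derivative_def differentiable_def\<close>)
      have "grad \<phi> x = \<Phi> (N x) *\<^sub>R (w' (u x) *\<^sub>R grad u x) + w (u x) *\<^sub>R (D *\<^sub>R grad N x)"
        unfolding \<phi>_def[abs_def] hgrad_mult[OF d\<Phi> dw]
        using hgrad_compose[OF N_differentiable D(1)] hgrad_compose[OF test_fun_differentiable[OF tu] wder] x by simp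
      then have "?I x = norm (grad N x) powr (p - 2) * (grad N x \<bullet> ((N x powr (1 - Q) * D * w (u x)) *\<^sub>R grad N x
          + (N x powr (1 - Q) * \<Phi> (N x) * w' (u x)) *\<^sub>R grad u x))"
        by (simp add: inner_add_right algebra_simps)
      also have "N x powr (1 - Q) * \<Phi> (N x) = cutoff n x * (R - N x) powr (1 - p)"
        unfolding \<Phi>_def cutoff_def using x by (simp add: mult.assoc[symmetric] powr_add[symmetric])
      also have "norm (grad N x) powr (p - 2) * (grad N x \<bullet> ((N x powr (1 - Q) * D * w (u x)) *\<^sub>R grad N x
          + (cutoff n x * (R - N x) powr (1 - p) * w' (u x)) *\<^sub>R grad u x))
        \<ge> cutoff n x * ((p - 1) / p * (W x * \<bar>u x\<bar> powr p) - (p - 1) * \<eta> powr p * W x - ?k * norm (grad u x) powr p)"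
        unfolding W_def w_def w'_def
        by (rule hardy_pointwise[OF p _ _ \<eta> D(2)]) (use cut x in auto)
      finally show ?thesis using True by (simp add: K'_def algebra_simps)
    next
      case False
      have "indicator K x * cutoff n x = 0"
      proof (cases "x \<in> K")
        case True
        then have "real (Suc n) * N x - 1 \<le> 0" using False by (simp add: K'_def field_simps)
        then show ?thesis by (simp only: cutoff_def exp_cutoff_simps(4) mult_zero_right)
      qed simp
      then have "?J x = 0" by auto
      then show ?thesis using g0[OF False] by simp
    qed
    have "(\<integral>x. ?J x \<partial>lebesgue) \<le> (\<integral>x. ?I x \<partial>lebesgue)"
      using intI i1 i2 i4 JI by (intro integral_mono) auto
    also have "\<dots> = 0" by (rule harmonic_N[OF t\<phi>])
    also have "(\<integral>x. ?J x \<partial>lebesgue) = (p - 1) / p * ?a1 - (p - 1) * \<eta> powr p * ?a2 - ?k * ?a4"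
      using i1 i2 i4 by simp
    finally show ?thesis by simp
  qed
  \<comment> \<open>Now \<open>\<eta>\<close> tends to 0 with \<open>n\<close> fixed;
    \<open>?a2\<close> does not depend on \<open>\<eta>\<close>, so the error disappears.\<close>
  have "(p - 1) / p * ?a1 \<le> 0 + ?k * ?a4"
  proof (rule tendsto_lowerbound)
    have "((\<lambda>\<eta>. (p - 1) * \<eta> powr p * ?a2 + ?k * ?a4) \<longlongrightarrow> (p - 1) * 0 powr p * ?a2 + ?k * ?a4) (at_right 0)"
      using p by (intro tendsto_intros tendsto_powr') (auto simp: eventually_at_filter)
    then show "((\<lambda>\<eta>. (p - 1) * \<eta> powr p * ?a2 + ?k * ?a4) \<longlongrightarrow> 0 + ?k * ?a4) (at_right 0)" using p by simp
    show "\<forall>\<^sub>F \<eta> in at_right 0. (p - 1) / p * ?a1 \<le> (p - 1) * \<eta> powr p * ?a2 + ?k * ?a4"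
      using main by (auto simp: eventually_at_filter)
  qed simp
  also have "?a4 \<le> ?a3"
    using i3 i4 cut by (intro integral_mono) (auto simp: indicator_def mult_left_le_one_le)
  finally have fin: "(p - 1) / p * ?a1 \<le> ?k * ?a3" by (simp add: mult_left_mono)
  \<comment> \<open>\<open>?k\<close> is the reciprocal of
    \<open>((p - 1) / p) powr (p - 1)\<close>; multiplying by the latter raises the factor
    \<open>(p - 1) / p\<close> to its p-th power.\<close>
  have pk: "((p - 1) / p) powr (p - 1) * ?k = 1"
    using p by (subst powr_mult[symmetric]) auto
  have "((p - 1) / p) powr p * ?a1 = ((p - 1) / p) powr (p - 1) * ((p - 1) / p * ?a1)"
    using p powr_add[of "(p - 1) / p" "p - 1" 1] by simp
  also have "\<dots> \<le> ((p - 1) / p) powr (p - 1) * (?k * ?a3)" using fin by (intro mult_left_mono) auto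
  also have "\<dots> = ?a3" using pk by (simp add: mult.assoc[symmetric])
  finally show "((p - 1) / p) powr p * ?a1 \<le> ?a3" .
qed

text \<open>Fatou's lemma as the inner cutoff is released; the origin, where the cutoff never tends
  to 1, is a null set.\<close>

lemma hardy_test_fun:
  assumes u: "test_fun \<Omega> u"
  shows "ennreal (((p - 1) / p) powr p) *
      (\<integral>\<^sup>+x\<in>\<Omega>. ennreal (hw u x) \<partial>lebesgue)
    \<le> (\<integral>\<^sup>+x\<in>\<Omega>. ennreal (norm (grad u x) powr p) \<partial>lebesgue)"
proof -
  obtain K where K: "smooth_on UNIV u" "compact K" "K \<subseteq> \<Omega>" "\<And>x. x \<notin> K \<Longrightarrow> u x = 0"
    using u unfolding test_fun_def by blast
  define W where "W x = norm (grad N x) powr p / (R - N x) powr p" for x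
  let ?f = "\<lambda>n x. indicator K x * (cutoff n x * (W x * \<bar>u x\<bar> powr p))"
  let ?g = "\<lambda>x. indicator K x * norm (grad u x) powr p"
  let ?c = "((p - 1) / p) powr p"
  note hc = hardy_cutoff[OF K, folded W_def]
  have cut: "cutoff n x \<ge> 0" for n x by (auto simp: cutoff_def exp_cutoff_simps)
  have W0: "W x \<ge> 0" for x by (simp add: W_def)
  have le: "ennreal ?c * (\<integral>\<^sup>+x. ennreal (?f n x) \<partial>lebesgue) \<le> (\<integral>\<^sup>+x. ennreal (?g x) \<partial>lebesgue)" for n
  proof -
    have "(\<integral>\<^sup>+x. ennreal (?f n x) \<partial>lebesgue) = ennreal (\<integral>x. ?f n x \<partial>lebesgue)"
      by (rule nn_integral_eq_integral[OF hc(1)]) (auto simp: cut W0)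
    moreover have "(\<integral>\<^sup>+x. ennreal (?g x) \<partial>lebesgue) = ennreal (\<integral>x. ?g x \<partial>lebesgue)"
      by (rule nn_integral_eq_integral[OF hc(2)]) auto
    moreover have "(\<integral>x. ?f n x \<partial>lebesgue) \<ge> 0" by (rule Bochner_Integration.integral_nonneg) (auto simp: cut W0)
    ultimately show ?thesis
      using hc(3) by (simp add: ennreal_mult[symmetric] ennreal_leI)
  qed
  have tend: "(\<lambda>n. cutoff n x) \<longlonglongrightarrow> 1" if "x \<noteq> 0" for x
  proof -
    have "filterlim (\<lambda>n. real (Suc n) * N x - 1) at_top sequentially"
      using N_pos[OF that] by real_asymp
    moreover have "(exp_cutoff \<longlongrightarrow> 1) at_top"
    proof (rule Lim_transform_eventually)
      show "((\<lambda>y::real. exp (- 1 / y)) \<longlongrightarrow> 1) at_top" by real_asymp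
      show "\<forall>\<^sub>F y in at_top. exp (- 1 / y) = exp_cutoff y"
        using eventually_gt_at_top[of 0] by eventually_elim (simp add: exp_cutoff_def)
    qed
    ultimately show ?thesis unfolding cutoff_def by (rule filterlim_compose[rotated])
  qed
  note ae = AE_lebesgue_neq[of "0 :: real^'n"]
  have lim: "ennreal (indicator K x * (W x * \<bar>u x\<bar> powr p)) = liminf (\<lambda>n. ennreal (?f n x))" if "x \<noteq> 0" for x
  proof -
    have "(\<lambda>n. ennreal (?f n x)) \<longlonglongrightarrow> ennreal (indicator K x * (1 * (W x * \<bar>u x\<bar> powr p)))"
      by (intro tendsto_ennrealI tendsto_intros tend that)
    then show ?thesis by (simp add: lim_imp_Liminf)
  qed
  have "(\<integral>\<^sup>+x\<in>\<Omega>. ennreal (hw u x) \<partial>lebesgue)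
      = (\<integral>\<^sup>+x. liminf (\<lambda>n. ennreal (?f n x)) \<partial>lebesgue)"
  proof (rule nn_integral_cong_AE, use ae in eventually_elim)
    fix x :: "real^'n" assume x: "x \<noteq> 0"
    have "ennreal (hw u x) * indicator \<Omega> x
        = ennreal (indicator K x * (W x * \<bar>u x\<bar> powr p))"
      using K(3) K(4)[of x] p by (cases "x \<in> K") (auto simp: W_def mult_ac)
    then show "ennreal (hw u x) * indicator \<Omega> x
        = liminf (\<lambda>n. ennreal (?f n x))" using lim[OF x] by simp
  qed
  also have "\<dots> \<le> liminf (\<lambda>n. \<integral>\<^sup>+x. ennreal (?f n x) \<partial>lebesgue)"
    using borel_measurable_integrable[OF hc(1)] by (intro nn_integral_liminf) auto
  finally have "ennreal ?c * (\<integral>\<^sup>+x\<in>\<Omega>. ennreal (hw u x) \<partial>lebesgue)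
      \<le> ennreal ?c * liminf (\<lambda>n. \<integral>\<^sup>+x. ennreal (?f n x) \<partial>lebesgue)"
    by (rule mult_left_mono) simp
  also have "\<dots> \<le> (\<integral>\<^sup>+x. ennreal (?g x) \<partial>lebesgue)"
  proof -
    have c: "ennreal ?c \<noteq> 0" "ennreal ?c \<noteq> top" using p by auto
    have "(\<integral>\<^sup>+x. ennreal (?f n x) \<partial>lebesgue) \<le> (\<integral>\<^sup>+x. ennreal (?g x) \<partial>lebesgue) / ennreal ?c" for n
      using divide_right_mono_ennreal[OF le, where c = "ennreal ?c"] c
      by (simp add: mult.commute[of "ennreal ?c"] mult_divide_eq_ennreal)
    then have "liminf (\<lambda>n. \<integral>\<^sup>+x. ennreal (?f n x) \<partial>lebesgue) \<le> (\<integral>\<^sup>+x. ennreal (?g x) \<partial>lebesgue) / ennreal ?c"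
      by (intro Liminf_le always_eventually) auto
    then have "ennreal ?c * liminf (\<lambda>n. \<integral>\<^sup>+x. ennreal (?f n x) \<partial>lebesgue)
        \<le> ennreal ?c * ((\<integral>\<^sup>+x. ennreal (?g x) \<partial>lebesgue) / ennreal ?c)"
      by (rule mult_left_mono) simp
    then show ?thesis
      using c by (simp add: ennreal_times_divide mult.commute[of "ennreal ?c"] mult_divide_eq_ennreal)
  qed
  also have "\<dots> \<le> (\<integral>\<^sup>+x\<in>\<Omega>. ennreal (norm (grad u x) powr p) \<partial>lebesgue)"
    using K(3) by (intro nn_integral_mono) (auto simp: indicator_def)
  finally show ?thesis .
qed

end

section \<open>The Hardy inequality for limits of test functions\<close>

text \<open>If \<open>b \<le> e * a\<close> the sum is at most \<open>(1 + e) * a\<close>, otherwise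
  at most \<open>(1 + 1 / e) * b\<close>. The first factor can be taken close to 1, so a sharp
  constant survives a small perturbation.\<close>

lemma powr_add_le_split:
  fixes a b e p :: real
  assumes "a \<ge> 0" "b \<ge> 0" "e > 0" "p > 0"
  shows "(a + b) powr p \<le> (1 + e) powr p * a powr p + (1 + 1 / e) powr p * b powr p"
proof (cases "b \<le> e * a")
  case True
  then have "(a + b) powr p \<le> ((1 + e) * a) powr p"
    using assms by (intro powr_mono2) (auto simp: algebra_simps)
  also have "\<dots> = (1 + e) powr p * a powr p" using assms by (simp add: powr_mult)
  finally show ?thesis by (simp add: add_increasing2)
next
  case False
  then have "(a + b) powr p \<le> ((1 + 1 / e) * b) powr p"
    using assms by (intro powr_mono2) (auto simp: field_simps)
  also have "\<dots> = (1 + 1 / e) powr p * b powr p" using assms by (simp add: powr_mult)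
  finally show ?thesis by (simp add: add_increasing)
qed

text \<open>Early members of the sequence may have infinite integral; it is shifted past them so
  that all remaining ones are integrable.\<close>

lemma tendsto_nn_L1_AE_subseq:
  fixes f :: "nat \<Rightarrow> 'a \<Rightarrow> real"
  assumes [measurable]: "\<And>n. f n \<in> borel_measurable M"
    and lim: "(\<lambda>n. \<integral>\<^sup>+x. ennreal \<bar>f n x\<bar> \<partial>M) \<longlonglongrightarrow> 0"
  shows "\<exists>r. strict_mono r \<and> (AE x in M. (\<lambda>n. f (r n) x) \<longlonglongrightarrow> 0)"
proof -
  have "eventually (\<lambda>n. (\<integral>\<^sup>+x. ennreal \<bar>f n x\<bar> \<partial>M) < 1) sequentially"
    using order_tendstoD(2)[OF lim, of 1] by simp
  then obtain k where k: "\<And>n. n \<ge> k \<Longrightarrow> (\<integral>\<^sup>+x. ennreal \<bar>f n x\<bar> \<partial>M) < 1"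
    unfolding eventually_sequentially by blast
  have int: "integrable M (f (n + k))" for n
    using k[of "n + k"] by (intro integrableI_bounded) (auto simp: less_top[symmetric] intro: less_trans[OF _ ennreal_one_less_top])
  have "(\<lambda>n. enn2real (\<integral>\<^sup>+x. ennreal \<bar>f (n + k) x\<bar> \<partial>M)) \<longlonglongrightarrow> 0"
    using LIMSEQ_ignore_initial_segment[OF lim, of k] by (intro tendsto_enn2real) auto
  then have "(\<lambda>n. \<integral>x. norm (f (n + k) x) \<partial>M) \<longlonglongrightarrow> 0"
    by (subst integral_eq_nn_integral) auto
  from tendsto_L1_AE_subseq[OF int this]
  obtain r where r: "strict_mono r" "AE x in M. (\<lambda>n. f (r n + k) x) \<longlonglongrightarrow> 0" by blast
  have "strict_mono (\<lambda>n. r n + k)" using r(1) by (simp add: strict_mono_def)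
  then show ?thesis using r(2) by blast
qed

context hardy
begin

text \<open>Convergence to \<open>u\<close> is only local and in L1. On a compact set a subsequence
  converges almost everywhere and Fatou's lemma carries the inequality over; compact sets then
  exhaust \<open>\<Omega>\<close>.\<close>

lemma hardy_D1p:
  assumes D: "D1p (\<odot>) deg p \<Omega> u g"
  shows "ennreal (((p - 1) / p) powr p) *
      (\<integral>\<^sup>+x\<in>\<Omega>. ennreal (hw u x) \<partial>lebesgue)
    \<le> (\<integral>\<^sup>+x\<in>\<Omega>. ennreal (norm (g x) powr p) \<partial>lebesgue)"
proof -
  let ?c = "ennreal (((p - 1) / p) powr p)"
  let ?f = "\<lambda>u x. ennreal (hw u x)"
  let ?B = "\<integral>\<^sup>+x\<in>\<Omega>. ennreal (norm (g x) powr p) \<partial>lebesgue"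
  from D obtain \<phi> where [measurable]: "u \<in> borel_measurable lebesgue" "g \<in> borel_measurable lebesgue"
    and \<phi>: "\<And>k. test_fun \<Omega> (\<phi> k)"
    and lim: "(\<lambda>k. \<integral>\<^sup>+x\<in>\<Omega>. ennreal (norm (grad (\<phi> k) x - g x) powr p) \<partial>lebesgue) \<longlonglongrightarrow> 0"
    and loc: "\<And>K. compact K \<Longrightarrow> K \<subseteq> \<Omega> \<Longrightarrow> (\<lambda>k. \<integral>\<^sup>+x\<in>K. ennreal \<bar>\<phi> k x - u x\<bar> \<partial>lebesgue) \<longlonglongrightarrow> 0"
    unfolding D1p_def by blast
  have [measurable]: "\<phi> k \<in> borel_measurable lebesgue" "grad (\<phi> k) \<in> borel_measurable lebesgue" for k
    using \<phi> test_fun_measurable test_fun_grad_measurable by blast+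
  have [measurable]: "\<Omega> \<in> sets lebesgue" using open_N_ball by auto
  \<comment> \<open>The gradient of \<open>\<phi> k\<close> is split into \<open>g\<close> and a
    remainder that vanishes in Lp as \<open>k\<close> grows; the factor
    \<open>(1 + e) powr p\<close> is removed at the end by letting \<open>e\<close> tend to
    0.\<close>
  have grads: "?c * (\<integral>\<^sup>+x\<in>\<Omega>. ?f (\<phi> k) x \<partial>lebesgue) \<le> ennreal ((1 + e) powr p) * ?B
      + ennreal ((1 + 1 / e) powr p) * (\<integral>\<^sup>+x\<in>\<Omega>. ennreal (norm (grad (\<phi> k) x - g x) powr p) \<partial>lebesgue)"
    if e: "e > 0" for e k
  proof -
    have pw: "ennreal (norm (grad (\<phi> k) x) powr p) * indicator \<Omega> x
        \<le> ennreal ((1 + e) powr p) * (ennreal (norm (g x) powr p) * indicator \<Omega> x)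
          + ennreal ((1 + 1 / e) powr p) * (ennreal (norm (grad (\<phi> k) x - g x) powr p) * indicator \<Omega> x)" for x
    proof -
      have "norm (grad (\<phi> k) x) powr p \<le> (norm (g x) + norm (grad (\<phi> k) x - g x)) powr p"
        using p norm_triangle_ineq[of "g x" "grad (\<phi> k) x - g x"] by (intro powr_mono2) auto
      also have "\<dots> \<le> (1 + e) powr p * norm (g x) powr p + (1 + 1 / e) powr p * norm (grad (\<phi> k) x - g x) powr p"
        using e p by (intro powr_add_le_split) auto
      finally show ?thesis
        by (cases "x \<in> \<Omega>") (simp_all add: ennreal_mult[symmetric] ennreal_plus[symmetric] ennreal_leI del: ennreal_plus)
    qed
    have "?c * (\<integral>\<^sup>+x\<in>\<Omega>. ?f (\<phi> k) x \<partial>lebesgue) \<le> (\<integral>\<^sup>+x\<in>\<Omega>. ennreal (norm (grad (\<phi> k) x) powr p) \<partial>lebesgue)"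
      by (rule hardy_test_fun[OF \<phi>])
    also have "\<dots> \<le> (\<integral>\<^sup>+x. ennreal ((1 + e) powr p) * (ennreal (norm (g x) powr p) * indicator \<Omega> x)
          + ennreal ((1 + 1 / e) powr p) * (ennreal (norm (grad (\<phi> k) x - g x) powr p) * indicator \<Omega> x) \<partial>lebesgue)"
      by (intro nn_integral_mono pw)
    also have "\<dots> = ennreal ((1 + e) powr p) * ?B
      + ennreal ((1 + 1 / e) powr p) * (\<integral>\<^sup>+x\<in>\<Omega>. ennreal (norm (grad (\<phi> k) x - g x) powr p) \<partial>lebesgue)"
      by (subst nn_integral_add, measurable, subst nn_integral_cmult, measurable, subst nn_integral_cmult, measurable)
    finally show ?thesis .
  qed
  have on_compact: "?c * (\<integral>\<^sup>+x\<in>K. ?f u x \<partial>lebesgue) \<le> ?B" if K: "compact K" "K \<subseteq> \<Omega>" for K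
  proof -
    have [measurable]: "K \<in> sets lebesgue" using K(1) by (rule fmeasurableD[OF lmeasurable_compact])
    have "(\<lambda>k. \<integral>\<^sup>+x. ennreal \<bar>indicator K x * (\<phi> k x - u x)\<bar> \<partial>lebesgue) \<longlonglongrightarrow> 0"
      using loc[OF K] by (rule tendsto_cong[THEN iffD1, rotated]) (auto intro!: always_eventually nn_integral_cong simp: indicator_def)
    then obtain r where r: "strict_mono r" "AE x in lebesgue. (\<lambda>n. indicator K x * (\<phi> (r n) x - u x)) \<longlonglongrightarrow> (0::real)"
      using tendsto_nn_L1_AE_subseq[of "\<lambda>k x. indicator K x * (\<phi> k x - u x)" lebesgue] by auto
    have bound: "?c * (\<integral>\<^sup>+x\<in>K. ?f u x \<partial>lebesgue) \<le> ennreal ((1 + e) powr p) * ?B" if e: "e > 0" for e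
    proof -
      let ?E = "\<lambda>k. \<integral>\<^sup>+x\<in>\<Omega>. ennreal (norm (grad (\<phi> k) x - g x) powr p) \<partial>lebesgue"
      have "?c * (\<integral>\<^sup>+x\<in>K. ?f u x \<partial>lebesgue) = (\<integral>\<^sup>+x. ?c * (?f u x * indicator K x) \<partial>lebesgue)"
        by (subst nn_integral_cmult) measurable
      also have "\<dots> = (\<integral>\<^sup>+x. liminf (\<lambda>n. ?c * (?f (\<phi> (r n)) x * indicator K x)) \<partial>lebesgue)"
      proof (rule nn_integral_cong_AE)
        show "AE x in lebesgue. ?c * (?f u x * indicator K x) = liminf (\<lambda>n. ?c * (?f (\<phi> (r n)) x * indicator K x))"
          using r(2)
        proof eventually_elim
          fix x assume a: "(\<lambda>n. indicator K x * (\<phi> (r n) x - u x)) \<longlonglongrightarrow> (0::real)"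
          show "?c * (?f u x * indicator K x) = liminf (\<lambda>n. ?c * (?f (\<phi> (r n)) x * indicator K x))"
          proof (cases "x \<in> K")
            case True
            then have "(\<lambda>n. \<phi> (r n) x) \<longlonglongrightarrow> u x" using a by (simp add: LIM_zero_iff)
            then have l: "(\<lambda>n. ennreal (((p - 1) / p) powr p * (hw (\<phi> (r n)) x)))
               \<longlonglongrightarrow> ennreal (((p - 1) / p) powr p * (hw u x))"
              using p K(2) True by (intro tendsto_ennrealI tendsto_intros tendsto_powr') auto
            have m: "?c * ennreal y = ennreal (((p - 1) / p) powr p * y)" for y
              by (rule ennreal_mult'[symmetric]) simp
            show ?thesis
              using lim_imp_Liminf[OF trivial_limit_sequentially l] True by (simp only: indicator_simps mult_1_right m)
          qed (simp add: Liminf_const)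
        qed
      qed
      also have "\<dots> \<le> liminf (\<lambda>n. \<integral>\<^sup>+x. ?c * (?f (\<phi> (r n)) x * indicator K x) \<partial>lebesgue)"
        by (rule nn_integral_liminf) measurable
      also have "\<dots> \<le> liminf (\<lambda>n. ennreal ((1 + e) powr p) * ?B + ennreal ((1 + 1 / e) powr p) * ?E (r n))"
      proof (rule Liminf_mono, intro always_eventually allI)
        fix n
        have "(\<integral>\<^sup>+x. ?c * (?f (\<phi> (r n)) x * indicator K x) \<partial>lebesgue) \<le> (\<integral>\<^sup>+x. ?c * (?f (\<phi> (r n)) x * indicator \<Omega> x) \<partial>lebesgue)"
          using K(2) by (intro nn_integral_mono mult_left_mono) (auto simp: indicator_def)
        also have "\<dots> = ?c * (\<integral>\<^sup>+x\<in>\<Omega>. ?f (\<phi> (r n)) x \<partial>lebesgue)"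
          by (subst nn_integral_cmult) measurable
        also note grads[OF e, of "r n"]
        finally show "(\<integral>\<^sup>+x. ?c * (?f (\<phi> (r n)) x * indicator K x) \<partial>lebesgue)
          \<le> ennreal ((1 + e) powr p) * ?B + ennreal ((1 + 1 / e) powr p) * ?E (r n)" .
      qed
      also have "\<dots> = ennreal ((1 + e) powr p) * ?B"
      proof -
        have "(\<lambda>n. ennreal ((1 + e) powr p) * ?B + ennreal ((1 + 1 / e) powr p) * ?E (r n))
            \<longlonglongrightarrow> ennreal ((1 + e) powr p) * ?B + ennreal ((1 + 1 / e) powr p) * 0"
          using LIMSEQ_subseq_LIMSEQ[OF lim r(1)]
          by (intro tendsto_add tendsto_const ennreal_tendsto_cmult) (auto simp: o_def)
        then show ?thesis by (simp add: lim_imp_Liminf)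
      qed
      finally show ?thesis .
    qed
    show ?thesis
    proof (cases "?B = \<infinity>")
      case False
      then obtain b where b: "?B = ennreal b" "b \<ge> 0" by (cases ?B) auto
      show ?thesis
      proof (rule tendsto_lowerbound)
        have "((\<lambda>e. (1 + e) powr p * b) \<longlongrightarrow> (1 + 0) powr p * b) (at_right 0)"
          by (intro tendsto_intros) auto
        then show "((\<lambda>e. ennreal ((1 + e) powr p) * ?B) \<longlongrightarrow> ?B) (at_right 0)"
          unfolding b using b(2) by (auto simp: ennreal_mult[symmetric] intro!: tendsto_ennrealI)
        show "\<forall>\<^sub>F e in at_right 0. ?c * (\<integral>\<^sup>+x\<in>K. ?f u x \<partial>lebesgue) \<le> ennreal ((1 + e) powr p) * ?B"
          using bound by (auto simp: eventually_at_filter)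
      qed simp
    qed simp
  qed
  obtain C where C: "\<And>n. compact (C n)" "\<And>n. C n \<subseteq> \<Omega>" "\<And>n. C n \<subseteq> interior (C (Suc n))" "\<Union> (range C) = \<Omega>"
    using open_Union_compact_subsets[OF open_N_ball[of R]] by metis
  have [measurable]: "C n \<in> sets lebesgue" for n using C(1) by (rule fmeasurableD[OF lmeasurable_compact])
  have inc: "incseq C" using C(3) interior_subset by (intro incseq_SucI) blast
  have sup: "?f u x * indicator \<Omega> x = (SUP n. ?f u x * indicator (C n) x)" for x
  proof (cases "x \<in> \<Omega>")
    case True
    then obtain n where n: "x \<in> C n" using C(4) by blast
    show ?thesis
    proof (rule antisym)
      show "?f u x * indicator \<Omega> x \<le> (SUP n. ?f u x * indicator (C n) x)"
        using n True by (intro SUP_upper2[of n]) auto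
      show "(SUP n. ?f u x * indicator (C n) x) \<le> ?f u x * indicator \<Omega> x"
        using True by (intro SUP_least) (auto simp: indicator_def)
    qed
  next
    case False
    then have "x \<notin> C n" for n using C(2) by blast
    then show ?thesis using False by simp
  qed
  have "(\<integral>\<^sup>+x\<in>\<Omega>. ?f u x \<partial>lebesgue) = (SUP n. \<integral>\<^sup>+x\<in>C n. ?f u x \<partial>lebesgue)"
    unfolding sup
  proof (rule nn_integral_monotone_convergence_SUP)
    show "incseq (\<lambda>n x. ?f u x * indicator (C n) x)"
      using inc by (auto simp: incseq_def le_fun_def indicator_def subset_iff)
  qed measurable
  then have "?c * (\<integral>\<^sup>+x\<in>\<Omega>. ?f u x \<partial>lebesgue) = (SUP n. ?c * (\<integral>\<^sup>+x\<in>C n. ?f u x \<partial>lebesgue))"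
    by (simp add: SUP_mult_left_ennreal)
  also have "\<dots> \<le> ?B" by (intro SUP_least on_compact C)
  finally show ?thesis .
qed

end

section \<open>Optimality of the constant\<close>

context carnot
begin

text \<open>The dilation is diagonal in the standard basis with entries \<open>s ^ deg i\<close>, so
  its Jacobian is \<open>s\<close> to the power Q.\<close>

lemma nn_integral_dil:
  assumes s: "s > 0" and f: "f \<in> borel_measurable lebesgue"
  shows "(\<integral>\<^sup>+x. f x \<partial>lebesgue) = ennreal (s ^ (\<Sum>i\<in>UNIV. deg i)) * (\<integral>\<^sup>+x. f (\<delta> s x) \<partial>lebesgue)"
proof -
  \<comment> \<open>The affine change of variables takes one factor per basis vector;
    \<open>THE\<close> recovers the coordinate from the vector.\<close>
  define c :: "real^'n \<Rightarrow> real" where "c j = s ^ deg (THE i. j = axis i 1)" for j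
  have c: "c (axis i 1) = s ^ deg i" for i
    by (simp add: c_def axis_eq_axis)
  have "(\<lambda>x. 0 + (\<Sum>j\<in>Basis. (c j * (x \<bullet> j)) *\<^sub>R j)) = \<delta> s"
  proof
    fix x :: "real^'n"
    have "\<delta> s x = (\<Sum>i\<in>UNIV. \<delta> s x $ i *\<^sub>R axis i 1)" by (rule vec_expansion)
    then show "0 + (\<Sum>j\<in>Basis. (c j * (x \<bullet> j)) *\<^sub>R j) = \<delta> s x"
      by (simp add: sum_Basis_vec c inner_axis dil_def)
  qed
  moreover have c0: "c j \<noteq> 0" for j using s by (simp add: c_def)
  ultimately have eq: "lebesgue = density (distr lebesgue lebesgue (\<delta> s)) (\<lambda>_. (\<Prod>j\<in>Basis. \<bar>c j\<bar>))"
    and meas: "\<delta> s \<in> lebesgue \<rightarrow>\<^sub>M lebesgue"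
    using lebesgue_affine_euclidean[of c 0] lebesgue_affine_measurable[of c 0] by simp_all
  have "(\<Prod>j\<in>Basis. \<bar>c j\<bar>) = (\<Prod>i\<in>UNIV. s ^ deg i)"
  proof -
    have B: "(Basis::(real^'n) set) = range (\<lambda>i. axis i 1)" by (auto simp: Basis_vec_def)
    have "inj (\<lambda>i::'n. axis i (1::real))" by (auto simp: inj_on_def axis_eq_axis)
    then show ?thesis unfolding B using s by (subst prod.reindex) (auto simp: c o_def)
  qed
  also have "\<dots> = s ^ (\<Sum>i\<in>UNIV. deg i)" by (simp add: power_sum)
  finally have prod: "(\<Prod>j\<in>Basis. \<bar>c j\<bar>) = s ^ (\<Sum>i\<in>UNIV. deg i)" .
  have "(\<integral>\<^sup>+x. f x \<partial>lebesgue) = (\<integral>\<^sup>+x. f x \<partial>density (distr lebesgue lebesgue (\<delta> s)) (\<lambda>_. ennreal (\<Prod>j\<in>Basis. \<bar>c j\<bar>)))"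
    by (subst eq) (rule refl)
  also have "\<dots> = (\<integral>\<^sup>+x. ennreal (\<Prod>j\<in>Basis. \<bar>c j\<bar>) * f x \<partial>distr lebesgue lebesgue (\<delta> s))"
    using f by (subst nn_integral_density) auto
  also have "\<dots> = (\<integral>\<^sup>+x. ennreal (\<Prod>j\<in>Basis. \<bar>c j\<bar>) * f (\<delta> s x) \<partial>lebesgue)"
    using f meas by (subst nn_integral_distr) auto
  also have "\<dots> = ennreal (\<Prod>j\<in>Basis. \<bar>c j\<bar>) * (\<integral>\<^sup>+x. f (\<delta> s x) \<partial>lebesgue)"
    using f meas by (intro nn_integral_cmult) simp
  finally show ?thesis unfolding prod .
qed

end

section \<open>One-variable ingredients, shells and trial functions near the boundary\<close>

lemma power_diff_bounds:
  fixes a b :: real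
  assumes "0 < a" "a \<le> b" "n \<ge> 1"
  shows "a ^ (n - 1) * (b - a) \<le> b ^ n - a ^ n" "b ^ n - a ^ n \<le> real n * b ^ (n - 1) * (b - a)"
proof -
  obtain m where n: "n = Suc m" using assms(3) by (cases n) auto
  have "a ^ m * b \<le> b ^ m * b" using assms by (intro mult_right_mono power_mono) auto
  then show "a ^ (n - 1) * (b - a) \<le> b ^ n - a ^ n" by (simp add: n algebra_simps)
  show "b ^ n - a ^ n \<le> real n * b ^ (n - 1) * (b - a)"
  proof (cases "a = b")
    case False
    then obtain z where z: "a < z" "z < b" "b ^ n - a ^ n = (b - a) * (real n * z ^ (n - 1))"
      using MVT2[of a b "\<lambda>x. x ^ n" "\<lambda>x. real n * x ^ (n - 1)"] assms by (auto intro!: derivative_eq_intros)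
    have "z ^ (n - 1) \<le> b ^ (n - 1)" using z assms by (intro power_mono) auto
    then have "(b - a) * (real n * z ^ (n - 1)) \<le> (b - a) * (real n * b ^ (n - 1))"
      using assms by (intro mult_left_mono) auto
    then show ?thesis unfolding z(3) by (simp add: mult_ac)
  qed simp
qed

text \<open>Zero outside the interval from 0 to 3 and at least \<open>exp (-2)\<close> on its middle
  third; this lower bound takes the place of a plateau in the optimality argument.\<close>

definition bump :: "real \<Rightarrow> real" where
  "bump x = exp_cutoff x * exp_cutoff (3 - x)"

lemma bump_bounds:
  "bump x \<ge> 0" "bump x \<le> 1" "\<not> (0 < x \<and> x < 3) \<Longrightarrow> bump x = 0"
  "1 \<le> x \<Longrightarrow> x \<le> 2 \<Longrightarrow> exp (-2) \<le> bump x"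
proof -
  show "bump x \<ge> 0" "bump x \<le> 1"
    unfolding bump_def by (auto intro!: mult_le_one mult_nonneg_nonneg exp_cutoff_simps(1,2))
  show "bump x = 0" if "\<not> (0 < x \<and> x < 3)"
    using that exp_cutoff_simps(4)[of x] exp_cutoff_simps(4)[of "3 - x"] unfolding bump_def by auto
  show "exp (-2) \<le> bump x" if x: "1 \<le> x" "x \<le> 2"
  proof -
    have "exp (-2) = exp (-1) * exp (-1 :: real)" by (simp add: exp_add[symmetric])
    also have "\<dots> \<le> exp (- 1 / x) * exp (- 1 / (3 - x))"
      using x by (intro mult_mono) (auto simp: field_simps)
    finally show ?thesis using x by (simp add: bump_def exp_cutoff_def)
  qed
qed

lemma smooth_bump: "smooth_on UNIV bump"
proof -
  have "smooth_on UNIV (\<lambda>x::real. 3 - x)"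
    by (intro smooth_on_diff smooth_on_const smooth_on_bounded_linear bounded_linear_ident) auto
  from smooth_on_real_compose[OF _ open_UNIV smooth_on_exp_cutoff this]
  show ?thesis unfolding bump_def[abs_def] by (intro smooth_on_mult smooth_on_exp_cutoff) auto
qed

lemma bump_derivative:
  obtains bump' D where "\<And>x. (bump has_real_derivative bump' x) (at x)"
    "\<And>x. \<bar>bump' x\<bar> \<le> D" "\<And>x. \<not> (0 \<le> x \<and> x \<le> 3) \<Longrightarrow> bump' x = 0" "D > 0"
proof -
  let ?b = "pd 1 bump"
  have der: "(bump has_real_derivative ?b x) (at x)" for x
    using smooth_on_has_pd[OF smooth_bump, of 1 x] by (simp only: has_pd_real Basis_real_def singleton_iff simp_thms UNIV_I)
  have zero: "?b x = 0" if "\<not> (0 \<le> x \<and> x \<le> 3)" for x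
  proof -
    have "((\<lambda>x. 0) has_real_derivative 0) (at x)" by simp
    then have "(bump has_real_derivative 0) (at x)"
      by (rule has_field_derivative_transform_within_open[of _ _ _ "- {0..3}"])
        (use that bump_bounds(3) in auto)
    then show ?thesis using der DERIV_unique by blast
  qed
  have "continuous_on {0..3} ?b"
    using smooth_on_continuous[OF smooth_on_pd[OF smooth_bump, of 1]] by (auto intro: continuous_on_subset)
  from compact_imp_bounded[OF compact_continuous_image[OF this]]
  have "\<exists>D. \<forall>x\<in>{0..3}. \<bar>?b x\<bar> \<le> D" by (auto simp: bounded_iff)
  then obtain D where D: "\<And>x. x \<in> {0..3} \<Longrightarrow> \<bar>?b x\<bar> \<le> D" by blast
  have "\<bar>?b x\<bar> \<le> max D 1" for x
    using D[of x] zero[of x] by (cases "0 \<le> x \<and> x \<le> 3") auto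
  then show ?thesis using that der zero by fastforce
qed

context hardy
begin

definition hom_dim_nat :: nat where "hom_dim_nat = (\<Sum>i\<in>UNIV. deg i)"

lemma hom_dim_nat_ge_1: "hom_dim_nat \<ge> 1"
proof -
  obtain i :: 'n where True by simp
  have "1 \<le> deg i" by (rule deg_ge_1)
  also have "\<dots> \<le> hom_dim_nat" unfolding hom_dim_nat_def by (rule member_le_sum) auto
  finally show ?thesis .
qed

text \<open>\<open>\<bar>\<nabla>N\<bar>\<close> is homogeneous of degree zero, so the measure \<open>\<bar>\<nabla>N\<bar>\<^sup>p dx\<close>
  of \<open>N\<close>-balls scales like Lebesgue measure.\<close>
lemma ball_mass:
  obtains m where "m > 0"
    "\<And>r. r > 0 \<Longrightarrow> (\<integral>\<^sup>+x. ennreal (norm (grad N x) powr p) * indicator {x. N x < r} x \<partial>lebesgue) = ennreal (m * r ^ hom_dim_nat)"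
proof -
  let ?g = "\<lambda>x. ennreal (norm (grad N x) powr p)"
  let ?F = "\<lambda>r. \<integral>\<^sup>+x. ?g x * indicator {x. N x < r} x \<partial>lebesgue"
  have [measurable]: "{x. N x < r} \<in> sets lebesgue" for r using open_N_ball[of r] by auto
  note ae = AE_lebesgue_neq[of "0 :: real^'n"]
  obtain M where M: "\<And>x. norm (grad N x) \<le> M" using hgrad_N_bounded by blast
  have "?F 1 \<le> (\<integral>\<^sup>+x. ennreal (M powr p) * indicator {x. N x \<le> 1} x \<partial>lebesgue)"
    using M p by (intro nn_integral_mono) (auto simp: indicator_def intro!: ennreal_leI powr_mono2)
  also have "\<dots> = ennreal (M powr p) * emeasure lebesgue {x. N x \<le> 1}"
    using fmeasurableD[OF lmeasurable_compact[OF compact_N_le]] by (intro nn_integral_cmult_indicator)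
  also have "\<dots> < \<infinity>"
    using fmeasurableD2[OF lmeasurable_compact[OF compact_N_le[of 1]]] by (simp add: ennreal_mult_less_top less_top)
  finally obtain m where m: "?F 1 = ennreal m" "m \<ge> 0" by (cases "?F 1") auto
  have "m \<noteq> 0"
  proof
    assume "m = 0"
    then have "?F 1 = 0" using m by simp
    then have ae0: "AE x in lebesgue. ?g x * indicator {x. N x < 1} x = 0"
      by (subst (asm) nn_integral_0_iff_AE) auto
    \<comment> \<open>\<open>C2 > 0\<close> supplies a point with nonzero gradient. A dilation
      brings it to \<open>N = 1 / 2\<close> with the same gradient, and by continuity the gradient
      is nonzero on an open subset of the unit ball.\<close>
    have "\<exists>x. x \<noteq> 0 \<and> norm (grad N x) > 0"
    proof (rule ccontr)
      assume "\<not> ?thesis"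
      then have "AE x in lebesgue. ereal (norm (grad N x)) \<le> 0" using ae by auto
      then have "esssup lebesgue (\<lambda>x. ereal (norm (grad N x))) \<le> 0"
        by (intro esssup_I) auto
      then have "C2 \<le> 0" unfolding C2_def by (cases "esssup lebesgue (\<lambda>x. ereal (norm (grad N x)))") auto
      then show False using C2_pos by simp
    qed
    then obtain x where x: "x \<noteq> 0" "norm (grad N x) > 0" by blast
    define y where "y = \<delta> (1 / (2 * N x)) x"
    have y: "N y = 1 / 2" "grad N y = grad N x"
      using N_pos[OF x(1)] by (simp_all add: y_def N_dil hgrad_N_dil x(1))
    define U where "U = (({x. N x < 1} - {0}) \<inter> (\<lambda>y. norm (grad N y)) -` {0<..})"
    have "open U" unfolding U_def
      using open_N_ball by (intro continuous_open_preimage continuous_on_norm continuous_on_hgrad_N open_Diff) auto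
    moreover have "y \<in> U" using y x(2) by (auto simp: U_def)
    ultimately have "\<not> negligible U" using open_not_negligible by blast
    moreover have "AE y in lebesgue. y \<notin> U"
      using ae0 by eventually_elim (auto simp: U_def)
    then have "U \<in> null_sets lebesgue"
      using AE_iff_null_sets[of U lebesgue] \<open>open U\<close> by auto
    ultimately show False by (simp add: negligible_iff_null_sets)
  qed
  moreover have "?F r = ennreal (m * r ^ hom_dim_nat)" if r: "r > 0" for r
  proof -
    have "?F r = ennreal (r ^ hom_dim_nat) * (\<integral>\<^sup>+x. ?g (\<delta> r x) * indicator {x. N x < r} (\<delta> r x) \<partial>lebesgue)"
      unfolding hom_dim_nat_def by (rule nn_integral_dil[OF r]) measurable
    also have "(\<integral>\<^sup>+x. ?g (\<delta> r x) * indicator {x. N x < r} (\<delta> r x) \<partial>lebesgue) = ?F 1"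
      by (rule nn_integral_cong_AE, use ae in eventually_elim)
        (use r in \<open>auto simp: hgrad_N_dil N_dil indicator_def\<close>)
    finally show ?thesis using m r by (simp add: ennreal_mult[symmetric] mult.commute)
  qed
  ultimately show ?thesis using that[of m] m(2) by simp
qed

text \<open>In the variable \<open>- ln (R - N x)\<close> this is the unit interval from
  \<open>t\<close> to \<open>t + 1\<close>, half-open so that consecutive shells are
  disjoint.\<close>

definition shell :: "real \<Rightarrow> (real^'n) set" where
  "shell t = {x. R - exp (- t) \<le> N x \<and> N x < R - exp (- t - 1)}"

lemma shell_measurable [measurable]: "shell t \<in> sets lebesgue"
proof -
  have "shell t = {x. N x < R - exp (- t - 1)} - {x. N x < R - exp (- t)}" by (auto simp: shell_def)
  moreover have "{x. N x < r} \<in> sets lebesgue" for r using open_N_ball[of r] by auto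
  ultimately show ?thesis by (metis sets.Diff)
qed

text \<open>In the variable \<open>t = - ln (R - N)\<close> the measure \<open>\<bar>\<nabla>N\<bar>\<^sup>p / (R - N) dx\<close> is
  comparable to Lebesgue measure near infinity; unit intervals suffice.\<close>
lemma shell_mass:
  obtains k1 k2 where "k1 > 0" "k2 > 0"
    "\<And>t. exp (- t) \<le> R / 2 \<Longrightarrow> ennreal k1 \<le> (\<integral>\<^sup>+x. ennreal (norm (grad N x) powr p / (R - N x)) * indicator (shell t) x \<partial>lebesgue)"
    "\<And>t. exp (- t) \<le> R / 2 \<Longrightarrow> (\<integral>\<^sup>+x. ennreal (norm (grad N x) powr p / (R - N x)) * indicator (shell t) x \<partial>lebesgue) \<le> ennreal k2"
proof -
  obtain m where m: "m > 0"
    "\<And>r. r > 0 \<Longrightarrow> (\<integral>\<^sup>+x. ennreal (norm (grad N x) powr p) * indicator {x. N x < r} x \<partial>lebesgue) = ennreal (m * r ^ hom_dim_nat)"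
    by (rule ball_mass) (rule that)
  let ?g = "\<lambda>x. norm (grad N x) powr p"
  let ?J = "\<lambda>t. \<integral>\<^sup>+x. ennreal (?g x / (R - N x)) * indicator (shell t) x \<partial>lebesgue"
  have [measurable]: "{x. N x < r} \<in> sets lebesgue" for r using open_N_ball[of r] by auto
  \<comment> \<open>With \<open>a = exp (- t)\<close> and \<open>b = exp (- t - 1)\<close>, the
    width \<open>a - b\<close> is \<open>a * (1 - exp (-1))\<close> and also
    \<open>b * (exp 1 - 1)\<close>. The weight \<open>1 / (R - N)\<close> lies between
    \<open>1 / a\<close> and \<open>1 / b\<close> on the shell, so \<open>t\<close> cancels. The
    radii lie between \<open>R / 2\<close> and \<open>R\<close>.\<close>
  define k1 where "k1 = m * (R / 2) ^ (hom_dim_nat - 1) * (1 - exp (-1))"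
  define k2 where "k2 = m * (real hom_dim_nat * R ^ (hom_dim_nat - 1)) * (exp 1 - 1)"
  have k: "k1 > 0" "k2 > 0"
    unfolding k1_def k2_def using m(1) R hom_dim_nat_ge_1 by (auto intro!: mult_pos_pos)
  have main: "ennreal k1 \<le> ?J t \<and> ?J t \<le> ennreal k2" if t: "exp (- t) \<le> R / 2" for t
  proof -
    define a where "a = exp (- t)"
    define b where "b = exp (- t - 1)"
    have ab: "a > 0" "b > 0" by (auto simp: a_def b_def)
    have b: "b = a * exp (-1)" and a: "a = b * exp 1"
      by (simp_all add: a_def b_def exp_add[symmetric])
    have da: "a - b = a * (1 - exp (-1))" by (subst b) (simp add: algebra_simps)
    have db: "a - b = b * (exp 1 - 1)" by (subst a) (simp add: algebra_simps)
    have diff: "1 / a * (a - b) = 1 - exp (-1)" "1 / b * (a - b) = exp 1 - 1"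
      using ab by (simp add: da, simp add: db)
    have ba: "b < a" by (simp add: a_def b_def)
    have aR: "a \<le> R / 2" using t by (simp add: a_def)
    have mass: "(\<integral>\<^sup>+x. ennreal (?g x) * indicator (shell t) x \<partial>lebesgue) = ennreal (m * ((R - b) ^ hom_dim_nat - (R - a) ^ hom_dim_nat))"
      (is "?S = _")
    proof -
      have shell_eq: "shell t = {x. R - a \<le> N x \<and> N x < R - b}" by (simp add: shell_def a_def b_def)
      have "(\<integral>\<^sup>+x. ennreal (?g x) * indicator {x. N x < R - b} x \<partial>lebesgue)
          = (\<integral>\<^sup>+x. ennreal (?g x) * indicator {x. N x < R - a} x + ennreal (?g x) * indicator (shell t) x \<partial>lebesgue)"
        using ba by (intro nn_integral_cong) (auto simp: indicator_def shell_eq)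
      also have "\<dots> = (\<integral>\<^sup>+x. ennreal (?g x) * indicator {x. N x < R - a} x \<partial>lebesgue) + ?S"
        by (rule nn_integral_add) measurable
      finally have "ennreal (m * (R - b) ^ hom_dim_nat) = ennreal (m * (R - a) ^ hom_dim_nat) + ?S"
        using m(2)[of "R - a"] m(2)[of "R - b"] ab ba aR R by simp
      then have "?S = ennreal (m * (R - b) ^ hom_dim_nat) - ennreal (m * (R - a) ^ hom_dim_nat)"
        by (simp add: ennreal_add_diff_cancel_left)
      also have "\<dots> = ennreal (m * (R - b) ^ hom_dim_nat - m * (R - a) ^ hom_dim_nat)"
        using m(1) ab aR R by (intro ennreal_minus) auto
      finally show ?thesis by (simp add: right_diff_distrib)
    qed
    have pd: "(R - a) ^ (hom_dim_nat - 1) * (a - b) \<le> (R - b) ^ hom_dim_nat - (R - a) ^ hom_dim_nat"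
      "(R - b) ^ hom_dim_nat - (R - a) ^ hom_dim_nat \<le> real hom_dim_nat * (R - b) ^ (hom_dim_nat - 1) * (a - b)"
      using power_diff_bounds[of "R - a" "R - b" hom_dim_nat] hom_dim_nat_ge_1 ab ba aR R by auto
    have pt: "1 / a * ?g x \<le> ?g x / (R - N x) \<and> ?g x / (R - N x) \<le> 1 / b * ?g x" if "x \<in> shell t" for x
    proof -
      have "b \<le> R - N x" "R - N x \<le> a" using that by (auto simp: shell_def a_def b_def)
      then have "?g x / a \<le> ?g x / (R - N x)" "?g x / (R - N x) \<le> ?g x / b"
        using ab by (auto intro!: divide_left_mono mult_pos_pos)
      then show ?thesis by simp
    qed
    have "ennreal k1 \<le> ennreal (1 / a) * ennreal (m * ((R - b) ^ hom_dim_nat - (R - a) ^ hom_dim_nat))"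
    proof -
      have "k1 = 1 / a * (m * ((R / 2) ^ (hom_dim_nat - 1) * (a - b)))"
        unfolding k1_def diff(1)[symmetric] by (simp only: mult_ac)
      also have "\<dots> \<le> 1 / a * (m * ((R - a) ^ (hom_dim_nat - 1) * (a - b)))"
        using ab ba aR R m(1) by (intro mult_left_mono mult_right_mono power_mono) auto
      also have "\<dots> \<le> 1 / a * (m * ((R - b) ^ hom_dim_nat - (R - a) ^ hom_dim_nat))"
        using ab m(1) pd(1) by (intro mult_left_mono) auto
      finally show ?thesis using ab by (simp add: ennreal_mult'[symmetric] ennreal_leI)
    qed
    also have "\<dots> = (\<integral>\<^sup>+x. ennreal (1 / a) * (ennreal (?g x) * indicator (shell t) x) \<partial>lebesgue)"
      by (subst nn_integral_cmult) (measurable, simp add: mass)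
    also have "\<dots> \<le> ?J t"
      using pt ab by (intro nn_integral_mono) (auto simp: indicator_def ennreal_mult'[symmetric] intro!: ennreal_leI)
    finally have 1: "ennreal k1 \<le> ?J t" .
    have "?J t \<le> (\<integral>\<^sup>+x. ennreal (1 / b) * (ennreal (?g x) * indicator (shell t) x) \<partial>lebesgue)"
      using pt ab by (intro nn_integral_mono) (auto simp: indicator_def ennreal_mult'[symmetric] intro!: ennreal_leI)
    also have "\<dots> = ennreal (1 / b) * ennreal (m * ((R - b) ^ hom_dim_nat - (R - a) ^ hom_dim_nat))"
      by (subst nn_integral_cmult) (measurable, simp add: mass)
    also have "\<dots> \<le> ennreal k2"
    proof -
      have "1 / b * (m * ((R - b) ^ hom_dim_nat - (R - a) ^ hom_dim_nat)) \<le> 1 / b * (m * (real hom_dim_nat * (R - b) ^ (hom_dim_nat - 1) * (a - b)))"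
        using ab m(1) pd(2) by (intro mult_left_mono) auto
      also have "\<dots> \<le> 1 / b * (m * (real hom_dim_nat * R ^ (hom_dim_nat - 1) * (a - b)))"
        using ab ba aR R m(1) by (intro mult_left_mono mult_right_mono power_mono) auto
      also have "\<dots> = k2" unfolding k2_def diff(2)[symmetric] by (simp only: mult_ac)
      finally show ?thesis using ab by (simp add: ennreal_mult'[symmetric] ennreal_leI)
    qed
    finally show ?thesis using 1 by simp
  qed
  show ?thesis using that[OF k] main by blast
qed

lemma disjoint_shells: "disjoint_family (\<lambda>k::nat. shell (T + real k))"
proof -
  have "shell (T + real j) \<inter> shell (T + real k) = {}" if "j < k" for j k :: nat
  proof -
    have "exp (- (T + real k)) \<le> exp (- (T + real j) - 1)" using that by simp
    then have "x \<notin> shell (T + real k)" if "x \<in> shell (T + real j)" for x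
      using that unfolding shell_def mem_Collect_eq by linarith
    then show ?thesis by blast
  qed
  then show ?thesis unfolding disjoint_family_on_def by (metis Int_commute linorder_neqE_nat)
qed

text \<open>The formal extremal of the one-dimensional problem is \<open>(R - r)\<^bsup>(p-1)/p\<^esup>\<close>; it is cut off on the
  scale \<open>L\<close> in the variable \<open>- ln (R - r)\<close>.\<close>
definition trial :: "real \<Rightarrow> real \<Rightarrow> real \<Rightarrow> real" where
  "trial T L r = (if r < R then (R - r) powr ((p - 1) / p) * bump ((- ln (R - r) - T) / L) else 0)"

text \<open>The p-th power of the common factor is \<open>1 / (R - r)\<close>, so the gradient and
  the Hardy term become integrals against the same measure. The other factor consists of
  \<open>(p - 1) / p\<close> times \<open>bump\<close> and an error of order
  \<open>1 / L\<close>.\<close>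

lemma trial_derivative:
  assumes "(bump has_real_derivative D) (at ((- ln (R - r) - T) / L))" "r < R" "L > 0"
  shows "(trial T L has_real_derivative
    (R - r) powr (- 1 / p) * (D / L - (p - 1) / p * bump ((- ln (R - r) - T) / L))) (at r)"
proof -
  let ?t = "\<lambda>r. (- ln (R - r) - T) / L"
  have t: "(?t has_real_derivative 1 / (R - r) / L) (at r)"
    using assms by (auto intro!: derivative_eq_intros)
  have q: "(p - 1) / p - 1 = - 1 / p" using p by (simp add: field_simps)
  have d1: "((\<lambda>r. (R - r) powr ((p - 1) / p)) has_real_derivative - ((p - 1) / p) * (R - r) powr (- 1 / p)) (at r)"
    unfolding q[symmetric] using assms by (auto intro!: derivative_eq_intros)
  have d2: "((\<lambda>r. bump (?t r)) has_real_derivative D * (1 / (R - r) / L)) (at r)"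
    by (rule DERIV_chain2[OF assms(1) t])
  have pw: "(R - r) powr ((p - 1) / p) * (1 / (R - r)) = (R - r) powr (- 1 / p)"
  proof -
    have "1 / (R - r) = (R - r) powr (-1)" using assms(2) by (simp add: powr_minus_divide)
    moreover have "(R - r) powr ((p - 1) / p) * (R - r) powr (-1) = (R - r) powr ((p - 1) / p - 1)"
      by (simp only: powr_add[symmetric] diff_conv_add_uminus)
    ultimately show ?thesis by (simp only: q)
  qed
  have "((\<lambda>r. (R - r) powr ((p - 1) / p) * bump (?t r)) has_real_derivative
      (R - r) powr (- 1 / p) * (D / L - (p - 1) / p * bump (?t r))) (at r)"
  proof (rule DERIV_cong[OF DERIV_mult[OF d1 d2]])
    have "D * (1 / (R - r) / L) * (R - r) powr ((p - 1) / p) = ((R - r) powr ((p - 1) / p) * (1 / (R - r))) * (D / L)"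
      by (simp add: mult_ac)
    then show "- ((p - 1) / p) * (R - r) powr (- 1 / p) * bump (?t r) + D * (1 / (R - r) / L) * (R - r) powr ((p - 1) / p)
        = (R - r) powr (- 1 / p) * (D / L - (p - 1) / p * bump (?t r))"
      unfolding pw by (simp add: algebra_simps)
  qed
  then show ?thesis
    by (rule has_field_derivative_transform_within_open[of _ _ _ "{..<R}"]) (use assms(2) in \<open>auto simp: trial_def\<close>)
qed

lemma test_fun_trial:
  assumes T: "exp (- T) \<le> R / 2" and L: "L > 0"
  shows "test_fun \<Omega> (\<lambda>x. trial T L (N x))"
proof -
  let ?u = "\<lambda>x. trial T L (N x)"
  \<comment> \<open>The range of \<open>N\<close> in which the argument of \<open>bump\<close> lies
    between 0 and 3. The assumption on \<open>T\<close> keeps it at \<open>N \<ge> R / 2\<close>,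
    off the origin, and finiteness of \<open>L\<close> keeps it off the boundary.\<close>
  define K where "K = {x. N x \<le> R - exp (- (T + 3 * L))} \<inter> {x. R - exp (- T) \<le> N x}"
  have K: "compact K" unfolding K_def
    by (intro compact_Int_closed compact_N_le closed_Collect_le continuous_N continuous_on_const)
  have KO: "K \<subseteq> \<Omega> - {0}"
  proof
    fix x assume "x \<in> K"
    then have "N x \<ge> R / 2" "N x \<le> R - exp (- (T + 3 * L))" using T by (auto simp: K_def)
    moreover have "exp (- (T + 3 * L)) > 0" by simp
    ultimately have "N x > 0" "N x < R" using R by linarith+
    then show "x \<in> \<Omega> - {0}" by auto
  qed
  have u0: "?u x = 0" if "x \<notin> K" for x
  proof (cases "N x < R")
    case True
    from that have "N x > R - exp (- (T + 3 * L)) \<or> N x < R - exp (- T)" by (auto simp: K_def)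
    then have "\<not> (0 < (- ln (R - N x) - T) / L \<and> (- ln (R - N x) - T) / L < 3)"
    proof
      assume "N x > R - exp (- (T + 3 * L))"
      then have "ln (R - N x) < ln (exp (- (T + 3 * L)))" using True by (subst ln_less_cancel_iff) auto
      then show ?thesis using L by (simp add: field_simps)
    next
      assume "N x < R - exp (- T)"
      then have "ln (exp (- T)) < ln (R - N x)" using True by (subst ln_less_cancel_iff) auto
      then show ?thesis using L by (simp add: field_simps)
    qed
    then show ?thesis by (simp add: trial_def bump_bounds(3))
  qed (simp add: trial_def)
  have sm: "smooth_on {0<..<R} (trial T L)"
  proof -
    have lin: "smooth_on {0<..<R} (\<lambda>r. R - r)"
      by (intro smooth_on_diff smooth_on_const smooth_on_bounded_linear bounded_linear_ident) auto
    have 1: "smooth_on {0<..<R} (\<lambda>r. (R - r) powr ((p - 1) / p))"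
      by (rule smooth_on_real_compose[OF _ _ smooth_on_powr lin]) auto
    have "smooth_on {0<..<R} (\<lambda>r. ln (R - r))"
      by (rule smooth_on_real_compose[OF _ _ smooth_on_ln lin]) auto
    then have "smooth_on {0<..<R} (\<lambda>r. (- ln (R - r) - T) * (1 / L))"
      by (intro smooth_on_mult smooth_on_diff smooth_on_minus smooth_on_const) auto
    then have arg: "smooth_on {0<..<R} (\<lambda>r. (- ln (R - r) - T) / L)" by simp
    have 2: "smooth_on {0<..<R} (\<lambda>r. bump ((- ln (R - r) - T) / L))"
      by (rule smooth_on_real_compose[OF _ open_UNIV smooth_bump arg]) auto
    show ?thesis
      by (rule smooth_on_cong[OF _ smooth_on_mult[OF _ 1 2]]) (auto simp: trial_def)
  qed
  have op: "open (\<Omega> - {0})" using open_N_ball by (intro open_Diff) auto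
  have "smooth_on (\<Omega> - {0}) ?u"
    by (rule smooth_on_real_compose[OF op _ sm smooth_on_subset[OF smooth_N]]) (auto intro: N_pos)
  then have "test_fun (\<Omega> - {0}) ?u" by (rule test_fun_vanishing_outside[OF op _ K KO u0])
  then show ?thesis unfolding test_fun_def by blast
qed

lemma D1p_test_fun:
  assumes "test_fun \<Omega> u"
  shows "D1p (\<odot>) deg p \<Omega> u (grad u)"
  unfolding D1p_def using assms p
  by (auto intro!: exI[of _ "\<lambda>_. u"] test_fun_measurable test_fun_grad_measurable)

text \<open>\<open>A\<close> is the Hardy integral of the trial function and \<open>E\<close> the
  mass of the region where \<open>bump\<close> may be active; \<open>A\<close> is at least, and
  \<open>E\<close> at most, a constant times \<open>L\<close>. The gradient integral is at most a
  constant near \<open>((p - 1) / p) powr p\<close> times \<open>A\<close>, plus a multiple of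
  \<open>L powr (- p) * E\<close>, which for large \<open>L\<close> is below any fixed fraction of
  \<open>A\<close>.\<close>

lemma hardy_optimal:
  assumes C: "C > ((p - 1) / p) powr p"
  shows "\<exists>u g. D1p (\<odot>) deg p \<Omega> u g \<and>
    \<not> (ennreal C * (\<integral>\<^sup>+x\<in>\<Omega>. ennreal (hw u x) \<partial>lebesgue)
      \<le> (\<integral>\<^sup>+x\<in>\<Omega>. ennreal (norm (g x) powr p) \<partial>lebesgue))"
proof -
  let ?b = "(p - 1) / p"
  have C0: "C > 0" using C powr_ge_zero[of ?b p] by linarith
  obtain bump' D where bd: "\<And>x. (bump has_real_derivative bump' x) (at x)"
    "\<And>x. \<bar>bump' x\<bar> \<le> D" "\<And>x. \<not> (0 \<le> x \<and> x \<le> 3) \<Longrightarrow> bump' x = 0" "D > 0"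
    by (rule bump_derivative) (rule that)
  obtain k1 k2 where k: "k1 > 0" "k2 > 0"
    "\<And>t. exp (- t) \<le> R / 2 \<Longrightarrow> ennreal k1 \<le> (\<integral>\<^sup>+x. ennreal (norm (grad N x) powr p / (R - N x)) * indicator (shell t) x \<partial>lebesgue)"
    "\<And>t. exp (- t) \<le> R / 2 \<Longrightarrow> (\<integral>\<^sup>+x. ennreal (norm (grad N x) powr p / (R - N x)) * indicator (shell t) x \<partial>lebesgue) \<le> ennreal k2"
    by (rule shell_mass) (rule that)
  obtain e where e: "e > 0" "(1 + e) powr p * ?b powr p < C"
  proof -
    have "((\<lambda>e. (1 + e) powr p * ?b powr p) \<longlongrightarrow> (1 + 0) powr p * ?b powr p) (at_right 0)"
      by (intro tendsto_intros) auto
    then have "eventually (\<lambda>e. (1 + e) powr p * ?b powr p < C) (at_right 0)"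
      using C by (intro order_tendstoD(2)) auto
    moreover have "eventually (\<lambda>e::real. e > 0) (at_right 0)" by (simp add: eventually_at_filter)
    ultimately have "eventually (\<lambda>e. e > 0 \<and> (1 + e) powr p * ?b powr p < C) (at_right 0)" by eventually_elim auto
    then show ?thesis using that eventually_happens[of _ "at_right (0::real)"] by auto
  qed
  \<comment> \<open>The slack left after paying \<open>(1 + e) powr p\<close> for splitting the
    gradient; it has to absorb the error caused by the derivative of \<open>bump\<close>.\<close>
  define \<Delta> where "\<Delta> = C - (1 + e) powr p * ?b powr p"
  define P where "P = (1 + 1 / e) powr p"
  have \<Delta>: "\<Delta> > 0" using e by (simp add: \<Delta>_def)
  \<comment> \<open>After division by \<open>L\<close>, the left side bounds the cutoff error and
    the right side is a lower bound for the available slack.\<close>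
  obtain L :: nat where L: "L \<ge> 1" "P * (D / real L) powr p * (4 * k2) < \<Delta> * (exp (-2) powr p * k1)"
  proof -
    have "((\<lambda>n. P * (D / real n) powr p * (4 * k2)) \<longlongrightarrow> P * 0 powr p * (4 * k2)) sequentially"
      using p bd(4) by (intro tendsto_intros tendsto_powr' lim_const_over_n) auto
    moreover have "P * 0 powr p * (4 * k2) < \<Delta> * (exp (-2) powr p * k1)" using p \<Delta> k(1) by simp
    ultimately have "eventually (\<lambda>n. P * (D / real n) powr p * (4 * k2) < \<Delta> * (exp (-2) powr p * k1)) sequentially"
      by (rule order_tendstoD(2))
    moreover have "eventually (\<lambda>n::nat. n \<ge> 1) sequentially" by (rule eventually_ge_at_top)
    ultimately have "eventually (\<lambda>n. n \<ge> 1 \<and> P * (D / real n) powr p * (4 * k2) < \<Delta> * (exp (-2) powr p * k1)) sequentially"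
      by eventually_elim auto
    then show ?thesis using that eventually_happens[of _ sequentially] by auto
  qed
  define T where "T = - ln (R / 2)"
  have T: "exp (- (T + real j)) \<le> R / 2" for j :: nat
  proof -
    have "exp (- (T + real j)) \<le> exp (ln (R / 2))" unfolding T_def by simp
    then show ?thesis using R by simp
  qed
  define \<tau> where "\<tau> x = (- ln (R - N x) - T) / real L" for x
  let ?u = "\<lambda>x. trial T (real L) (N x)"
  let ?W = "\<lambda>x. norm (grad N x) powr p / (R - N x)"
  let ?S = "\<lambda>j x. ennreal (?W x) * indicator (shell (T + real j)) x"
    and ?a = "\<lambda>x. ennreal (?W x * bump (\<tau> x) powr p) * indicator \<Omega> x"
    and ?e = "\<lambda>x. ennreal (?W x * indicator {0..3} (\<tau> x)) * indicator \<Omega> x"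
    and ?c1 = "(1 + e) powr p * ?b powr p" and ?c2 = "P * (D / real L) powr p"
  have Lpos: "real L > 0" using L(1) by simp
  have tu: "test_fun \<Omega> ?u" using test_fun_trial[OF _ Lpos, of T] T[of 0] by simp
  define E where "E = (\<integral>\<^sup>+x. ?e x \<partial>lebesgue)"
  define A where "A = (\<integral>\<^sup>+x. ?a x \<partial>lebesgue)"
  have [measurable]: "\<Omega> \<in> sets lebesgue" using open_N_ball by auto
  have \<tau>_m [measurable]: "\<tau> \<in> borel_measurable lebesgue" unfolding \<tau>_def by measurable
  have [measurable]: "bump \<in> borel_measurable borel"
    by (rule borel_measurable_continuous_onI[OF smooth_on_continuous[OF smooth_bump]])
  have \<tau>_shell: "T + real k \<le> - ln (R - N x)" "- ln (R - N x) < T + real k + 1" if "x \<in> shell (T + real k)" for x k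
  proof -
    have b: "exp (- (T + real k) - 1) < R - N x" "R - N x \<le> exp (- (T + real k))" using that by (auto simp: shell_def)
    have pos: "R - N x > 0" using b(1) exp_gt_zero[of "- (T + real k) - 1"] by linarith
    show "T + real k \<le> - ln (R - N x)" using b(2) pos ln_le_cancel_iff[OF pos exp_gt_zero, of "- (T + real k)"] by simp
    show "- ln (R - N x) < T + real k + 1" using b(1) pos ln_less_cancel_iff[OF exp_gt_zero pos, of "- (T + real k) - 1"] by simp
  qed
  have E_le: "E \<le> ennreal (real L * (4 * k2))"
  proof -
    \<comment> \<open>The closed range from 0 to \<open>3 * L\<close> needs one shell more than
      \<open>3 * L\<close>, for its right end; \<open>3 * L + 1 \<le> 4 * L\<close> is the origin of
      the factor 4.\<close>
    have "E \<le> (\<integral>\<^sup>+x. (\<Sum>j<3 * L + 1. ?S j x) \<partial>lebesgue)"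
      unfolding E_def
    proof (rule nn_integral_mono)
      fix x
      show "?e x \<le> (\<Sum>j<3 * L + 1. ?S j x)"
      proof (cases "x \<in> \<Omega> \<and> \<tau> x \<in> {0..3}")
        case True
        define s where "s = - ln (R - N x) - T"
        have s: "0 \<le> s" "s \<le> 3 * real L" using True Lpos by (auto simp: \<tau>_def s_def field_simps)
        define j where "j = nat \<lfloor>s\<rfloor>"
        have j: "real j \<le> s" "s < real j + 1" using s by (auto simp: j_def)
        have "j < 3 * L + 1" using j s by linarith
        moreover have "x \<in> shell (T + real j)"
        proof -
          have pos: "R - N x > 0" using True by simp
          have "R - N x = exp (- (s + T))" using pos by (simp add: s_def)
          moreover have "exp (- (s + T)) \<le> exp (- (T + real j))" "exp (- (T + real j) - 1) < exp (- (s + T))"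
            using j by simp_all
          ultimately show ?thesis unfolding shell_def mem_Collect_eq by linarith
        qed
        ultimately have "?S j x \<le> (\<Sum>j<3 * L + 1. ?S j x)"
          by (intro member_le_sum) auto
        then show ?thesis using True \<open>x \<in> shell (T + real j)\<close> by simp
      qed auto
    qed
    also have "\<dots> = (\<Sum>j<3 * L + 1. \<integral>\<^sup>+x. ?S j x \<partial>lebesgue)"
      by (rule nn_integral_sum) measurable
    also have "\<dots> \<le> (\<Sum>j<3 * L + 1. ennreal k2)" by (intro sum_mono k(4) T)
    also have "\<dots> = ennreal (real (3 * L + 1) * k2)"
      using k(2) by (subst sum_ennreal) (auto simp: algebra_simps)
    also have "\<dots> \<le> ennreal (real L * (4 * k2))"
      using k(2) L(1) by (intro ennreal_leI) (simp add: algebra_simps)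
    finally show ?thesis .
  qed
  have A_ge: "ennreal (real L * (exp (-2) powr p * k1)) \<le> A"
  proof -
    \<comment> \<open>In the shells with index from \<open>L\<close> to \<open>2 * L - 1\<close> the
      variable \<open>\<tau>\<close> lies between 1 and 2, where \<open>bump\<close> is at least
      \<open>exp (-2)\<close>.\<close>
    have "ennreal (real L * (exp (-2) powr p * k1)) = ennreal (exp (-2) powr p) * (\<Sum>j\<in>{L..<2 * L}. ennreal k1)"
      using k(1) by (subst sum_ennreal) (auto simp: ennreal_mult'[symmetric] mult_ac)
    also have "\<dots> \<le> ennreal (exp (-2) powr p) * (\<Sum>j\<in>{L..<2 * L}. \<integral>\<^sup>+x. ?S j x \<partial>lebesgue)"
      by (intro mult_left_mono sum_mono k(3) T) auto
    also have "\<dots> = ennreal (exp (-2) powr p) * (\<integral>\<^sup>+x. (\<Sum>j\<in>{L..<2 * L}. ?S j x) \<partial>lebesgue)"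
      by (subst nn_integral_sum) measurable
    also have "\<dots> = (\<integral>\<^sup>+x. ennreal (exp (-2) powr p) * (\<Sum>j\<in>{L..<2 * L}. ?S j x) \<partial>lebesgue)"
      by (rule nn_integral_cmult[symmetric]) measurable
    also have "\<dots> \<le> A" unfolding A_def
    proof (rule nn_integral_mono)
      fix x
      have "(\<Sum>j\<in>{L..<2 * L}. ?S j x)
          = ennreal (?W x) * indicator (\<Union>j\<in>{L..<2 * L}. shell (T + real j)) x"
        using disjoint_family_on_mono[OF _ disjoint_shells[of T], of "{L..<2 * L}"]
        by (subst indicator_UN_disjoint) (auto simp: sum_distrib_left)
      moreover have "ennreal (exp (-2) powr p) * (ennreal (?W x) * indicator (\<Union>j\<in>{L..<2 * L}. shell (T + real j)) x)
          \<le> ?a x"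
      proof (cases "x \<in> (\<Union>j\<in>{L..<2 * L}. shell (T + real j))")
        case True
        then obtain j where j: "L \<le> j" "j < 2 * L" "x \<in> shell (T + real j)" by auto
        have xO: "N x < R" using j(3) exp_gt_zero[of "- (T + real j) - 1"] unfolding shell_def mem_Collect_eq by linarith
        have "real L \<le> - ln (R - N x) - T" "- ln (R - N x) - T \<le> 2 * real L"
          using \<tau>_shell[OF j(3)] j(1,2) by linarith+
        then have "1 \<le> \<tau> x" "\<tau> x \<le> 2" unfolding \<tau>_def using Lpos by (auto simp: field_simps)
        then have "exp (-2) powr p \<le> bump (\<tau> x) powr p" using p by (intro powr_mono2 bump_bounds) auto
        then have "exp (-2) powr p * ?W x \<le> ?W x * bump (\<tau> x) powr p"
          using xO by (subst mult.commute) (intro mult_left_mono, auto)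
        then show ?thesis using True xO by (simp add: ennreal_mult'[symmetric] ennreal_leI)
      qed simp
      ultimately show "ennreal (exp (-2) powr p) * (\<Sum>j\<in>{L..<2 * L}. ?S j x)
          \<le> ?a x" by simp
    qed
    finally show ?thesis .
  qed
  have A_le_E: "A \<le> E" unfolding A_def E_def
  proof (rule nn_integral_mono)
    fix x
    show "?a x \<le> ?e x"
    proof (cases "x \<in> \<Omega>")
      case True
      have "bump (\<tau> x) powr p \<le> indicator {0..3} (\<tau> x)"
        using bump_bounds[of "\<tau> x"] p powr_mono2[of p "bump (\<tau> x)" 1] by (auto simp: indicator_def)
      then have "?W x * bump (\<tau> x) powr p \<le> ?W x * indicator {0..3} (\<tau> x)"
        using True by (intro mult_left_mono) auto
      then show ?thesis using True by (simp add: ennreal_leI)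
    qed simp
  qed
  note ae = AE_lebesgue_neq[of "0 :: real^'n"]
  have LHS: "(\<integral>\<^sup>+x\<in>\<Omega>. ennreal (hw ?u x) \<partial>lebesgue) = A"
    unfolding A_def
  proof (rule nn_integral_cong)
    fix x
    show "ennreal (hw ?u x) * indicator \<Omega> x
        = ?a x"
    proof (cases "x \<in> \<Omega>")
      case True
      then have r: "R - N x > 0" by simp
      have "\<bar>?u x\<bar> powr p = (R - N x) powr (p - 1) * bump (\<tau> x) powr p"
        using True p bump_bounds(1) by (simp add: trial_def \<tau>_def abs_mult powr_mult powr_powr)
      moreover have "(R - N x) powr (p - 1) / (R - N x) powr p = 1 / (R - N x)"
        using r powr_diff[of "R - N x" "p - 1" p] by (simp add: powr_minus_divide)
      ultimately have "\<bar>?u x\<bar> powr p / (R - N x) powr p = 1 / (R - N x) * bump (\<tau> x) powr p"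
        by (metis times_divide_eq_left)
      then show ?thesis by (simp add: mult_ac)
    qed simp
  qed
  have RHS: "(\<integral>\<^sup>+x\<in>\<Omega>. ennreal (norm (grad ?u x) powr p) \<partial>lebesgue)
      \<le> ennreal ?c1 * A + ennreal ?c2 * E"
  proof -
    have "(\<integral>\<^sup>+x\<in>\<Omega>. ennreal (norm (grad ?u x) powr p) \<partial>lebesgue)
      \<le> (\<integral>\<^sup>+x. ennreal ?c1 * (?a x)
          + ennreal ?c2 * (?e x) \<partial>lebesgue)"
    proof (rule nn_integral_mono_AE, use ae in eventually_elim)
      fix x :: "real^'n" assume x: "x \<noteq> 0"
      show "ennreal (norm (grad ?u x) powr p) * indicator \<Omega> x
        \<le> ennreal ?c1 * (?a x)
          + ennreal ?c2 * (?e x)"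
      proof (cases "x \<in> \<Omega>")
        case True
        then have r: "R - N x > 0" "N x < R" by auto
        let ?y = "bump' (\<tau> x) / real L - ?b * bump (\<tau> x)"
        have "grad ?u x = ((R - N x) powr (- 1 / p) * ?y) *\<^sub>R grad N x"
          unfolding \<tau>_def by (rule hgrad_compose[OF N_differentiable[OF x] trial_derivative[OF bd(1) r(2) Lpos]])
        then have "norm (grad ?u x) powr p = ((R - N x) powr (- 1 / p)) powr p * \<bar>?y\<bar> powr p * norm (grad N x) powr p"
          by (simp add: abs_mult powr_mult)
        also have "((R - N x) powr (- 1 / p)) powr p = 1 / (R - N x)"
          unfolding powr_powr using p r by (simp add: powr_minus_divide)
        finally have g: "norm (grad ?u x) powr p = ?W x * \<bar>?y\<bar> powr p" by simp
        have "\<bar>?y\<bar> \<le> ?b * bump (\<tau> x) + \<bar>bump' (\<tau> x)\<bar> / real L"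
          using bump_bounds(1)[of "\<tau> x"] p abs_triangle_ineq4[of "bump' (\<tau> x) / real L" "?b * bump (\<tau> x)"]
          by (simp add: abs_mult)
        then have "\<bar>?y\<bar> powr p \<le> (?b * bump (\<tau> x) + \<bar>bump' (\<tau> x)\<bar> / real L) powr p"
          using p by (intro powr_mono2) auto
        also have "\<dots> \<le> (1 + e) powr p * (?b * bump (\<tau> x)) powr p + P * (\<bar>bump' (\<tau> x)\<bar> / real L) powr p"
          unfolding P_def using p e(1) bump_bounds(1) by (intro powr_add_le_split) auto
        finally have y1: "\<bar>?y\<bar> powr p \<le> (1 + e) powr p * (?b * bump (\<tau> x)) powr p + P * (\<bar>bump' (\<tau> x)\<bar> / real L) powr p" .
        have y2: "P * (\<bar>bump' (\<tau> x)\<bar> / real L) powr p \<le> P * ((D / real L) powr p * indicator {0..3} (\<tau> x))"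
        proof (intro mult_left_mono)
          show "(\<bar>bump' (\<tau> x)\<bar> / real L) powr p \<le> (D / real L) powr p * indicator {0..3} (\<tau> x)"
          using bd(2,3)[of "\<tau> x"] p Lpos by (auto simp: indicator_def intro!: powr_mono2 divide_right_mono)
        qed (simp add: P_def)
        have y3: "(?b * bump (\<tau> x)) powr p = ?b powr p * bump (\<tau> x) powr p"
          using p bump_bounds(1)[of "\<tau> x"] by (simp only: powr_mult)
        have y: "\<bar>?y\<bar> powr p \<le> (1 + e) powr p * ?b powr p * bump (\<tau> x) powr p + P * (D / real L) powr p * indicator {0..3} (\<tau> x)"
          using y1 y2 unfolding y3 by (simp only: mult.assoc)
        have W0: "?W x \<ge> 0" using r by simp
        have "norm (grad ?u x) powr p \<le> ((1 + e) powr p * ?b powr p) * (?W x * bump (\<tau> x) powr p)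
            + (P * (D / real L) powr p) * (?W x * indicator {0..3} (\<tau> x))"
          unfolding g using mult_left_mono[OF y W0] by (simp add: algebra_simps)
        then have "ennreal (norm (grad ?u x) powr p) \<le> ennreal (((1 + e) powr p * ?b powr p) * (?W x * bump (\<tau> x) powr p)
            + (P * (D / real L) powr p) * (?W x * indicator {0..3} (\<tau> x)))" by (rule ennreal_leI)
        also have "\<dots> = ennreal ?c1 * ennreal (?W x * bump (\<tau> x) powr p)
            + ennreal ?c2 * ennreal (?W x * indicator {0..3} (\<tau> x))"
        proof -
          have "ennreal (a * x + b * y) = ennreal a * ennreal x + ennreal b * ennreal y"
            if "a \<ge> 0" "x \<ge> 0" "b \<ge> 0" "y \<ge> 0" for a b x y :: real
            using that by (simp add: ennreal_mult)
          then show ?thesis using W0 by (simp only: P_def mult_nonneg_nonneg powr_ge_zero indicator_pos_le)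
        qed
        finally show ?thesis using True by simp
      qed simp
    qed
    also have "\<dots> = ennreal ?c1 * A + ennreal ?c2 * E"
      unfolding A_def E_def
      by (subst nn_integral_add, measurable, subst nn_integral_cmult, measurable, subst nn_integral_cmult, measurable)
    finally show ?thesis .
  qed
  \<comment> \<open>A strict inequality between multiples of \<open>A\<close> requires finite
    values; with these it is settled in the reals.\<close>
  have "E < \<infinity>" using le_less_trans[OF E_le] by simp
  moreover from this have "A < \<infinity>" using le_less_trans[OF A_le_E] by blast
  ultimately obtain E' A' where EA: "E = ennreal E'" "E' \<ge> 0" "A = ennreal A'" "A' \<ge> 0"
    by (cases E; cases A) auto
  have E': "E' \<le> real L * (4 * k2)" using E_le EA k Lpos by (simp add: ennreal_le_iff)
  have A': "real L * (exp (-2) powr p * k1) \<le> A'" using A_ge EA k Lpos by (simp add: ennreal_le_iff)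
  have "(1 + e) powr p * ?b powr p * A' + P * (D / real L) powr p * E' < C * A'"
  proof -
    have "P * (D / real L) powr p * E' \<le> P * (D / real L) powr p * (real L * (4 * k2))"
      using E' by (intro mult_left_mono) (auto simp: P_def)
    also have "\<dots> = real L * (P * (D / real L) powr p * (4 * k2))" by simp
    also have "\<dots> < real L * (\<Delta> * (exp (-2) powr p * k1))" using L Lpos by (intro mult_strict_left_mono) auto
    also have "\<dots> \<le> \<Delta> * A'" using mult_left_mono[OF A', of \<Delta>] \<Delta> by (simp add: mult_ac)
    finally show ?thesis unfolding \<Delta>_def by (simp add: left_diff_distrib)
  qed
  then have "ennreal ?c1 * A + ennreal ?c2 * E < ennreal C * A"
    unfolding EA using EA C0
    by (simp add: ennreal_mult'[symmetric] ennreal_plus[symmetric] ennreal_less_iff P_def del: ennreal_plus)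
  then have "\<not> (ennreal C * (\<integral>\<^sup>+x\<in>\<Omega>. ennreal (hw ?u x) \<partial>lebesgue)
      \<le> (\<integral>\<^sup>+x\<in>\<Omega>. ennreal (norm (grad ?u x) powr p) \<partial>lebesgue))"
    unfolding LHS using RHS by (meson leD order_trans)
  then show ?thesis using D1p_test_fun[OF tu] by blast
qed

end

theorem mainTheorem17:
  fixes gmul :: "real^'n::finite \<Rightarrow> real^'n \<Rightarrow> real^'n"
    and ginv :: "real^'n \<Rightarrow> real^'n"
    and deg :: "'n \<Rightarrow> nat"
    and N2 :: "real^'n \<Rightarrow> real"
    and p R :: real
  assumes G: "carnot_group gmul ginv deg"
    and N2: "fund_norm gmul deg N2"
    and p: "p > 1"
    and harm: "Lp_harmonic gmul deg p (UNIV - {0}) (Gamma_p deg N2 p)"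
    and R: "R > 0"
  defines "\<Omega> \<equiv> {\<xi>. N2 \<xi> < R}"
  shows
    "(\<forall>u g. D1p gmul deg p \<Omega> u g \<longrightarrow>
        ennreal (((p - 1) / p) powr p) *
          (\<integral>\<^sup>+\<xi>\<in>\<Omega>. ennreal (\<bar>u \<xi>\<bar> powr p / (R - N2 \<xi>) powr p * norm (hgrad gmul deg N2 \<xi>) powr p) \<partial>lebesgue)
        \<le> (\<integral>\<^sup>+\<xi>\<in>\<Omega>. ennreal (norm (g \<xi>) powr p) \<partial>lebesgue))
   \<and> (\<forall>C. C > ((p - 1) / p) powr p \<longrightarrow>
        (\<exists>u g. D1p gmul deg p \<Omega> u g \<and>
          \<not> (ennreal C *
               (\<integral>\<^sup>+\<xi>\<in>\<Omega>. ennreal (\<bar>u \<xi>\<bar> powr p / (R - N2 \<xi>) powr p * norm (hgrad gmul deg N2 \<xi>) powr p) \<partial>lebesgue)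
             \<le> (\<integral>\<^sup>+\<xi>\<in>\<Omega>. ennreal (norm (g \<xi>) powr p) \<partial>lebesgue))))
   \<and> (let C2 = real_of_ereal (esssup lebesgue (\<lambda>\<xi>. ereal (norm (hgrad gmul deg N2 \<xi>))));
          c = (p - 1) / p * (1 / C2);
          \<delta> = (\<lambda>\<xi>. Inf ((\<lambda>\<eta>. d_CC gmul deg \<xi> \<eta>) ` frontier \<Omega>))
      in \<forall>u g. D1p gmul deg p \<Omega> u g \<longrightarrow>
        ennreal (c powr p) *
          (\<integral>\<^sup>+\<xi>\<in>\<Omega>. ennreal (\<bar>u \<xi>\<bar> powr p / \<delta> \<xi> powr p * norm (hgrad gmul deg N2 \<xi>) powr p) \<partial>lebesgue)
        \<le> (\<integral>\<^sup>+\<xi>\<in>\<Omega>. ennreal (norm (g \<xi>) powr p) \<partial>lebesgue))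
   \<and> (is_distance (\<lambda>\<xi> \<eta>. N2 (gmul (ginv \<xi>) \<eta>)) \<longrightarrow>
      (let c = (p - 1) / p;
           \<delta> = (\<lambda>\<xi>. Inf ((\<lambda>\<eta>. N2 (gmul (ginv \<xi>) \<eta>)) ` frontier \<Omega>))
       in \<forall>u g. D1p gmul deg p \<Omega> u g \<longrightarrow>
        ennreal (c powr p) *
          (\<integral>\<^sup>+\<xi>\<in>\<Omega>. ennreal (\<bar>u \<xi>\<bar> powr p / \<delta> \<xi> powr p * norm (hgrad gmul deg N2 \<xi>) powr p) \<partial>lebesgue)
        \<le> (\<integral>\<^sup>+\<xi>\<in>\<Omega>. ennreal (norm (g \<xi>) powr p) \<partial>lebesgue)))"
proof -
  interpret hardy gmul ginv deg N2 p R
    by unfold_locales (use assms in auto)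
  have meas: "u \<in> borel_measurable lebesgue" if "D1p gmul deg p {\<xi>. N2 \<xi> < R} u g" for u g
    using that unfolding D1p_def by blast
  note cc = order_trans[OF hardy_weight_transfer[OF p C2_pos meas d_CC_frontier_ge[OF R]] hardy_D1p]
  \<comment> \<open>Case (b) is the instance \<open>C = 1\<close> of the weight transfer; the
    division by 1 only matches its form.\<close>
  have dist: "(R - N2 \<xi>) / 1 \<le> Inf ((\<lambda>\<eta>. N2 (gmul (ginv \<xi>) \<eta>)) ` frontier {\<xi>. N2 \<xi> < R})"
    if "is_distance (\<lambda>\<xi> \<eta>. N2 (gmul (ginv \<xi>) \<eta>))" for \<xi>
    using norm_distance_frontier_ge[OF R that] by simp
  note nd = order_trans[OF hardy_weight_transfer[OF p zero_less_one meas dist] hardy_D1p, simplified div_by_1 mult_1_right]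
  show ?thesis
    unfolding \<Omega>_def Let_def C2_def[symmetric]
    by (intro conjI allI impI hardy_D1p hardy_optimal cc nd)
qed

end
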